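(* Let $k$ be an algebraically closed field, and let $\mathfrak{u}\subseteq\mathfrak{sl}_3$ be the Lie algebra of strictly lower triangular $3\times 3$ matrices over $k$. For each $r\ge 1$, the variety $C_r(\mathfrak{u})$ is: (a) irreducible of dimension $2r+1$; (b) singular at the point $$X=\left(\begin{pmatrix} 0 & 0 & 0 \\ 0 & 0 & 0 \\ y_1 & 0 & 0 \end{pmatrix},\ldots,\begin{pmatrix} 0 & 0 & 0 \\ 0 & 0 & 0 \\ y_r & 0 & 0 \end{pmatrix}\right)$$ with $y_1,\ldots,y_r\in k$; (c) Cohen-Macaulay and normal.
   Context: $C_r(\mathfrak{u})=\{(u_1,\ldots,u_r)\in\mathfrak{u}^r\mid [u_i,u_j]=0\text{ for all }1\le i\le j\le r\}$, a closed subvariety of the affine space $\mathfrak{u}^r$, taken with its reduced structure. A variety is Cohen-Macaulay (resp. normal) if its coordinate ring is Cohen-Macaulay (resp. normal).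
   Formalization: Part (b) is stated only for r ≥ 2: for r = 1 the commuting condition is empty, so C_1(u) = u is affine 3-space, which is smooth at every point, and (b) is false there; (a) and (c) are stated for all r ≥ 1. *)

theory Defs
  imports
    "HOL-Computational_Algebra.Polynomial"
    "HOL-Library.Poly_Mapping"
    "HOL-Library.Extended_Nat"
    "Jordan_Normal_Form.Matrix"
    "HOL-Algebra.Algebra"
begin

section \<open>Commutative algebra\<close>

subsection \<open>Localization\<close>

definition frac_rel :: "('a, 'm) ring_scheme \<Rightarrow> 'a set \<Rightarrow> (('a \<times> 'a) \<times> ('a \<times> 'a)) set" where
  "frac_rel R S = {((a, s), (b, t)). a \<in> carrier R \<and> b \<in> carrier R \<and> s \<in> S \<and> t \<in> S \<and>
     (\<exists>u\<in>S. u \<otimes>\<^bsub>R\<^esub> (t \<otimes>\<^bsub>R\<^esub> a \<ominus>\<^bsub>R\<^esub> s \<otimes>\<^bsub>R\<^esub> b) = \<zero>\<^bsub>R\<^esub>)}"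

definition ring_frac :: "('a, 'm) ring_scheme \<Rightarrow> 'a set \<Rightarrow> 'a \<Rightarrow> 'a \<Rightarrow> ('a \<times> 'a) set" where
  "ring_frac R S a s = frac_rel R S `` {(a, s)}"

text \<open>\<open>localization R S\<close> is \<open>S\<^sup>-\<^sup>1R\<close>, for a multiplicatively closed subset \<open>S\<close>.\<close>

definition localization :: "('a, 'm) ring_scheme \<Rightarrow> 'a set \<Rightarrow> ('a \<times> 'a) set ring" where
  "localization R S =
    \<lparr>carrier = (carrier R \<times> S) // frac_rel R S,
     mult = (\<lambda>A B. \<Union>(a, s)\<in>A. \<Union>(b, t)\<in>B. ring_frac R S (a \<otimes>\<^bsub>R\<^esub> b) (s \<otimes>\<^bsub>R\<^esub> t)),
     one = ring_frac R S \<one>\<^bsub>R\<^esub> \<one>\<^bsub>R\<^esub>,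
     ring.zero = ring_frac R S \<zero>\<^bsub>R\<^esub> \<one>\<^bsub>R\<^esub>,
     add = (\<lambda>A B. \<Union>(a, s)\<in>A. \<Union>(b, t)\<in>B.
              ring_frac R S (t \<otimes>\<^bsub>R\<^esub> a \<oplus>\<^bsub>R\<^esub> s \<otimes>\<^bsub>R\<^esub> b) (s \<otimes>\<^bsub>R\<^esub> t))\<rparr>"

definition localization_at :: "('a, 'm) ring_scheme \<Rightarrow> 'a set \<Rightarrow> ('a \<times> 'a) set ring" where
  "localization_at R P = localization R (carrier R - P)"

definition fraction_field :: "('a, 'm) ring_scheme \<Rightarrow> ('a \<times> 'a) set ring" where
  "fraction_field R = localization R (carrier R - {\<zero>\<^bsub>R\<^esub>})"

definition to_fraction_field :: "('a, 'm) ring_scheme \<Rightarrow> 'a \<Rightarrow> ('a \<times> 'a) set" where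
  "to_fraction_field R a = ring_frac R (carrier R - {\<zero>\<^bsub>R\<^esub>}) a \<one>\<^bsub>R\<^esub>"

subsection \<open>Krull dimension, depth, regularity, the Cohen-Macaulay property\<close>

text \<open>The supremum of the empty set in \<open>enat\<close> is \<open>0\<close>, so the zero ring gets dimension \<open>0\<close>.\<close>

definition krull_dim :: "('a, 'm) ring_scheme \<Rightarrow> enat" where
  "krull_dim R = Sup {enat n | n. \<exists>P :: nat \<Rightarrow> 'a set.
     (\<forall>i\<le>n. primeideal (P i) R) \<and> (\<forall>i<n. P i \<subset> P (Suc i))}"

definition noetherian_local_ring :: "('a, 'm) ring_scheme \<Rightarrow> bool" where
  "noetherian_local_ring R \<longleftrightarrow> cring R \<and> noetherian_ring R \<and> (\<exists>!M. maximalideal M R)"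

definition max_ideal :: "('a, 'm) ring_scheme \<Rightarrow> 'a set" where
  "max_ideal R = (THE M. maximalideal M R)"

definition regular_local_ring :: "('a, 'm) ring_scheme \<Rightarrow> bool" where
  "regular_local_ring R \<longleftrightarrow> noetherian_local_ring R \<and>
     (\<exists>A\<subseteq>carrier R. finite A \<and> enat (card A) = krull_dim R \<and> max_ideal R = Idl\<^bsub>R\<^esub> A)"

definition regular_sequence :: "('a, 'm) ring_scheme \<Rightarrow> 'a list \<Rightarrow> bool" where
  "regular_sequence R xs \<longleftrightarrow> set xs \<subseteq> carrier R \<and> Idl\<^bsub>R\<^esub> (set xs) \<noteq> carrier R \<and>
     (\<forall>i<length xs. \<forall>a\<in>carrier R. xs ! i \<otimes>\<^bsub>R\<^esub> a \<in> Idl\<^bsub>R\<^esub> (set (take i xs)) \<longrightarrow>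
        a \<in> Idl\<^bsub>R\<^esub> (set (take i xs)))"

definition local_depth :: "('a, 'm) ring_scheme \<Rightarrow> enat" where
  "local_depth R =
     Sup {enat (length xs) | xs. regular_sequence R xs \<and> set xs \<subseteq> max_ideal R}"

definition cohen_macaulay_local :: "('a, 'm) ring_scheme \<Rightarrow> bool" where
  "cohen_macaulay_local R \<longleftrightarrow> noetherian_local_ring R \<and> local_depth R = krull_dim R"

definition cohen_macaulay :: "('a, 'm) ring_scheme \<Rightarrow> bool" where
  "cohen_macaulay R \<longleftrightarrow> cring R \<and> noetherian_ring R \<and>
     (\<forall>M. maximalideal M R \<longrightarrow> cohen_macaulay_local (localization_at R M))"

subsection \<open>Normality\<close>

text \<open>\<open>p\<close> is a list of coefficients in the subring \<open>A\<close> of \<open>K\<close>, leading coefficient first, so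
  \<open>hd p = \<one>\<^bsub>K\<^esub>\<close> says that it is monic.\<close>

definition integral_over :: "('a, 'm) ring_scheme \<Rightarrow> 'a set \<Rightarrow> 'a \<Rightarrow> bool" where
  "integral_over K A x \<longleftrightarrow>
     (\<exists>p\<in>carrier (A[X]\<^bsub>K\<^esub>). p \<noteq> [] \<and> hd p = \<one>\<^bsub>K\<^esub> \<and> ring.eval K p x = \<zero>\<^bsub>K\<^esub>)"

definition normal_domain :: "('a, 'm) ring_scheme \<Rightarrow> bool" where
  "normal_domain R \<longleftrightarrow> domain R \<and>
     (\<forall>x\<in>carrier (fraction_field R).
        integral_over (fraction_field R) (to_fraction_field R ` carrier R) x \<longrightarrow>
        x \<in> to_fraction_field R ` carrier R)"

section \<open>Affine varieties\<close>

text \<open>The affine space with coordinates indexed by a finite set \<open>I\<close> is \<open>I \<rightarrow>\<^sub>E UNIV\<close>, over the field \<open>'k\<close>.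
  A polynomial maps monomials (exponent functions of finite support) to coefficients.\<close>

definition mpoly_ring :: "'v set \<Rightarrow> (('v \<Rightarrow>\<^sub>0 nat) \<Rightarrow>\<^sub>0 'k::comm_ring_1) ring" where
  "mpoly_ring I = \<lparr>carrier = {p. \<forall>m\<in>Poly_Mapping.keys p. Poly_Mapping.keys m \<subseteq> I}, mult = (*), one = 1, ring.zero = 0, add = (+)\<rparr>"

definition mpoly_eval :: "('v \<Rightarrow> 'k) \<Rightarrow> (('v \<Rightarrow>\<^sub>0 nat) \<Rightarrow>\<^sub>0 'k::comm_ring_1) \<Rightarrow> 'k" where
  "mpoly_eval x p = (\<Sum>m\<in>Poly_Mapping.keys p. Poly_Mapping.lookup p m * (\<Prod>v\<in>Poly_Mapping.keys m. x v ^ Poly_Mapping.lookup m v))"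

definition zariski_closed :: "'v set \<Rightarrow> ('v \<Rightarrow> 'k::field) set \<Rightarrow> bool" where
  "zariski_closed I Z \<longleftrightarrow>
     (\<exists>F\<subseteq>carrier (mpoly_ring I). Z = {x \<in> I \<rightarrow>\<^sub>E UNIV. \<forall>p\<in>F. mpoly_eval x p = 0})"

definition zariski_irreducible :: "'v set \<Rightarrow> ('v \<Rightarrow> 'k::field) set \<Rightarrow> bool" where
  "zariski_irreducible I V \<longleftrightarrow> V \<noteq> {} \<and>
     (\<forall>Z1 Z2. zariski_closed I Z1 \<and> zariski_closed I Z2 \<and> V \<subseteq> Z1 \<union> Z2 \<longrightarrow> V \<subseteq> Z1 \<or> V \<subseteq> Z2)"

definition variety_dim :: "'v set \<Rightarrow> ('v \<Rightarrow> 'k::field) set \<Rightarrow> enat" where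
  "variety_dim I V = Sup {enat n | n. \<exists>Z :: nat \<Rightarrow> ('v \<Rightarrow> 'k) set.
     (\<forall>i\<le>n. zariski_closed I (Z i) \<and> zariski_irreducible I (Z i) \<and> Z i \<subseteq> V) \<and>
     (\<forall>i<n. Z i \<subset> Z (Suc i))}"

definition vanishing_ideal ::
    "'v set \<Rightarrow> ('v \<Rightarrow> 'k::field) set \<Rightarrow> (('v \<Rightarrow>\<^sub>0 nat) \<Rightarrow>\<^sub>0 'k) set" where
  "vanishing_ideal I V = {p \<in> carrier (mpoly_ring I). \<forall>x\<in>V. mpoly_eval x p = 0}"

text \<open>Dividing by the ideal of all polynomials vanishing on \<open>V\<close> gives \<open>V\<close> its reduced structure.\<close>

definition coordinate_ring ::
    "'v set \<Rightarrow> ('v \<Rightarrow> 'k::field) set \<Rightarrow> (('v \<Rightarrow>\<^sub>0 nat) \<Rightarrow>\<^sub>0 'k) set ring" where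
  "coordinate_ring I V = mpoly_ring I Quot vanishing_ideal I V"

definition point_ideal ::
    "'v set \<Rightarrow> ('v \<Rightarrow> 'k::field) set \<Rightarrow> ('v \<Rightarrow> 'k) \<Rightarrow> (('v \<Rightarrow>\<^sub>0 nat) \<Rightarrow>\<^sub>0 'k) set set" where
  "point_ideal I V x =
     {vanishing_ideal I V +>\<^bsub>mpoly_ring I\<^esub> p | p. p \<in> carrier (mpoly_ring I) \<and> mpoly_eval x p = 0}"

definition singular_at :: "'v set \<Rightarrow> ('v \<Rightarrow> 'k::field) set \<Rightarrow> ('v \<Rightarrow> 'k) \<Rightarrow> bool" where
  "singular_at I V x \<longleftrightarrow> x \<in> V \<and>
     \<not> regular_local_ring (localization_at (coordinate_ring I V) (point_ideal I V x))"

section \<open>Commuting tuples of strictly lower triangular matrices\<close>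

text \<open>Matrix entries are indexed from \<open>0\<close>.\<close>

definition lie_u :: "'k::field mat set" where
  "lie_u = {A \<in> carrier_mat 3 3. \<forall>i<3. \<forall>j<3. i \<le> j \<longrightarrow> A $$ (i, j) = 0}"

definition commuting_tuples :: "nat \<Rightarrow> (nat \<Rightarrow> 'k::field mat) set" where
  "commuting_tuples r = {u \<in> {1..r} \<rightarrow>\<^sub>E lie_u.
     \<forall>i j. 1 \<le> i \<and> i \<le> j \<and> j \<le> r \<longrightarrow> u i * u j - u j * u i = 0\<^sub>m 3 3}"

text \<open>The entries below the diagonal identify \<open>lie_u\<^sup>r\<close> with an affine space of dimension \<open>3 * r\<close>;
  \<open>(i, a, b)\<close> stands for the entry \<open>(a, b)\<close> of the \<open>i\<close>-th matrix.\<close>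

definition u_index :: "nat \<Rightarrow> (nat \<times> nat \<times> nat) set" where
  "u_index r = {(i, a, b). 1 \<le> i \<and> i \<le> r \<and> b < a \<and> a < 3}"

definition u_coords :: "nat \<Rightarrow> (nat \<Rightarrow> 'k::field mat) \<Rightarrow> (nat \<times> nat \<times> nat \<Rightarrow> 'k)" where
  "u_coords r u = (\<lambda>(i, a, b)\<in>u_index r. u i $$ (a, b))"

definition commuting_variety :: "nat \<Rightarrow> (nat \<times> nat \<times> nat \<Rightarrow> 'k::field) set" where
  "commuting_variety r = u_coords r ` commuting_tuples r"

definition corner_tuple :: "nat \<Rightarrow> (nat \<Rightarrow> 'k) \<Rightarrow> (nat \<Rightarrow> 'k::field mat)" where
  "corner_tuple r y = (\<lambda>i\<in>{1..r}. mat 3 3 (\<lambda>(a, b). if a = 2 \<and> b = 0 then y i else 0))"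

end

theory Submission
  imports Defs "HOL-Library.Product_Lexorder" "HOL-Library.Function_Algebras"
begin

text \<open>Writing \<open>a\<^sub>i, b\<^sub>i, c\<^sub>i\<close> for the entries \<open>(1, 0), (2, 1), (2, 0)\<close> of \<open>u\<^sub>i\<close>, commutativity says
  \<open>a\<^sub>i b\<^sub>j = a\<^sub>j b\<^sub>i\<close>, so the points are \<open>a = s w, b = t w\<close> with \<open>c\<close> arbitrary. Any two of them are joined by
  a polynomial curve, whence irreducibility, and setting \<open>t = 1\<close> identifies the coordinate ring with the ring
  spanned by the monomials in \<open>w\<^sub>i, \<zeta> w\<^sub>i, c\<^sub>i\<close>. It lies in a polynomial ring in \<open>2r + 1\<close> variables,
  so any \<open>2r + 2\<close> of its elements are algebraically dependent, which bounds the lengths of chains of primes. It is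
  normal because the monoid of exponents is. It is free over the polynomial ring in the \<open>2r + 1\<close> elements
  \<open>a\<^sub>1, b\<^sub>i - a\<^sub>i\<^sub>+\<^sub>1, b\<^sub>r, c\<^sub>i\<close>; by the Nullstellensatz every maximal ideal contains these elements minus
  suitable constants, which form a regular sequence of length \<open>2r + 1\<close>. Since depth is at most dimension and the dimension
  is at most \<open>2r + 1\<close>, the ring is Cohen-Macaulay. At a point with \<open>a = b = 0\<close> all coordinate lines stay on
  the variety, so that the tangent space has dimension \<open>3r > 2r + 1\<close> for \<open>r \<ge> 2\<close>.\<close>

section \<open>Prime ideals and regular sequences\<close>

text \<open>The equations are the 2 by 2 minors of the matrix with rows a and b, and the parameters
  come from sliding one row against the other. Set a_1 = 0, b_i = a_(i+1) and b_r = 0: the minors of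
  neighbouring columns then give b_i^2 = 0 for i < r, so all entries vanish. Hence these r + 1
  linear forms are a system of parameters for the matrices of rank at most one, a cone of dimension
  r + 1, and the r basis elements count the degree of the Segre embedding of P^1 x P^(r-1).

  Maximal ideals away from the origin are the reason for the constants: by freeness the parameters
  behave like the variables of a polynomial ring, and variables minus constants still form a regular
  sequence. Here algebraic closedness is used through the residue fields, which must be k; elsewhere
  it is used through the infinity of k.

  Derivations are linear coefficients along coordinate lines, which makes sense in every
  characteristic. Normality passes through divisibility of powers, because leading monomials control
  divisibility but not integral equations.\<close>

lemma (in cring) idealI_mult:
  assumes "I \<subseteq> carrier R" "\<zero> \<in> I" "\<And>a b. a \<in> I \<Longrightarrow> b \<in> I \<Longrightarrow> a \<oplus> b \<in> I"
    "\<And>r a. r \<in> carrier R \<Longrightarrow> a \<in> I \<Longrightarrow> r \<otimes> a \<in> I"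
  shows "ideal I R"
proof (rule idealI)
  show "ring R" by (rule ring_axioms)
  show "subgroup I (add_monoid R)"
  proof
    fix x assume x: "x \<in> I"
    have "(\<ominus> \<one>) \<otimes> x \<in> I" using x assms by auto
    moreover have "(\<ominus> \<one>) \<otimes> x = \<ominus> x" using x assms(1) l_minus[of \<one> x] by auto
    ultimately show "inv\<^bsub>add_monoid R\<^esub> x \<in> I" by (simp add: a_inv_def)
  qed (use assms in auto)
  show "\<And>a x. a \<in> I \<Longrightarrow> x \<in> carrier R \<Longrightarrow> x \<otimes> a \<in> I" using assms by auto
  show "\<And>a x. a \<in> I \<Longrightarrow> x \<in> carrier R \<Longrightarrow> a \<otimes> x \<in> I" using assms m_comm by (metis subsetD)
qed

lemma (in cring) ideal_mult_left: "ideal I R \<Longrightarrow> r \<in> carrier R \<Longrightarrow> a \<in> I \<Longrightarrow> r \<otimes> a \<in> I"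
  by (simp add: ideal.I_l_closed)

lemma (in cring) ideal_zero_mem: "ideal I R \<Longrightarrow> \<zero> \<in> I"
  by (simp add: additive_subgroup.zero_closed ideal.axioms(1))

lemma (in cring) ideal_add_mem: "ideal I R \<Longrightarrow> a \<in> I \<Longrightarrow> b \<in> I \<Longrightarrow> a \<oplus> b \<in> I"
  by (simp add: additive_subgroup.a_closed ideal.axioms(1))

lemma (in cring) ideal_carrier: "ideal I R \<Longrightarrow> a \<in> I \<Longrightarrow> a \<in> carrier R"
  by (rule ideal.Icarr)

text \<open>Zorn's lemma provides an ideal \<open>Q\<close> maximal among those containing
  \<open>I\<close> and missing \<open>S\<close>. If \<open>a\<close> and \<open>b\<close> lie
  outside \<open>Q\<close>, then \<open>Q\<close> enlarged by either one meets \<open>S\<close>; the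
  product of two such elements lies in \<open>S\<close>, and also in \<open>Q\<close> as soon as
  \<open>a \<otimes> b\<close> does. Hence \<open>Q\<close> is prime.\<close>

lemma (in cring) exists_prime_avoiding:
  assumes I: "ideal I R" and one: "\<one> \<in> S" and mult: "\<And>s t. s \<in> S \<Longrightarrow> t \<in> S \<Longrightarrow> s \<otimes> t \<in> S"
    and disj: "I \<inter> S = {}"
  shows "\<exists>Q. primeideal Q R \<and> I \<subseteq> Q \<and> Q \<inter> S = {}"
proof -
  define A where "A = {J. ideal J R \<and> I \<subseteq> J \<and> J \<inter> S = {}}"
  have "\<exists>M\<in>A. \<forall>J\<in>A. M \<subseteq> J \<longrightarrow> J = M"
  proof (rule subset_Zorn_nonempty)
    show "A \<noteq> {}" using I disj by (auto simp: A_def)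
    fix C assume C: "C \<noteq> {}" "subset.chain A C"
    have "subset.chain {I. ideal I R} C" using C(2) unfolding pred_on.chain_def A_def by auto
    from chain_Union_is_ideal[OF this] C(1) have "ideal (\<Union>C) R" by simp
    moreover have CA: "I \<subseteq> J \<and> J \<inter> S = {}" if "J \<in> C" for J
      using C(2) that unfolding pred_on.chain_def A_def by auto
    ultimately show "\<Union>C \<in> A" using C(1) unfolding A_def by (simp, intro conjI) (fastforce, blast)
  qed
  then obtain Q where "Q \<in> A" and A: "\<And>J. J \<in> A \<Longrightarrow> Q \<subseteq> J \<Longrightarrow> J = Q" by auto
  then have Q: "ideal Q R" "I \<subseteq> Q" "Q \<inter> S = {}" by (auto simp: A_def)
  have max: "J = Q" if "ideal J R" "I \<subseteq> J" "J \<inter> S = {}" "Q \<subseteq> J" for J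
    using A[of J] that by (simp add: A_def)
  have Qc: "Q \<subseteq> carrier R" using Q(1) ideal_carrier by blast
  have meet: "\<exists>q\<in>Q. \<exists>x\<in>carrier R. q \<oplus> x \<otimes> a \<in> S" if a: "a \<in> carrier R" "a \<notin> Q" for a
  proof -
    let ?W = "{q \<oplus> x \<otimes> a | q x. q \<in> Q \<and> x \<in> carrier R}"
    have X: "ideal ?W R"
    proof (rule idealI_mult)
      show "?W \<subseteq> carrier R" using Qc a by auto
      have "\<zero> = \<zero> \<oplus> \<zero> \<otimes> a" using a by simp
      then show "\<zero> \<in> ?W" using ideal_zero_mem[OF Q(1)] by blast
      fix u v assume "u \<in> ?W" "v \<in> ?W"
      then obtain q x q' x' where *: "u = q \<oplus> x \<otimes> a" "v = q' \<oplus> x' \<otimes> a" "q \<in> Q" "q' \<in> Q"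
        "x \<in> carrier R" "x' \<in> carrier R" by blast
      have "u \<oplus> v = (q \<oplus> q') \<oplus> (x \<oplus> x') \<otimes> a"
        using * a Qc by (simp add: subset_iff l_distr a_ac)
      then show "u \<oplus> v \<in> ?W" using * ideal_add_mem[OF Q(1)] by blast
    next
      fix r u assume r: "r \<in> carrier R" and "u \<in> ?W"
      then obtain q x where *: "u = q \<oplus> x \<otimes> a" "q \<in> Q" "x \<in> carrier R" by blast
      have "r \<otimes> u = (r \<otimes> q) \<oplus> (r \<otimes> x) \<otimes> a" using * a r Qc by (simp add: subset_iff r_distr m_assoc)
      then show "r \<otimes> u \<in> ?W" using * r ideal_mult_left[OF Q(1)] by blast
    qed
    have sub: "Q \<subseteq> ?W"
    proof
      fix q assume "q \<in> Q"
      moreover have "q = q \<oplus> \<zero> \<otimes> a" using a \<open>q \<in> Q\<close> Qc by (simp add: subset_iff)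
      ultimately show "q \<in> ?W" by blast
    qed
    have "a = \<zero> \<oplus> \<one> \<otimes> a" using a by simp
    then have "a \<in> ?W" using ideal_zero_mem[OF Q(1)] by blast
    then have "?W \<noteq> Q" using a by auto
    then have "?W \<inter> S \<noteq> {}" using max[OF X] sub Q(2) by blast
    then show ?thesis by blast
  qed
  have "primeideal Q R"
  proof (rule primeidealI)
    show "carrier R \<noteq> Q" using Q(3) one by auto
    fix a b assume ab: "a \<in> carrier R" "b \<in> carrier R" "a \<otimes> b \<in> Q"
    show "a \<in> Q \<or> b \<in> Q"
    proof (rule ccontr)
      assume n: "\<not> (a \<in> Q \<or> b \<in> Q)"
      obtain q x q' x' where *: "q \<in> Q" "x \<in> carrier R" "q' \<in> Q" "x' \<in> carrier R"
         "q \<oplus> x \<otimes> a \<in> S" "q' \<oplus> x' \<otimes> b \<in> S" using meet[of a] meet[of b] ab n by blast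
      have "(q \<oplus> x \<otimes> a) \<otimes> (q' \<oplus> x' \<otimes> b) = (q' \<oplus> x' \<otimes> b) \<otimes> q \<oplus> ((x \<otimes> a) \<otimes> q' \<oplus> (x \<otimes> x') \<otimes> (a \<otimes> b))"
        using * ab Qc by (simp add: subset_iff l_distr r_distr m_ac a_ac)
      also have "\<dots> \<in> Q" using * ab Qc
        by (intro ideal_add_mem[OF Q(1)] ideal_mult_left[OF Q(1)] ab(3)) auto
      finally show False using mult[OF *(5,6)] Q(3) by auto
    qed
  qed (use Q is_cring in auto)
  then show ?thesis using Q by auto
qed

text \<open>A nonzerodivisor modulo \<open>I\<close> lies in no minimal prime over \<open>I\<close>.
  The set to be avoided consists of the products s x^k with s outside \<open>P\<close>: cancellation
  keeps \<open>I\<close> away from it, the case k = 0 forces the new prime into \<open>P\<close>,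
  and s = 1, k = 1 keeps \<open>x\<close> out of it.\<close>

lemma (in cring) exists_prime_below:
  assumes I: "ideal I R" and P: "primeideal P R" and IP: "I \<subseteq> P" and x: "x \<in> P"
    and nzd: "\<And>a. a \<in> carrier R \<Longrightarrow> x \<otimes> a \<in> I \<Longrightarrow> a \<in> I"
  shows "\<exists>Q. primeideal Q R \<and> I \<subseteq> Q \<and> Q \<subset> P"
proof -
  interpret P: primeideal P R by fact
  have xc: "x \<in> carrier R" using x by (rule P.Icarr)
  let ?S = "{s \<otimes> x [^] (k::nat) | s k. s \<in> carrier R - P}"
  have "1": "\<one> \<notin> P" using P.one_imp_carrier P.I_notcarr by auto
  have "\<exists>Q. primeideal Q R \<and> I \<subseteq> Q \<and> Q \<inter> ?S = {}"
  proof (rule exists_prime_avoiding[OF I])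
    have "\<one> = \<one> \<otimes> x [^] (0::nat)" by simp
    then show "\<one> \<in> ?S" using "1" by blast
    fix s t assume "s \<in> ?S" "t \<in> ?S"
    then obtain a k b l where *: "s = a \<otimes> x [^] (k::nat)" "t = b \<otimes> x [^] (l::nat)"
       "a \<in> carrier R - P" "b \<in> carrier R - P" by blast
    have "s \<otimes> t = (a \<otimes> b) \<otimes> x [^] (k + l)" using * xc by (simp add: nat_pow_mult[symmetric] m_ac)
    moreover have "a \<otimes> b \<in> carrier R - P" using * P.I_prime by auto
    ultimately show "s \<otimes> t \<in> ?S" by blast
  next
    have "s \<otimes> x [^] (k::nat) \<in> I \<Longrightarrow> s \<in> I" if s: "s \<in> carrier R" for s k
    proof (induction k)
      case 0 then show ?case using s by simp
    next
      case (Suc k)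
      have "s \<otimes> x [^] Suc k = x \<otimes> (s \<otimes> x [^] k)" using s xc by (simp add: m_ac)
      then show ?case using Suc nzd[of "s \<otimes> x [^] k"] s xc by auto
    qed
    then show "I \<inter> ?S = {}" using IP by fastforce
  qed
  then obtain Q where Q: "primeideal Q R" "I \<subseteq> Q" "Q \<inter> ?S = {}" by blast
  interpret Q: primeideal Q R by fact
  have "Q \<subseteq> P"
  proof
    fix s assume s: "s \<in> Q"
    have "s = s \<otimes> x [^] (0::nat)" using Q.Icarr[OF s] by simp
    then show "s \<in> P" using Q(3) s Q.Icarr[OF s] by blast
  qed
  moreover have "x \<notin> Q"
  proof
    assume "x \<in> Q"
    moreover have "x = \<one> \<otimes> x [^] (1::nat)" using xc by (simp add: nat_pow_def)
    ultimately show False using Q(3) "1" by blast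
  qed
  ultimately show ?thesis using Q x by blast
qed

text \<open>Starting from a prime over the whole sequence, dropping the last element allows a
  strictly smaller prime over the remaining ones, since that element cancels modulo them. Each
  element thus pays for one step of a descending chain.\<close>

lemma (in cring) length_regular_sequence_le_krull_dim:
  assumes "regular_sequence R xs"
  shows "enat (length xs) \<le> krull_dim R"
proof -
  have xs: "set xs \<subseteq> carrier R" "Idl (set xs) \<noteq> carrier R"
    and reg: "\<And>i a. i < length xs \<Longrightarrow> a \<in> carrier R \<Longrightarrow> xs ! i \<otimes> a \<in> Idl (set (take i xs)) \<Longrightarrow>
        a \<in> Idl (set (take i xs))"
    using assms unfolding regular_sequence_def by auto
  have idl: "ideal (Idl (set (take j xs))) R" for j
    by (rule genideal_ideal) (use xs(1) set_take_subset in fastforce)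
  \<comment> \<open>The top \<open>Q\<close> is arbitrary, so that the smaller prime found in the
    induction step can serve as the top of the shorter chain.\<close>
  have chain: "j \<le> length xs \<Longrightarrow> primeideal Q R \<Longrightarrow> Idl (set (take j xs)) \<subseteq> Q \<Longrightarrow>
      \<exists>c :: nat \<Rightarrow> 'a set. c j = Q \<and> (\<forall>i\<le>j. primeideal (c i) R) \<and> (\<forall>i<j. c i \<subset> c (Suc i))" for j Q
  proof (induction j arbitrary: Q)
    case 0
    then show ?case by (intro exI[of _ "\<lambda>_. Q"]) auto
  next
    case (Suc j)
    have sub: "set (take j xs) \<subseteq> set (take (Suc j) xs)" by (rule set_take_subset_set_take) simp
    have "set (take (Suc j) xs) \<subseteq> carrier R" using xs(1) set_take_subset by fastforce
    then have s: "set (take (Suc j) xs) \<subseteq> Q" using Suc.prems(3) genideal_self by blast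
    have x: "xs ! j \<in> set (take (Suc j) xs)" using Suc.prems(1)
      by (simp add: take_Suc_conv_app_nth)
    have Qi: "ideal Q R" using Suc.prems(2) by (simp add: primeideal_def)
    have "\<exists>Q'. primeideal Q' R \<and> Idl (set (take j xs)) \<subseteq> Q' \<and> Q' \<subset> Q"
    proof (rule exists_prime_below[OF idl Suc.prems(2)])
      show "Idl (set (take j xs)) \<subseteq> Q" using genideal_minimal[OF Qi] s sub by blast
      show "xs ! j \<in> Q" using x s by auto
    qed (use reg Suc.prems in auto)
    then obtain Q' where Q': "primeideal Q' R" "Idl (set (take j xs)) \<subseteq> Q'" "Q' \<subset> Q" by blast
    from Suc.IH[OF _ Q'(1,2)] Suc.prems obtain c :: "nat \<Rightarrow> 'a set"
      where c: "c j = Q'" "\<forall>i\<le>j. primeideal (c i) R" "\<forall>i<j. c i \<subset> c (Suc i)" by auto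
    let ?c = "c(Suc j := Q)"
    have "?c (Suc j) = Q \<and> (\<forall>i\<le>Suc j. primeideal (?c i) R) \<and> (\<forall>i<Suc j. ?c i \<subset> ?c (Suc i))"
      using c Q' Suc.prems(2) by (auto simp: le_Suc_eq less_Suc_eq)
    then show ?case by blast
  qed
  have "\<one> \<notin> Idl (set xs)"
    using ideal.one_imp_carrier[OF genideal_ideal[OF xs(1)]] xs(2) by auto
  then obtain Q where Q: "primeideal Q R" "Idl (set xs) \<subseteq> Q"
    using exists_prime_avoiding[OF genideal_ideal[OF xs(1)], of "{\<one>}"] by auto
  from chain[of "length xs", OF _ Q(1)] Q(2) obtain c :: "nat \<Rightarrow> 'a set" where
     c: "\<forall>i\<le>length xs. primeideal (c i) R" "\<forall>i<length xs. c i \<subset> c (Suc i)" by auto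
  show ?thesis unfolding krull_dim_def by (rule Sup_upper) (use c in blast)
qed

section \<open>Localization\<close>

locale mult_subset = cring R for R (structure) + fixes S
  assumes S_carrier: "S \<subseteq> carrier R" and one_S [simp]: "\<one> \<in> S"
    and mult_S [simp]: "\<And>s t. s \<in> S \<Longrightarrow> t \<in> S \<Longrightarrow> s \<otimes> t \<in> S"
begin

abbreviation "fr \<equiv> ring_frac R S"
abbreviation "L \<equiv> localization R S"

lemma S_carr [simp]: "s \<in> S \<Longrightarrow> s \<in> carrier R" using S_carrier by auto

lemma minus_eq_zero_iff: "a \<in> carrier R \<Longrightarrow> b \<in> carrier R \<Longrightarrow> a \<ominus> b = \<zero> \<longleftrightarrow> a = b"
  by (metis a_minus_def minus_equality minus_minus r_neg a_inv_closed)

lemma frac_rel_iff: "((a, s), (b, t)) \<in> frac_rel R S \<longleftrightarrow>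
   a \<in> carrier R \<and> b \<in> carrier R \<and> s \<in> S \<and> t \<in> S \<and> (\<exists>u\<in>S. u \<otimes> (t \<otimes> a) = u \<otimes> (s \<otimes> b))"
proof -
  have "u \<otimes> (t \<otimes> a \<ominus> s \<otimes> b) = \<zero> \<longleftrightarrow> u \<otimes> (t \<otimes> a) = u \<otimes> (s \<otimes> b)"
    if "a \<in> carrier R" "b \<in> carrier R" "s \<in> S" "t \<in> S" "u \<in> S" for u
  proof -
    have "u \<otimes> (t \<otimes> a \<ominus> s \<otimes> b) = u \<otimes> (t \<otimes> a) \<ominus> u \<otimes> (s \<otimes> b)"
      using that by (simp add: a_minus_def r_distr r_minus)
    then show ?thesis using that minus_eq_zero_iff by simp
  qed
  then show ?thesis unfolding frac_rel_def by auto
qed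

lemma frac_rel_equiv: "equiv (carrier R \<times> S) (frac_rel R S)"
proof (rule equivI)
  show "refl_on (carrier R \<times> S) (frac_rel R S)"
    by (rule refl_onI) (use one_S in \<open>auto simp: frac_rel_iff\<close>)
  show "frac_rel R S \<subseteq> (carrier R \<times> S) \<times> (carrier R \<times> S)" by (auto simp: frac_rel_def)
  show "sym (frac_rel R S)" by (rule symI) (auto simp: frac_rel_iff, metis)
  show "trans (frac_rel R S)"
  proof (rule transI)
    fix x y z assume xy: "(x, y) \<in> frac_rel R S" and yz: "(y, z) \<in> frac_rel R S"
    obtain a s b t c q where e: "x = (a, s)" "y = (b, t)" "z = (c, q)" by (cases x, cases y, cases z)
    from xy yz obtain u v where m: "a \<in> carrier R" "b \<in> carrier R" "c \<in> carrier R" "s \<in> S" "t \<in> S" "q \<in> S"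
      and u: "u \<in> S" "u \<otimes> (t \<otimes> a) = u \<otimes> (s \<otimes> b)" and v: "v \<in> S" "v \<otimes> (q \<otimes> b) = v \<otimes> (t \<otimes> c)"
      unfolding e frac_rel_iff by blast
    have "(u \<otimes> v \<otimes> t) \<otimes> (q \<otimes> a) = (v \<otimes> q) \<otimes> (u \<otimes> (t \<otimes> a))" using m u(1) v(1) by (simp add: m_ac)
    also have "\<dots> = (u \<otimes> s) \<otimes> (v \<otimes> (q \<otimes> b))" unfolding u using m u(1) v(1) by (simp add: m_ac)
    also have "\<dots> = (u \<otimes> v \<otimes> t) \<otimes> (s \<otimes> c)" unfolding v using m u(1) v(1) by (simp add: m_ac)
    finally show "(x, z) \<in> frac_rel R S" unfolding e frac_rel_iff using m u(1) v(1) by (metis mult_S)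
  qed
qed

lemma fr_eq_iff: "a \<in> carrier R \<Longrightarrow> b \<in> carrier R \<Longrightarrow> s \<in> S \<Longrightarrow> t \<in> S \<Longrightarrow>
   fr a s = fr b t \<longleftrightarrow> (\<exists>u\<in>S. u \<otimes> (t \<otimes> a) = u \<otimes> (s \<otimes> b))"
  unfolding ring_frac_def
  by (subst eq_equiv_class_iff[OF frac_rel_equiv]) (simp_all add: frac_rel_iff)

lemma fr_eqI: "a \<in> carrier R \<Longrightarrow> b \<in> carrier R \<Longrightarrow> s \<in> S \<Longrightarrow> t \<in> S \<Longrightarrow>
   t \<otimes> a = s \<otimes> b \<Longrightarrow> fr a s = fr b t"
  unfolding fr_eq_iff by (rule bexI[of _ \<one>]) auto

lemma fr_mem: "(b, t) \<in> fr a s \<Longrightarrow> b \<in> carrier R \<and> t \<in> S \<and> a \<in> carrier R \<and> s \<in> S \<and> fr b t = fr a s"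
  unfolding ring_frac_def using equiv_class_eq[OF frac_rel_equiv, of "(a, s)" "(b, t)"]
  by (simp add: frac_rel_iff)

lemma fr_self: "a \<in> carrier R \<Longrightarrow> s \<in> S \<Longrightarrow> (a, s) \<in> fr a s"
  unfolding ring_frac_def using one_S by (auto simp: frac_rel_iff)

lemma fr_carrier [simp]: "a \<in> carrier R \<Longrightarrow> s \<in> S \<Longrightarrow> fr a s \<in> carrier L"
  unfolding localization_def ring_frac_def by (auto intro: quotientI)

lemma fr_carrierE: assumes "x \<in> carrier L" obtains a s where "a \<in> carrier R" "s \<in> S" "x = fr a s"
  using assms unfolding localization_def ring_frac_def by (auto elim!: quotientE)

lemma fr_mult_cong:
  assumes "fr a s = fr a' s'" "fr b t = fr b' t'"
    and [simp]: "a \<in> carrier R" "b \<in> carrier R" "s \<in> S" "t \<in> S" "a' \<in> carrier R" "b' \<in> carrier R" "s' \<in> S" "t' \<in> S"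
  shows "fr (a \<otimes> b) (s \<otimes> t) = fr (a' \<otimes> b') (s' \<otimes> t')"
proof -
  obtain u where u [simp]: "u \<in> S" "u \<otimes> (s' \<otimes> a) = u \<otimes> (s \<otimes> a')" using assms(1) by (auto simp: fr_eq_iff)
  obtain v where v [simp]: "v \<in> S" "v \<otimes> (t' \<otimes> b) = v \<otimes> (t \<otimes> b')" using assms(2) by (auto simp: fr_eq_iff)
  have "(u \<otimes> v) \<otimes> ((s' \<otimes> t') \<otimes> (a \<otimes> b)) = (u \<otimes> (s' \<otimes> a)) \<otimes> (v \<otimes> (t' \<otimes> b))" by (simp add: m_ac del: u(2) v(2))
  also have "\<dots> = (u \<otimes> (s \<otimes> a')) \<otimes> (v \<otimes> (t \<otimes> b'))" unfolding u v ..
  also have "\<dots> = (u \<otimes> v) \<otimes> ((s \<otimes> t) \<otimes> (a' \<otimes> b'))" by (simp add: m_ac del: u(2) v(2))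
  finally show ?thesis by (subst fr_eq_iff) (auto intro!: bexI[of _ "u \<otimes> v"])
qed

lemma fr_add_cong:
  assumes "fr a s = fr a' s'" "fr b t = fr b' t'"
    and [simp]: "a \<in> carrier R" "b \<in> carrier R" "s \<in> S" "t \<in> S" "a' \<in> carrier R" "b' \<in> carrier R" "s' \<in> S" "t' \<in> S"
  shows "fr (t \<otimes> a \<oplus> s \<otimes> b) (s \<otimes> t) = fr (t' \<otimes> a' \<oplus> s' \<otimes> b') (s' \<otimes> t')"
proof -
  obtain u where u: "u \<in> S" "u \<otimes> (s' \<otimes> a) = u \<otimes> (s \<otimes> a')" using assms(1) by (auto simp: fr_eq_iff)
  obtain v where v: "v \<in> S" "v \<otimes> (t' \<otimes> b) = v \<otimes> (t \<otimes> b')" using assms(2) by (auto simp: fr_eq_iff)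
  have "(u \<otimes> v) \<otimes> ((s' \<otimes> t') \<otimes> (t \<otimes> a \<oplus> s \<otimes> b)) =
     (v \<otimes> (t \<otimes> t')) \<otimes> (u \<otimes> (s' \<otimes> a)) \<oplus> (u \<otimes> (s \<otimes> s')) \<otimes> (v \<otimes> (t' \<otimes> b))"
    using u(1) v(1) by (simp add: m_ac r_distr)
  also have "\<dots> = (v \<otimes> (t \<otimes> t')) \<otimes> (u \<otimes> (s \<otimes> a')) \<oplus> (u \<otimes> (s \<otimes> s')) \<otimes> (v \<otimes> (t \<otimes> b'))" unfolding u v ..
  also have "\<dots> = (u \<otimes> v) \<otimes> ((s \<otimes> t) \<otimes> (t' \<otimes> a' \<oplus> s' \<otimes> b'))" using u(1) v(1) by (simp add: m_ac r_distr)
  finally show ?thesis using u(1) v(1) by (subst fr_eq_iff) (auto intro!: bexI[of _ "u \<otimes> v"])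
qed

text \<open>\<open>localization\<close> defines its operations as unions over all representatives.
  By \<open>fr_mult_cong\<close> all members of the union are the same class, so the union collapses
  to it.\<close>

lemma fr_mult:
  assumes [simp]: "a \<in> carrier R" "b \<in> carrier R" "s \<in> S" "t \<in> S"
  shows "fr a s \<otimes>\<^bsub>L\<^esub> fr b t = fr (a \<otimes> b) (s \<otimes> t)"
proof -
  have "(\<Union>(a, s)\<in>fr a s. \<Union>(b, t)\<in>fr b t. fr (a \<otimes> b) (s \<otimes> t)) = fr (a \<otimes> b) (s \<otimes> t)"
  proof (rule UN_constant_eq[OF fr_self[of a s]], simp, simp, rule, clarify)
    fix a' s' assume 1: "(a', s') \<in> fr a s"
    show "(\<Union>(b, t)\<in>fr b t. fr (a' \<otimes> b) (s' \<otimes> t)) = fr (a \<otimes> b) (s \<otimes> t)"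
    proof (rule UN_constant_eq[OF fr_self[of b t]], simp, simp, rule, clarify)
      fix b' t' assume 2: "(b', t') \<in> fr b t"
      show "fr (a' \<otimes> b') (s' \<otimes> t') = fr (a \<otimes> b) (s \<otimes> t)"
        using fr_mem[OF 1] fr_mem[OF 2] by (intro fr_mult_cong) auto
    qed
  qed
  then show ?thesis unfolding localization_def by simp
qed

lemma fr_add:
  assumes [simp]: "a \<in> carrier R" "b \<in> carrier R" "s \<in> S" "t \<in> S"
  shows "fr a s \<oplus>\<^bsub>L\<^esub> fr b t = fr (t \<otimes> a \<oplus> s \<otimes> b) (s \<otimes> t)"
proof -
  have "(\<Union>(a, s)\<in>fr a s. \<Union>(b, t)\<in>fr b t. fr (t \<otimes> a \<oplus> s \<otimes> b) (s \<otimes> t)) = fr (t \<otimes> a \<oplus> s \<otimes> b) (s \<otimes> t)"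
  proof (rule UN_constant_eq[OF fr_self[of a s]], simp, simp, rule, clarify)
    fix a' s' assume 1: "(a', s') \<in> fr a s"
    show "(\<Union>(b, t)\<in>fr b t. fr (t \<otimes> a' \<oplus> s' \<otimes> b) (s' \<otimes> t)) = fr (t \<otimes> a \<oplus> s \<otimes> b) (s \<otimes> t)"
    proof (rule UN_constant_eq[OF fr_self[of b t]], simp, simp, rule, clarify)
      fix b' t' assume 2: "(b', t') \<in> fr b t"
      show "fr (t' \<otimes> a' \<oplus> s' \<otimes> b') (s' \<otimes> t') = fr (t \<otimes> a \<oplus> s \<otimes> b) (s \<otimes> t)"
        using fr_mem[OF 1] fr_mem[OF 2] by (intro fr_add_cong) auto
    qed
  qed
  then show ?thesis unfolding localization_def by simp
qed

lemma one_L: "\<one>\<^bsub>L\<^esub> = fr \<one> \<one>" and zero_L: "\<zero>\<^bsub>L\<^esub> = fr \<zero> \<one>"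
  by (simp_all add: localization_def)

lemma fr_expand: "a \<in> carrier R \<Longrightarrow> s \<in> S \<Longrightarrow> u \<in> S \<Longrightarrow> fr (u \<otimes> a) (u \<otimes> s) = fr a s"
  by (rule fr_eqI) (simp_all add: m_ac)

lemma fr_add_same:
  assumes "a \<in> carrier R" "b \<in> carrier R" "s \<in> S"
  shows "fr a s \<oplus>\<^bsub>L\<^esub> fr b s = fr (a \<oplus> b) s"
  using assms fr_expand[of "a \<oplus> b" s s] by (simp add: fr_add r_distr)

lemma common_denominator2:
  assumes "x \<in> carrier L" "y \<in> carrier L"
  obtains a b s where "a \<in> carrier R" "b \<in> carrier R" "s \<in> S" "x = fr a s" "y = fr b s"
proof -
  obtain a s where 1: "a \<in> carrier R" "s \<in> S" "x = fr a s" using assms(1) by (rule fr_carrierE)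
  obtain b t where 2: "b \<in> carrier R" "t \<in> S" "y = fr b t" using assms(2) by (rule fr_carrierE)
  show thesis
  proof (rule that)
    show "x = fr (t \<otimes> a) (s \<otimes> t)" using 1 2 fr_expand[of a s t] by (simp add: m_comm)
    show "y = fr (s \<otimes> b) (s \<otimes> t)" using 1 2 fr_expand[of b t s] by simp
  qed (use 1 2 in auto)
qed

text \<open>A ring axiom involves at most three elements. Over a common denominator sums become sums
  of numerators, and each axiom reduces to the same axiom in \<open>R\<close>.\<close>

lemma common_denominator3:
  assumes "x \<in> carrier L" "y \<in> carrier L" "z \<in> carrier L"
  obtains a b c s where "a \<in> carrier R" "b \<in> carrier R" "c \<in> carrier R" "s \<in> S"
    "x = fr a s" "y = fr b s" "z = fr c s"
proof -
  obtain a b s where 1: "a \<in> carrier R" "b \<in> carrier R" "s \<in> S" "x = fr a s" "y = fr b s"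
    using assms(1,2) by (rule common_denominator2)
  obtain c t where 2: "c \<in> carrier R" "t \<in> S" "z = fr c t" using assms(3) by (rule fr_carrierE)
  show thesis
  proof (rule that)
    show "x = fr (t \<otimes> a) (s \<otimes> t)" using 1 2 fr_expand[of a s t] by (simp add: m_comm)
    show "y = fr (t \<otimes> b) (s \<otimes> t)" using 1 2 fr_expand[of b s t] by (simp add: m_comm)
    show "z = fr (s \<otimes> c) (s \<otimes> t)" using 1 2 fr_expand[of c t s] by simp
  qed (use 1 2 in auto)
qed

lemma cring_L: "cring L"
proof (rule cringI)
  show "abelian_group L"
  proof (rule abelian_groupI)
    fix x y z assume "x \<in> carrier L" "y \<in> carrier L" "z \<in> carrier L"
    then show "x \<oplus>\<^bsub>L\<^esub> y \<oplus>\<^bsub>L\<^esub> z = x \<oplus>\<^bsub>L\<^esub> (y \<oplus>\<^bsub>L\<^esub> z)"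
      by (rule common_denominator3) (simp add: fr_add_same a_assoc)
  next
    fix x y assume xy: "x \<in> carrier L" "y \<in> carrier L"
    show "x \<oplus>\<^bsub>L\<^esub> y \<in> carrier L" using xy by (rule common_denominator2) (simp add: fr_add_same)
    show "x \<oplus>\<^bsub>L\<^esub> y = y \<oplus>\<^bsub>L\<^esub> x" using xy by (rule common_denominator2) (simp add: fr_add_same a_comm)
  next
    show "\<zero>\<^bsub>L\<^esub> \<in> carrier L" by (simp add: zero_L)
    fix x assume "x \<in> carrier L"
    then obtain a s where x: "a \<in> carrier R" "s \<in> S" "x = fr a s" by (rule fr_carrierE)
    have z: "\<zero>\<^bsub>L\<^esub> = fr \<zero> s" unfolding zero_L using x by (intro fr_eqI) auto
    show "\<zero>\<^bsub>L\<^esub> \<oplus>\<^bsub>L\<^esub> x = x" unfolding z using x by (simp add: fr_add_same)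
    have "fr (\<ominus> a) s \<oplus>\<^bsub>L\<^esub> x = \<zero>\<^bsub>L\<^esub>" unfolding z using x by (simp add: fr_add_same l_neg)
    then show "\<exists>y\<in>carrier L. y \<oplus>\<^bsub>L\<^esub> x = \<zero>\<^bsub>L\<^esub>" using x by (intro bexI[of _ "fr (\<ominus> a) s"]) auto
  qed
  show "Group.comm_monoid L"
  proof (rule comm_monoidI)
    fix x y z assume "x \<in> carrier L" "y \<in> carrier L" "z \<in> carrier L"
    then show "x \<otimes>\<^bsub>L\<^esub> y \<otimes>\<^bsub>L\<^esub> z = x \<otimes>\<^bsub>L\<^esub> (y \<otimes>\<^bsub>L\<^esub> z)"
      by (rule common_denominator3) (simp add: fr_mult m_assoc)
  next
    fix x y assume xy: "x \<in> carrier L" "y \<in> carrier L"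
    show "x \<otimes>\<^bsub>L\<^esub> y \<in> carrier L" using xy by (rule common_denominator2) (simp add: fr_mult)
    show "x \<otimes>\<^bsub>L\<^esub> y = y \<otimes>\<^bsub>L\<^esub> x" using xy by (rule common_denominator2) (simp add: fr_mult m_comm)
  next
    show "\<one>\<^bsub>L\<^esub> \<in> carrier L" by (simp add: one_L)
    fix x assume "x \<in> carrier L"
    then show "\<one>\<^bsub>L\<^esub> \<otimes>\<^bsub>L\<^esub> x = x" by (rule fr_carrierE) (simp add: one_L fr_mult)
  qed
  fix x y z assume "x \<in> carrier L" "y \<in> carrier L" "z \<in> carrier L"
  then show "(x \<oplus>\<^bsub>L\<^esub> y) \<otimes>\<^bsub>L\<^esub> z = x \<otimes>\<^bsub>L\<^esub> z \<oplus>\<^bsub>L\<^esub> y \<otimes>\<^bsub>L\<^esub> z"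
    by (rule common_denominator3) (simp add: fr_mult fr_add_same l_distr)
qed

abbreviation "\<iota> \<equiv> \<lambda>a. fr a \<one>"

lemma iota_hom: "ring_hom_cring R L \<iota>"
  by (intro ring_hom_cring.intro ring_hom_cring_axioms.intro is_cring cring_L ring_hom_memI)
    (simp_all add: one_L fr_mult fr_add)

end

section \<open>Extension and contraction of ideals\<close>

context mult_subset begin

definition ext :: "'a set \<Rightarrow> ('a \<times> 'a) set set" where
  "ext I = {fr a s | a s. a \<in> I \<and> s \<in> S}"

lemma extI: "a \<in> I \<Longrightarrow> s \<in> S \<Longrightarrow> fr a s \<in> ext I"
  unfolding ext_def by blast

lemma fr_eq_iota: "a \<in> carrier R \<Longrightarrow> s \<in> S \<Longrightarrow> fr a s = fr \<one> s \<otimes>\<^bsub>L\<^esub> \<iota> a"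
  by (simp add: fr_mult)

lemma iota_eq_fr: "a \<in> carrier R \<Longrightarrow> s \<in> S \<Longrightarrow> \<iota> a = \<iota> s \<otimes>\<^bsub>L\<^esub> fr a s"
  by (simp add: fr_mult) (intro fr_eqI, simp_all)

lemma one_L_closed: "\<one>\<^bsub>L\<^esub> \<in> carrier L"
  by (simp add: one_L)

lemma ext_ideal:
  assumes I: "ideal I R"
  shows "ideal (ext I) L"
proof -
  interpret L: cring L by (rule cring_L)
  note Ic = ideal_carrier[OF I]
  show ?thesis
  proof (rule L.idealI_mult)
    show "ext I \<subseteq> carrier L" using Ic by (auto simp: ext_def)
    show "\<zero>\<^bsub>L\<^esub> \<in> ext I" using ideal_zero_mem[OF I] by (auto simp: zero_L intro: extI)
    fix x y assume "x \<in> ext I" "y \<in> ext I"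
    then obtain a s b t where *: "x = fr a s" "y = fr b t" "a \<in> I" "b \<in> I" "s \<in> S" "t \<in> S" unfolding ext_def by blast
    have "t \<otimes> a \<oplus> s \<otimes> b \<in> I" using * by (intro ideal_add_mem[OF I] ideal_mult_left[OF I]) simp_all
    moreover have "x \<oplus>\<^bsub>L\<^esub> y = fr (t \<otimes> a \<oplus> s \<otimes> b) (s \<otimes> t)" using * Ic by (simp add: fr_add)
    ultimately show "x \<oplus>\<^bsub>L\<^esub> y \<in> ext I" using * extI mult_S by simp
  next
    fix r x assume r: "r \<in> carrier L" and "x \<in> ext I"
    then obtain a s where *: "x = fr a s" "a \<in> I" "s \<in> S" unfolding ext_def by blast
    obtain b t where "b \<in> carrier R" "t \<in> S" "r = fr b t" using r by (rule fr_carrierE)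
    moreover from this have "b \<otimes> a \<in> I" using * by (intro ideal_mult_left[OF I])
    ultimately show "r \<otimes>\<^bsub>L\<^esub> x \<in> ext I" using * Ic extI mult_S by (simp add: fr_mult)
  qed
qed

text \<open>The factor \<open>u\<close> is essential: \<open>fr a s\<close> may equal a fraction
  with numerator in \<open>I\<close> although \<open>a\<close> itself is not in \<open>I\<close>.
  For the prime at which one localizes it is absorbed, see \<open>fr_in_ext_P_iff\<close>.\<close>

lemma fr_in_ext_iff:
  assumes I: "ideal I R" and a: "a \<in> carrier R" and s: "s \<in> S"
  shows "fr a s \<in> ext I \<longleftrightarrow> (\<exists>u\<in>S. u \<otimes> a \<in> I)"
proof
  assume "fr a s \<in> ext I"
  then obtain b t where *: "fr a s = fr b t" "b \<in> I" "t \<in> S" unfolding ext_def by blast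
  then have b: "b \<in> carrier R" using ideal_carrier[OF I] by auto
  obtain u where u: "u \<in> S" "u \<otimes> (t \<otimes> a) = u \<otimes> (s \<otimes> b)"
    using *(1) by (subst (asm) fr_eq_iff[OF a b s *(3)]) blast
  have "(u \<otimes> t) \<otimes> a = (u \<otimes> s) \<otimes> b" using u a b s * by (simp add: m_assoc)
  also have "\<dots> \<in> I" using u s by (intro ideal_mult_left[OF I] *) auto
  finally show "\<exists>u\<in>S. u \<otimes> a \<in> I" using u *(3) mult_S by blast
next
  assume "\<exists>u\<in>S. u \<otimes> a \<in> I"
  then obtain u where u: "u \<in> S" "u \<otimes> a \<in> I" by blast
  have "fr (u \<otimes> a) (u \<otimes> s) \<in> ext I" using u s by (intro extI) auto
  then show "fr a s \<in> ext I" using fr_expand[OF a s u(1)] by simp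
qed

lemma con_ideal: "ideal K L \<Longrightarrow> ideal {a \<in> carrier R. \<iota> a \<in> K} R"
proof -
  interpret h: ring_hom_cring R L \<iota> by (rule iota_hom)
  show "ideal K L \<Longrightarrow> ideal {a \<in> carrier R. \<iota> a \<in> K} R" by (rule h.ring.ideal_vimage)
qed

text \<open>A fraction is a unit times the image of its numerator, so an ideal of the localization
  is recovered from its contraction. The noetherian property and the strictness of contracted chains
  of primes both rest on this.\<close>

lemma ext_con:
  assumes K: "ideal K L"
  shows "ext {a \<in> carrier R. \<iota> a \<in> K} = K"
proof -
  interpret L: cring L by (rule cring_L)
  show ?thesis
  proof
    show "ext {a \<in> carrier R. \<iota> a \<in> K} \<subseteq> K"
    proof
      fix x assume "x \<in> ext {a \<in> carrier R. \<iota> a \<in> K}"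
      then obtain a s where "x = fr a s" "a \<in> carrier R" "\<iota> a \<in> K" "s \<in> S" unfolding ext_def by blast
      then show "x \<in> K" using fr_eq_iota[of a s] L.ideal_mult_left[OF K] by simp
    qed
    show "K \<subseteq> ext {a \<in> carrier R. \<iota> a \<in> K}"
    proof
      fix x assume x: "x \<in> K"
      then obtain a s where *: "a \<in> carrier R" "s \<in> S" "x = fr a s"
        using fr_carrierE[OF L.ideal_carrier[OF K x]] by blast
      then have "\<iota> a \<in> K" using iota_eq_fr[of a s] L.ideal_mult_left[OF K] x by simp
      then show "x \<in> ext {a \<in> carrier R. \<iota> a \<in> K}" using * by (auto intro: extI)
    qed
  qed
qed

lemma Idl_iota:
  assumes T: "T \<subseteq> carrier R"
  shows "Idl\<^bsub>L\<^esub> (\<iota> ` T) = ext (Idl T)"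
proof
  interpret L: cring L by (rule cring_L)
  have T': "\<iota> ` T \<subseteq> carrier L" using T by auto
  show "Idl\<^bsub>L\<^esub> (\<iota> ` T) \<subseteq> ext (Idl T)"
  proof (rule L.genideal_minimal[OF ext_ideal[OF genideal_ideal[OF T]]])
    show "\<iota> ` T \<subseteq> ext (Idl T)" using genideal_self[OF T] by (auto intro: extI)
  qed
  have K: "ideal (Idl\<^bsub>L\<^esub> (\<iota> ` T)) L" by (rule L.genideal_ideal[OF T'])
  have "Idl T \<subseteq> {a \<in> carrier R. \<iota> a \<in> Idl\<^bsub>L\<^esub> (\<iota> ` T)}"
    using T L.genideal_self[OF T'] by (intro genideal_minimal con_ideal[OF K]) auto
  then have "ext (Idl T) \<subseteq> ext {a \<in> carrier R. \<iota> a \<in> Idl\<^bsub>L\<^esub> (\<iota> ` T)}" unfolding ext_def by blast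
  then show "ext (Idl T) \<subseteq> Idl\<^bsub>L\<^esub> (\<iota> ` T)" unfolding ext_con[OF K] .
qed

lemma noetherian_L:
  assumes "noetherian_ring R"
  shows "noetherian_ring L"
proof -
  interpret L: cring L by (rule cring_L)
  interpret N: noetherian_ring R by fact
  show ?thesis
  proof (rule L.noetherian_ringI)
    fix K assume K: "ideal K L"
    obtain T where T: "T \<subseteq> carrier R" "finite T" "{a \<in> carrier R. \<iota> a \<in> K} = Idl T"
      using N.finetely_gen[OF con_ideal[OF K]] by blast
    then have "K = Idl\<^bsub>L\<^esub> (\<iota> ` T)" using Idl_iota[OF T(1)] ext_con[OF K] by simp
    then show "\<exists>A\<subseteq>carrier L. finite A \<and> K = Idl\<^bsub>L\<^esub> A" using T by (intro exI[of _ "\<iota> ` T"]) auto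
  qed
qed

lemma con_prime:
  assumes "primeideal K L"
  shows "primeideal {a \<in> carrier R. \<iota> a \<in> K} R"
proof -
  interpret L: cring L by (rule cring_L)
  interpret K: primeideal K L by fact
  show ?thesis
  proof (rule primeidealI)
    show "ideal {a \<in> carrier R. \<iota> a \<in> K} R" by (rule con_ideal[OF K.is_ideal])
    show "cring R" by (rule is_cring)
    have "\<iota> \<one> \<notin> K" using K.one_imp_carrier K.I_notcarr one_L by auto
    then show "carrier R \<noteq> {a \<in> carrier R. \<iota> a \<in> K}" by blast
    fix a b assume ab: "a \<in> carrier R" "b \<in> carrier R" "a \<otimes> b \<in> {a \<in> carrier R. \<iota> a \<in> K}"
    then have "\<iota> a \<otimes>\<^bsub>L\<^esub> \<iota> b \<in> K" by (simp add: fr_mult)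
    then show "a \<in> {a \<in> carrier R. \<iota> a \<in> K} \<or> b \<in> {a \<in> carrier R. \<iota> a \<in> K}"
      using K.I_prime[of "\<iota> a" "\<iota> b"] ab by auto
  qed
qed

lemma krull_dim_L_le: "krull_dim L \<le> krull_dim R"
  unfolding krull_dim_def
proof (rule Sup_subset_mono, clarify)
  fix n and C :: "nat \<Rightarrow> ('a \<times> 'a) set set"
  assume C: "\<forall>i\<le>n. primeideal (C i) L" "\<forall>i<n. C i \<subset> C (Suc i)"
  define c where "c i = {a \<in> carrier R. \<iota> a \<in> C i}" for i
  have "\<forall>i\<le>n. primeideal (c i) R" using C(1) con_prime by (auto simp: c_def)
  moreover have "c i \<subset> c (Suc i)" if "i < n" for i
  proof -
    have "C i \<subset> C (Suc i)" using C(2) that by blast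
    then have "c i \<subseteq> c (Suc i)" by (auto simp: c_def)
    moreover have "ideal (C i) L" "ideal (C (Suc i)) L" using C(1) that by (auto simp: primeideal_def)
    then have "ext (c i) = C i" "ext (c (Suc i)) = C (Suc i)" unfolding c_def by (simp_all add: ext_con)
    ultimately show ?thesis using \<open>C i \<subset> C (Suc i)\<close> by auto
  qed
  ultimately show "\<exists>m. enat n = enat m \<and> (\<exists>P. (\<forall>i\<le>m. primeideal (P i) R) \<and> (\<forall>i<m. P i \<subset> P (Suc i)))" by blast
qed

end

section \<open>Localization at a prime ideal\<close>

locale localization_at_prime = prime?: primeideal P R for P and R (structure)

sublocale localization_at_prime \<subseteq> mult_subset R "carrier R - P"
proof unfold_locales
  show "\<one> \<in> carrier R - P" using prime.one_imp_carrier prime.I_notcarr by auto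
qed (use prime.I_prime in auto)

context localization_at_prime begin

lemma one_notin_P [simp]: "\<one> \<notin> P" using one_S by blast

lemma fr_in_ext_P_iff:
  assumes a: "a \<in> carrier R" and s: "s \<in> carrier R - P"
  shows "fr a s \<in> ext P \<longleftrightarrow> a \<in> P"
proof
  assume "fr a s \<in> ext P"
  then obtain u where "u \<in> carrier R - P" "u \<otimes> a \<in> P" using fr_in_ext_iff[OF prime.is_ideal a s] by blast
  then show "a \<in> P" using prime.I_prime[of u a] a by blast
next
  assume "a \<in> P"
  then show "fr a s \<in> ext P" using s by (rule extI)
qed

lemma one_notin_ext_P: "\<one>\<^bsub>L\<^esub> \<notin> ext P"
  unfolding one_L using one_S by (subst fr_in_ext_P_iff) auto

text \<open>A fraction whose numerator lies outside \<open>P\<close> is a unit, so a proper ideal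
  contains only fractions with numerator in \<open>P\<close>.\<close>

lemma ideal_le_ext_P:
  assumes K: "ideal K L" and ne: "K \<noteq> carrier L"
  shows "K \<subseteq> ext P"
proof
  interpret L: cring L by (rule cring_L)
  fix x assume x: "x \<in> K"
  then obtain a s where *: "a \<in> carrier R" "s \<in> carrier R - P" "x = fr a s"
    using fr_carrierE[OF L.ideal_carrier[OF K x]] by blast
  have "a \<in> P"
  proof (rule ccontr)
    assume "a \<notin> P"
    then have a: "a \<in> carrier R - P" using * by auto
    then have as: "a \<otimes> s \<in> carrier R - P" using * mult_S by blast
    have "fr s a \<otimes>\<^bsub>L\<^esub> x = fr (s \<otimes> a) (a \<otimes> s)"
      using * a fr_mult[of s a a s] by blast
    also have "\<dots> = \<one>\<^bsub>L\<^esub>" unfolding one_L using * a as one_S by (intro fr_eqI) (auto simp: m_comm)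
    finally have "fr s a \<otimes>\<^bsub>L\<^esub> x = \<one>\<^bsub>L\<^esub>" .
    moreover have "fr s a \<otimes>\<^bsub>L\<^esub> x \<in> K" using * a x by (intro L.ideal_mult_left[OF K]) auto
    ultimately show False using ideal.one_imp_carrier[OF K] ne by simp
  qed
  then show "x \<in> ext P" using * by (auto intro: extI)
qed

lemma maximalideal_ext_P: "maximalideal (ext P) L"
proof (rule maximalidealI)
  interpret L: cring L by (rule cring_L)
  show "ideal (ext P) L" by (rule ext_ideal[OF prime.is_ideal])
  show "carrier L \<noteq> ext P" using one_notin_ext_P by auto
  show "J = ext P \<or> J = carrier L" if "ideal J L" "ext P \<subseteq> J" "J \<subseteq> carrier L" for J
    using ideal_le_ext_P[of J] that by blast
qed

lemma maximalideal_unique: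
  assumes "maximalideal M L"
  shows "M = ext P"
proof -
  interpret M: maximalideal M L by fact
  interpret L: cring L by (rule cring_L)
  have E: "ideal (ext P) L" by (rule ext_ideal[OF prime.is_ideal])
  have "M \<subseteq> ext P" using M.I_notcarr by (intro ideal_le_ext_P M.is_ideal) auto
  then have "ext P = M \<or> ext P = carrier L" using L.ideal_carrier[OF E] by (intro M.I_maximal E) auto
  then show ?thesis using one_notin_ext_P one_L_closed by blast
qed

lemma max_ideal_L: "max_ideal L = ext P"
  unfolding max_ideal_def using maximalideal_ext_P maximalideal_unique by (rule the_equality)

lemma noetherian_local_ring_L: "noetherian_ring R \<Longrightarrow> noetherian_local_ring L"
  unfolding noetherian_local_ring_def
  using cring_L noetherian_L maximalideal_ext_P maximalideal_unique by blast

text \<open>A relation in the localization becomes one in \<open>R\<close> after multiplication by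
  some \<open>u\<close> outside \<open>P\<close>; regularity is then applied to
  \<open>u \<otimes> a\<close> instead of \<open>a\<close>. As the sequence lies in
  \<open>P\<close>, the ideal it generates stays proper.\<close>

lemma regular_sequence_L:
  assumes "regular_sequence R xs" and xsP: "set xs \<subseteq> P"
  shows "regular_sequence L (map \<iota> xs)"
  unfolding regular_sequence_def
proof (intro conjI allI ballI impI)
  interpret L: cring L by (rule cring_L)
  have xs: "set xs \<subseteq> carrier R"
    and reg: "\<And>i a. i < length xs \<Longrightarrow> a \<in> carrier R \<Longrightarrow> xs ! i \<otimes> a \<in> Idl (set (take i xs)) \<Longrightarrow>
        a \<in> Idl (set (take i xs))"
    using assms unfolding regular_sequence_def by auto
  show "set (map \<iota> xs) \<subseteq> carrier L" using xs by (auto simp del: Diff_iff)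
  have "Idl\<^bsub>L\<^esub> (set (map \<iota> xs)) \<subseteq> ext P"
    using xsP by (intro L.genideal_minimal ext_ideal prime.is_ideal) (auto intro!: extI simp del: Diff_iff)
  then show "Idl\<^bsub>L\<^esub> (set (map \<iota> xs)) \<noteq> carrier L" using one_notin_ext_P one_L_closed by blast
  fix i z assume i: "i < length (map \<iota> xs)" and z: "z \<in> carrier L"
    and m: "map \<iota> xs ! i \<otimes>\<^bsub>L\<^esub> z \<in> Idl\<^bsub>L\<^esub> (set (take i (map \<iota> xs)))"
  obtain a s where as: "a \<in> carrier R" "s \<in> carrier R - P" "z = fr a s" using z by (rule fr_carrierE)
  have xi: "xs ! i \<in> carrier R" using i xs by auto
  let ?I = "Idl (set (take i xs))"
  have T: "set (take i xs) \<subseteq> carrier R" using xs set_take_subset by fastforce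
  have I: "ideal ?I R" by (rule genideal_ideal[OF T])
  have e: "Idl\<^bsub>L\<^esub> (set (take i (map \<iota> xs))) = ext ?I"
    using Idl_iota[OF T] by (simp add: take_map)
  have "fr (xs ! i \<otimes> a) s \<in> ext ?I" using m i as xi unfolding e by (simp add: fr_mult)
  then obtain u where u: "u \<in> carrier R - P" "u \<otimes> (xs ! i \<otimes> a) \<in> ?I"
    using fr_in_ext_iff[OF I _ as(2)] as xi by auto
  then have "xs ! i \<otimes> (u \<otimes> a) \<in> ?I" using xi as by (simp add: m_lcomm)
  then have "u \<otimes> a \<in> ?I" using reg[of i "u \<otimes> a"] i as u by auto
  then show "z \<in> Idl\<^bsub>L\<^esub> (set (take i (map \<iota> xs)))"
    unfolding e as(3) using fr_in_ext_iff[OF I as(1,2)] u(1) by blast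
qed

end

text \<open>The inequalities length of \<open>xs\<close> \<le> depth \<le> dimension of the
  localization \<le> dimension of \<open>R\<close> \<le> length of \<open>xs\<close> close up, so
  the height of \<open>P\<close> never has to be computed.\<close>

lemma cohen_macaulay_local_localization_at:
  assumes P: "primeideal P R" and N: "noetherian_ring R"
    and dim: "krull_dim R \<le> enat (length xs)"
    and xs: "regular_sequence R xs" "set xs \<subseteq> P"
  shows "cohen_macaulay_local (localization_at R P)"
proof -
  interpret localization_at_prime P R using P by (rule localization_at_prime.intro)
  interpret L: cring L by (rule cring_L)
  have "enat (length xs) \<le> local_depth L"
    unfolding local_depth_def max_ideal_L
    using regular_sequence_L[OF xs] xs(2)
    by (intro Sup_upper CollectI exI[of _ "map \<iota> xs"]) (auto intro!: extI simp del: Diff_iff)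
  moreover have "local_depth L \<le> krull_dim L"
    unfolding local_depth_def by (intro Sup_least) (auto intro: L.length_regular_sequence_le_krull_dim)
  ultimately have "local_depth L = krull_dim L"
    using krull_dim_L_le dim by (metis order.trans order.antisym)
  then show ?thesis
    unfolding cohen_macaulay_local_def localization_at_def using noetherian_local_ring_L[OF N] by simp
qed

section \<open>Criteria for normality and for singularity\<close>

lemma (in cring) mult_eval_mem:
  assumes B: "B \<subseteq> carrier R" "\<zero> \<in> B" "\<And>a b. a \<in> B \<Longrightarrow> b \<in> B \<Longrightarrow> a \<oplus> b \<in> B"
      "\<And>a b. a \<in> B \<Longrightarrow> b \<in> B \<Longrightarrow> a \<otimes> b \<in> B"
    and x: "x \<in> carrier R" and y: "y \<in> carrier R"
  shows "set qs \<subseteq> B \<Longrightarrow> (\<And>i. i < length qs \<Longrightarrow> y \<otimes> x [^] i \<in> B) \<Longrightarrow> y \<otimes> eval qs x \<in> B"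
proof (induction qs)
  case Nil
  then show ?case using y B by simp
next
  case (Cons a qs)
  have a: "a \<in> B" "a \<in> carrier R" using Cons.prems B by auto
  have e: "eval qs x \<in> carrier R" using Cons.prems(1) B x by (intro eval_in_carrier) auto
  have "y \<otimes> eval (a # qs) x = a \<otimes> (y \<otimes> x [^] length qs) \<oplus> y \<otimes> eval qs x"
    using a e x y by (simp add: r_distr m_lcomm)
  also have "\<dots> \<in> B" using Cons a by (intro B(3) B(4)[OF a(1)]) simp_all
  finally show ?case .
qed

text \<open>An integral element \<open>f / g\<close> is almost integral: all its powers have the common denominator
  \<open>g\<^sup>n\<close>, where \<open>n\<close> is the degree of the equation.\<close>

lemma (in ring_hom_cring) integral_common_denominator:
  assumes x: "x \<in> carrier S" and fg: "f \<in> carrier R" "g \<in> carrier R" "h g \<otimes>\<^bsub>S\<^esub> x = h f"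
    and qs: "set qs \<subseteq> h ` carrier R" "S.eval (\<one>\<^bsub>S\<^esub> # qs) x = \<zero>\<^bsub>S\<^esub>"
  shows "\<exists>b\<in>carrier R. h (g [^]\<^bsub>R\<^esub> length qs) \<otimes>\<^bsub>S\<^esub> x [^]\<^bsub>S\<^esub> (m::nat) = h b"
proof -
  let ?B = "h ` carrier R"
  have B: "?B \<subseteq> carrier S" by auto
  have Bz: "\<zero>\<^bsub>S\<^esub> \<in> ?B" using imageI[OF R.zero_closed, of h] by simp
  have Badd: "a \<oplus>\<^bsub>S\<^esub> b \<in> ?B" if ab: "a \<in> ?B" "b \<in> ?B" for a b
  proof -
    obtain a' b' where "a = h a'" "b = h b'" "a' \<in> carrier R" "b' \<in> carrier R" using ab by blast
    then show ?thesis using imageI[OF R.a_closed[of a' b'], of h] by simp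
  qed
  have Bmult: "a \<otimes>\<^bsub>S\<^esub> b \<in> ?B" if ab: "a \<in> ?B" "b \<in> ?B" for a b
  proof -
    obtain a' b' where "a = h a'" "b = h b'" "a' \<in> carrier R" "b' \<in> carrier R" using ab by blast
    then show ?thesis using imageI[OF R.m_closed[of a' b'], of h] by simp
  qed
  have Bminus: "\<ominus>\<^bsub>S\<^esub> a \<in> ?B" if ab: "a \<in> ?B" for a
  proof -
    obtain a' where "a = h a'" "a' \<in> carrier R" using ab by blast
    then show ?thesis using imageI[OF R.a_inv_closed[of a'], of h] by simp
  qed
  have pow: "h (a [^]\<^bsub>R\<^esub> k) = h a [^]\<^bsub>S\<^esub> k" if "a \<in> carrier R" for a and k :: nat
    using that by (rule ring.hom_nat_pow)
  define n where "n = length qs"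
  define e where "e = S.eval qs x"
  have e: "e \<in> carrier S" unfolding e_def using qs(1) B x by (intro S.eval_in_carrier) blast+
  have "x [^]\<^bsub>S\<^esub> n \<oplus>\<^bsub>S\<^esub> e = \<zero>\<^bsub>S\<^esub>" using qs(2) x unfolding n_def e_def by simp
  then have xn: "x [^]\<^bsub>S\<^esub> n = \<ominus>\<^bsub>S\<^esub> e" using S.minus_equality[of "x [^]\<^bsub>S\<^esub> n" e] e x by simp
  have gxm: "h g [^]\<^bsub>S\<^esub> k \<otimes>\<^bsub>S\<^esub> x [^]\<^bsub>S\<^esub> k = h (f [^]\<^bsub>R\<^esub> k)" for k :: nat
    using S.nat_pow_distrib[of "h g" x k] fg x by (simp add: pow)
  define y where "y = h (g [^]\<^bsub>R\<^esub> n)"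
  have y: "y \<in> carrier S" unfolding y_def using fg by simp
  \<comment> \<open>Below n the denominator absorbs the power of x: g^n x^m = g^(n-m) f^m. From n
    on, the monic equation x^n = - e lowers the exponent.\<close>
  have mem: "y \<otimes>\<^bsub>S\<^esub> x [^]\<^bsub>S\<^esub> m \<in> ?B" for m :: nat
  proof (induction m rule: less_induct)
    case (less m)
    show ?case
    proof (cases "m < n")
      case True
      then have "y = h (g [^]\<^bsub>R\<^esub> (n - m)) \<otimes>\<^bsub>S\<^esub> h g [^]\<^bsub>S\<^esub> m"
        unfolding y_def using fg by (simp add: pow S.nat_pow_mult)
      then have "y \<otimes>\<^bsub>S\<^esub> x [^]\<^bsub>S\<^esub> m = h (g [^]\<^bsub>R\<^esub> (n - m)) \<otimes>\<^bsub>S\<^esub> h (f [^]\<^bsub>R\<^esub> m)"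
        using gxm[of m, symmetric] fg x by (simp add: S.m_assoc)
      also have "\<dots> \<in> ?B" using fg by (intro Bmult imageI R.nat_pow_closed)
      finally show ?thesis .
    next
      case False
      define z where "z = y \<otimes>\<^bsub>S\<^esub> x [^]\<^bsub>S\<^esub> (m - n)"
      have z: "z \<in> carrier S" unfolding z_def using y x by simp
      have zi: "z \<otimes>\<^bsub>S\<^esub> x [^]\<^bsub>S\<^esub> i = y \<otimes>\<^bsub>S\<^esub> x [^]\<^bsub>S\<^esub> (m - n + i)" for i :: nat
        unfolding z_def using x y by (simp add: S.m_assoc S.nat_pow_mult)
      have "z \<otimes>\<^bsub>S\<^esub> e \<in> ?B" unfolding e_def
      proof (rule S.mult_eval_mem[OF B Bz Badd Bmult x z qs(1)])
        fix i assume "i < length qs"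
        then show "z \<otimes>\<^bsub>S\<^esub> x [^]\<^bsub>S\<^esub> i \<in> ?B" unfolding zi using False by (intro less) (simp add: n_def)
      qed
      moreover have "y \<otimes>\<^bsub>S\<^esub> x [^]\<^bsub>S\<^esub> m = \<ominus>\<^bsub>S\<^esub> (z \<otimes>\<^bsub>S\<^esub> e)"
        using zi[of n] False xn z e by (simp add: S.r_minus)
      ultimately show ?thesis using Bminus by simp
    qed
  qed
  show ?thesis using mem[of m] unfolding y_def n_def by blast
qed

text \<open>A completely integrally closed domain is normal: if f / g satisfies a monic equation of
  degree n, the single element c = g^n clears the denominators of all powers of f / g. The criterion
  is phrased inside \<open>R\<close>, as divisibility of c f^m by g^m, so that it can be checked on
  polynomials.\<close>

lemma normal_domainI:
  fixes R (structure)
  assumes "domain R"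
    and cic: "\<And>f g c. f \<in> carrier R \<Longrightarrow> g \<in> carrier R \<Longrightarrow> c \<in> carrier R \<Longrightarrow> g \<noteq> \<zero> \<Longrightarrow> c \<noteq> \<zero> \<Longrightarrow>
       (\<And>m::nat. \<exists>h\<in>carrier R. c \<otimes> f [^] m = g [^] m \<otimes> h) \<Longrightarrow> \<exists>h\<in>carrier R. f = g \<otimes> h"
  shows "normal_domain R"
  unfolding normal_domain_def
proof (intro conjI ballI impI)
  show "domain R" by fact
  interpret domain R by fact
  interpret mult_subset R "carrier R - {\<zero>}"
    by unfold_locales (auto simp: integral_iff)
  interpret h: ring_hom_cring R L \<iota> by (rule iota_hom)
  have F: "fraction_field R = L" "to_fraction_field R = \<iota>"
    by (auto simp: fraction_field_def to_fraction_field_def)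
  fix x assume "x \<in> carrier (fraction_field R)"
    and int: "integral_over (fraction_field R) (to_fraction_field R ` carrier R) x"
  then have x: "x \<in> carrier L" unfolding F by simp
  then obtain f g where fg: "f \<in> carrier R" "g \<in> carrier R - {\<zero>}" "x = fr f g" by (rule fr_carrierE)
  then have g: "g \<in> carrier R" "g \<noteq> \<zero>" by auto
  have inj: "a = b" if ab: "\<iota> a = \<iota> b" "a \<in> carrier R" "b \<in> carrier R" for a b
  proof -
    obtain u where u: "u \<in> carrier R - {\<zero>}" "u \<otimes> (\<one> \<otimes> a) = u \<otimes> (\<one> \<otimes> b)"
      using ab fr_eq_iff[OF ab(2,3) one_S one_S] by blast
    then show ?thesis using m_lcancel[of u a b] ab by simp
  qed
  obtain p where p: "polynomial\<^bsub>L\<^esub> (\<iota> ` carrier R) p" "p \<noteq> []" "hd p = \<one>\<^bsub>L\<^esub>" "ring.eval L p x = \<zero>\<^bsub>L\<^esub>"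
  proof -
    have "carrier ((\<iota> ` carrier R)[X]\<^bsub>L\<^esub>) = {p. polynomial\<^bsub>L\<^esub> (\<iota> ` carrier R) p}" by (simp only: univ_poly_def partial_object.simps)
    then show thesis using int that unfolding F integral_over_def by blast
  qed
  then obtain qs where qs: "p = \<one>\<^bsub>L\<^esub> # qs" by (cases p) auto
  have qsB: "set qs \<subseteq> \<iota> ` carrier R" using p(1) unfolding polynomial_def qs by simp
  have gx: "\<iota> g \<otimes>\<^bsub>L\<^esub> x = \<iota> f" using iota_eq_fr[of f g] fg by simp
  note den = h.integral_common_denominator[OF x fg(1) g(1) gx qsB p(4)[unfolded qs]]
  have "\<exists>h\<in>carrier R. f = g \<otimes> h"
  proof (rule cic[of f g "g [^] length qs"])
    show "g [^] length qs \<noteq> \<zero>"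
    proof -
      have "g [^] k \<noteq> \<zero>" for k :: nat by (induction k) (use g integral_iff in auto)
      then show ?thesis .
    qed
    fix m :: nat
    obtain b where b: "b \<in> carrier R" "\<iota> (g [^] length qs) \<otimes>\<^bsub>L\<^esub> x [^]\<^bsub>L\<^esub> m = \<iota> b" using den[of m] by blast
    have gm: "\<iota> (g [^] m) \<otimes>\<^bsub>L\<^esub> x [^]\<^bsub>L\<^esub> m = \<iota> (f [^] m)"
      using h.S.nat_pow_distrib[of "\<iota> g" x m] gx g(1) fg(1) x by (simp only: h.ring.hom_nat_pow h.hom_closed)
    have "\<iota> (g [^] length qs \<otimes> f [^] m) = \<iota> (g [^] length qs) \<otimes>\<^bsub>L\<^esub> \<iota> (f [^] m)"
      by (intro h.hom_mult nat_pow_closed g fg)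
    also have "\<dots> = \<iota> (g [^] m) \<otimes>\<^bsub>L\<^esub> \<iota> b" unfolding gm[symmetric] b(2)[symmetric]
      by (intro h.S.m_lcomm h.hom_closed nat_pow_closed g h.S.nat_pow_closed x)
    also have "\<dots> = \<iota> (g [^] m \<otimes> b)" by (intro h.hom_mult[symmetric] nat_pow_closed g b)
    finally have "g [^] length qs \<otimes> f [^] m = g [^] m \<otimes> b" by (rule inj) (intro m_closed nat_pow_closed g fg b)+
    then show "\<exists>h\<in>carrier R. g [^] length qs \<otimes> f [^] m = g [^] m \<otimes> h" using b(1) by blast
  qed (use g fg(1) in auto)
  then obtain b where b: "b \<in> carrier R" "f = g \<otimes> b" by blast
  have "x = \<iota> b" unfolding fg(3) b(2) by (intro fr_eqI one_S fg(2) b(1) m_closed g) (simp add: b g)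
  then show "x \<in> to_fraction_field R ` carrier R" unfolding F using b by blast
qed

section \<open>Non-regularity from too many derivations at a point\<close>

lemma vector_space_fun: "vector_space (\<lambda>(c::'k::field) (f::'v \<Rightarrow> 'k) w. c * f w)"
  by unfold_locales (auto simp: algebra_simps fun_eq_iff)

text \<open>\<open>D\<close> collects derivations at the point \<open>\<epsilon>\<close>; it sends the maximal ideal of the local
  ring onto a space of dimension \<open>card V\<close>, and generators of the ideal to generators of the space.\<close>

lemma not_regular_local_ring:
  fixes R (structure) and \<epsilon> :: "'a \<Rightarrow> 'k::field" and D :: "'a \<Rightarrow> 'v \<Rightarrow> 'k"
  assumes P: "primeideal P R" and P_eq: "P = {a \<in> carrier R. \<epsilon> a = 0}"
    and \<epsilon>_mult: "\<And>a b. a \<in> carrier R \<Longrightarrow> b \<in> carrier R \<Longrightarrow> \<epsilon> (a \<otimes> b) = \<epsilon> a * \<epsilon> b"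
    and D_add: "\<And>a b v. a \<in> carrier R \<Longrightarrow> b \<in> carrier R \<Longrightarrow> D (a \<oplus> b) v = D a v + D b v"
    and D_mult: "\<And>a b v. a \<in> carrier R \<Longrightarrow> b \<in> carrier R \<Longrightarrow> D (a \<otimes> b) v = \<epsilon> a * D b v + \<epsilon> b * D a v"
    and V: "finite V"
    and \<xi>: "\<And>v. v \<in> V \<Longrightarrow> \<xi> v \<in> P" "\<And>v w. v \<in> V \<Longrightarrow> D (\<xi> v) w = (if w = v then 1 else 0)"
    and dim: "krull_dim R < enat (card V)"
  shows "\<not> regular_local_ring (localization_at R P)"
proof
  assume reg: "regular_local_ring (localization_at R P)"
  interpret localization_at_prime P R using P by (rule localization_at_prime.intro)
  interpret L: cring L by (rule cring_L)
  interpret vs: vector_space "\<lambda>(c::'k) (f::'v \<Rightarrow> 'k) w. c * f w" by (rule vector_space_fun)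
  obtain A where A: "A \<subseteq> carrier L" "finite A" "enat (card A) = krull_dim L" "ext P = Idl\<^bsub>L\<^esub> A"
    using reg unfolding regular_local_ring_def localization_at_def max_ideal_L by auto
  have "\<forall>x\<in>A. \<exists>p s. p \<in> P \<and> s \<in> carrier R - P \<and> x = fr p s"
    using L.genideal_self[OF A(1)] unfolding A(4)[symmetric] ext_def by blast
  then obtain num where num: "\<And>x. x \<in> A \<Longrightarrow> \<exists>s. num x \<in> P \<and> s \<in> carrier R - P \<and> x = fr (num x) s"
    by metis
  define U where "U = vs.span ((\<lambda>x. D (num x)) ` A)"
  have Uadd: "f \<in> U \<Longrightarrow> g \<in> U \<Longrightarrow> (\<lambda>w. f w + g w) \<in> U" for f g
    unfolding U_def using vs.span_add[of f _ g] by (simp add: plus_fun_def)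
  have Uscale: "f \<in> U \<Longrightarrow> (\<lambda>w. c * f w) \<in> U" for f c
    unfolding U_def by (rule vs.span_scale)
  have memP: "p \<in> P \<longleftrightarrow> p \<in> carrier R \<and> \<epsilon> p = 0" for p by (subst P_eq) simp
  have Pc: "p \<in> P \<Longrightarrow> p \<in> carrier R" "p \<in> P \<Longrightarrow> \<epsilon> p = 0" for p using memP by blast+
  have sc: "s \<in> carrier R - P \<Longrightarrow> s \<in> carrier R" "s \<in> carrier R - P \<Longrightarrow> \<epsilon> s \<noteq> 0" for s using memP by blast+
  have D0: "D \<zero> = (\<lambda>w. 0)"
  proof
    fix w
    have "D \<zero> w = D \<zero> w + D \<zero> w" using D_add[of \<zero> \<zero> w] by (simp only: zero_closed l_zero)
    then show "D \<zero> w = 0" by (simp only: add_cancel_right_right)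
  qed
  have Dp: "D (a \<otimes> p) = (\<lambda>w. \<epsilon> a * D p w)" if "a \<in> carrier R" "p \<in> P" for a p
    using that Pc[of p] D_mult[of a p] by (simp add: fun_eq_iff)
  have Pm: "a \<otimes> p \<in> P" if "a \<in> carrier R" "p \<in> P" for a p
    using ideal_mult_left[OF prime.is_ideal] that by blast
  have Pa: "p \<oplus> q \<in> P" if "p \<in> P" "q \<in> P" for p q
    using ideal_add_mem[OF prime.is_ideal] that by blast
  \<comment> \<open>\<open>D\<close> lives on \<open>R\<close> and is not extended to the
    localization. On \<open>P\<close> the product rule reduces to D(a p) = \<epsilon>(a) D(p), which
    makes the fractions having a numerator in \<open>P\<close> with derivative in \<open>U\<close>
    an ideal. It contains the generators \<open>A\<close>, hence all of
    \<open>ext P\<close>.\<close>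
  define T where "T = {fr p s | p s. p \<in> P \<and> s \<in> carrier R - P \<and> D p \<in> U}"
  have TI: "fr p s \<in> T" if "p \<in> P" "s \<in> carrier R - P" "D p \<in> U" for p s
    unfolding T_def mem_Collect_eq using that by (intro exI conjI) (rule refl)
  have TE: thesis if "x \<in> T" "\<And>p s. x = fr p s \<Longrightarrow> p \<in> P \<Longrightarrow> s \<in> carrier R - P \<Longrightarrow> D p \<in> U \<Longrightarrow> thesis"
    for x thesis using that unfolding T_def mem_Collect_eq by (elim exE conjE)
  have "ideal T L"
  proof (rule L.idealI_mult)
    show "T \<subseteq> carrier L" unfolding T_def using Pc fr_carrier by blast
    have "(\<lambda>w. 0) \<in> U" using vs.span_zero unfolding U_def by (simp add: zero_fun_def)
    then have "D \<zero> \<in> U" unfolding D0 .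
    then show "\<zero>\<^bsub>L\<^esub> \<in> T" unfolding zero_L by (rule TI[OF ideal_zero_mem[OF prime.is_ideal] one_S])
    fix x y assume xy: "x \<in> T" "y \<in> T"
    obtain p s where 1: "x = fr p s" "p \<in> P" "s \<in> carrier R - P" "D p \<in> U" using xy(1) by (rule TE)
    obtain q t where 2: "y = fr q t" "q \<in> P" "t \<in> carrier R - P" "D q \<in> U" using xy(2) by (rule TE)
    note * = 1(1) 2(1) 1(2) 2(2) 1(3) 2(3) 1(4) 2(4)
    note c = Pc(1)[OF *(3)] Pc(1)[OF *(4)] sc(1)[OF *(5)] sc(1)[OF *(6)]
    have x: "x \<oplus>\<^bsub>L\<^esub> y = fr (t \<otimes> p \<oplus> s \<otimes> q) (s \<otimes> t)"
      unfolding *(1,2) by (rule fr_add[OF c(1,2) *(5,6)])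
    have "D (t \<otimes> p \<oplus> s \<otimes> q) = (\<lambda>w. \<epsilon> t * D p w + \<epsilon> s * D q w)"
    proof
      fix w
      have "D (t \<otimes> p \<oplus> s \<otimes> q) w = D (t \<otimes> p) w + D (s \<otimes> q) w"
        by (intro D_add m_closed c)
      then show "D (t \<otimes> p \<oplus> s \<otimes> q) w = \<epsilon> t * D p w + \<epsilon> s * D q w"
        using Dp[OF sc(1)[OF *(6)] *(3)] Dp[OF sc(1)[OF *(5)] *(4)] by (simp only:)
    qed
    then have D: "D (t \<otimes> p \<oplus> s \<otimes> q) \<in> U" using Uadd[OF Uscale[OF *(7)] Uscale[OF *(8)]] by (simp only:)
    have "t \<otimes> p \<oplus> s \<otimes> q \<in> P" by (intro Pa Pm c *(3,4))
    then show "x \<oplus>\<^bsub>L\<^esub> y \<in> T" unfolding x by (rule TI[OF _ mult_S[OF *(5,6)] D])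
  next
    fix r x assume "r \<in> carrier L" "x \<in> T"
    obtain a t where 1: "a \<in> carrier R" "t \<in> carrier R - P" "r = fr a t"
      using \<open>r \<in> carrier L\<close> by (rule fr_carrierE)
    obtain p s where 2: "x = fr p s" "p \<in> P" "s \<in> carrier R - P" "D p \<in> U" using \<open>x \<in> T\<close> by (rule TE)
    note * = 1(3) 1(1,2) 2
    have x: "r \<otimes>\<^bsub>L\<^esub> x = fr (a \<otimes> p) (t \<otimes> s)" unfolding *(1,4) by (rule fr_mult[OF *(2) Pc(1)[OF *(5)] *(3,6)])
    have "D (a \<otimes> p) \<in> U" unfolding Dp[OF *(2,5)] by (rule Uscale[OF *(7)])
    then show "r \<otimes>\<^bsub>L\<^esub> x \<in> T" unfolding x by (rule TI[OF Pm[OF *(2,5)] mult_S[OF *(3,6)]])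
  qed
  moreover have "A \<subseteq> T"
  proof
    fix x assume x: "x \<in> A"
    then have "D (num x) \<in> U" unfolding U_def by (intro vs.span_base) auto
    obtain s where s: "num x \<in> P" "s \<in> carrier R - P" "x = fr (num x) s" using num[OF x] by blast
    show "x \<in> T" by (subst s(3)) (rule TI[OF s(1,2) \<open>D (num x) \<in> U\<close>])
  qed
  ultimately have PT: "ext P \<subseteq> T" unfolding A(4) by (rule L.genideal_minimal)
  define E where "E = (\<lambda>v w. if w = v then 1 else (0::'k)) ` V"
  have "E \<subseteq> U"
  proof
    fix f assume "f \<in> E"
    then obtain v where v: "v \<in> V" "f = D (\<xi> v)" unfolding E_def using \<xi>(2) by (force simp only: fun_eq_iff)
    have xv: "\<xi> v \<in> P" "\<xi> v \<in> carrier R" using \<xi>(1)[OF v(1)] Pc(1)[OF \<xi>(1)[OF v(1)]] .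
    obtain p s where *: "\<iota> (\<xi> v) = fr p s" "p \<in> P" "s \<in> carrier R - P" "D p \<in> U"
      using subsetD[OF PT extI[OF xv(1) one_S]] by (rule TE)
    \<comment> \<open>Equal fractions have equal cross products only up to a factor \<open>u\<close>
      outside \<open>P\<close>. Applying \<open>D\<close> and cancelling the nonzero scalars
      \<epsilon>(u) and \<epsilon>(s) puts the unit vector into \<open>U\<close>.\<close>
    obtain u where u: "u \<in> carrier R - P" "u \<otimes> (s \<otimes> \<xi> v) = u \<otimes> (\<one> \<otimes> p)"
      using iffD1[OF fr_eq_iff[OF xv(2) Pc(1)[OF *(2)] one_S *(3)] *(1)] by (rule bexE)
    have "\<epsilon> u * (\<epsilon> s * D (\<xi> v) w) = \<epsilon> u * D p w" for w
    proof -
      have "D (u \<otimes> (s \<otimes> \<xi> v)) w = \<epsilon> u * (\<epsilon> s * D (\<xi> v) w)"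
        using Dp[OF sc(1)[OF u(1)] Pm[OF sc(1)[OF *(3)] xv(1)]] Dp[OF sc(1)[OF *(3)] xv(1)] by (simp only:)
      moreover have "D (u \<otimes> (\<one> \<otimes> p)) w = \<epsilon> u * D p w"
        using Dp[OF sc(1)[OF u(1)] *(2)] Pc(1)[OF *(2)] by (simp only: l_one)
      ultimately show ?thesis using u(2) by (simp only:)
    qed
    then have "D (\<xi> v) = (\<lambda>w. inverse (\<epsilon> s) * D p w)"
      using sc(2)[OF u(1)] sc(2)[OF *(3)] by (simp add: fun_eq_iff field_simps)
    then show "f \<in> U" unfolding v(2) using Uscale[OF *(4)] by (simp only:)
  qed
  moreover have "vs.independent E"
  proof (rule vs.independent_if_scalars_zero)
    show fin: "finite E" unfolding E_def using V by simp
    fix c x assume s: "(\<Sum>f\<in>E. (\<lambda>w. c f * f w)) = 0" and x: "x \<in> E"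
    then obtain v where v: "v \<in> V" "x = (\<lambda>w. if w = v then 1 else 0)" unfolding E_def by blast
    have "0 = (\<Sum>f\<in>E. (\<lambda>w. c f * f w)) v" unfolding s by simp
    also have "\<dots> = (\<Sum>f\<in>E. c f * f v)" by (induction E rule: infinite_finite_induct) auto
    also have "\<dots> = (\<Sum>f\<in>E. if f = x then c x else 0)"
    proof (rule sum.cong)
      fix f assume "f \<in> E"
      then obtain u where u: "f = (\<lambda>w. if w = u then 1 else 0)" unfolding E_def by blast
      show "c f * f v = (if f = x then c x else 0)"
      proof (cases "u = v")
        case True
        then show ?thesis using u v(2) by simp
      next
        case False
        then have "f u \<noteq> x u" unfolding u v(2) by simp
        then have "f \<noteq> x" by blast
        then show ?thesis using False u by simp
      qed
    qed simp
    also have "\<dots> = c x" using fin x by simp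
    finally show "c x = 0" by simp
  qed
  ultimately have "card E \<le> card ((\<lambda>x. D (num x)) ` A)"
    unfolding U_def using vs.independent_span_bound A(2) by blast
  also have "\<dots> \<le> card A" by (rule card_image_le[OF A(2)])
  finally have "card E \<le> card A" .
  moreover have "inj_on (\<lambda>v w. if w = v then 1 else (0::'k)) V"
    by (rule inj_onI) (metis zero_neq_one)
  then have "card E = card V" unfolding E_def by (rule card_image)
  moreover have "enat (card A) < enat (card V)" using krull_dim_L_le dim A(3) by (metis order.strict_trans1)
  ultimately show False by simp
qed

section \<open>Multivariate polynomials\<close>

abbreviation lookup :: "('a \<Rightarrow>\<^sub>0 'b::zero) \<Rightarrow> 'a \<Rightarrow> 'b" where "lookup \<equiv> Poly_Mapping.lookup"

abbreviation keys :: "('a \<Rightarrow>\<^sub>0 'b::zero) \<Rightarrow> 'a set" where "keys \<equiv> Poly_Mapping.keys"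

abbreviation single :: "'a \<Rightarrow> 'b \<Rightarrow> 'a \<Rightarrow>\<^sub>0 'b::zero" where "single \<equiv> Poly_Mapping.single"

definition mp_const :: "'k \<Rightarrow> ('v \<Rightarrow>\<^sub>0 nat) \<Rightarrow>\<^sub>0 'k::comm_ring_1" where
  "mp_const c = single 0 c"

definition mp_var :: "'v \<Rightarrow> ('v \<Rightarrow>\<^sub>0 nat) \<Rightarrow>\<^sub>0 'k::comm_ring_1" where
  "mp_var v = single (single v 1) 1"

definition monom_eval :: "('v \<Rightarrow> 'b::comm_monoid_mult) \<Rightarrow> ('v \<Rightarrow>\<^sub>0 nat) \<Rightarrow> 'b" where
  "monom_eval x m = (\<Prod>v\<in>keys m. x v ^ lookup m v)"

text \<open>With the coefficient map \<open>h\<close> as a parameter, one operator covers evaluation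
  at a point, substitution of polynomials, restriction to a curve and the values of polynomials in
  an arbitrary algebra.\<close>

definition mp_subst ::
    "('k \<Rightarrow> 'b) \<Rightarrow> ('v \<Rightarrow> 'b) \<Rightarrow> (('v \<Rightarrow>\<^sub>0 nat) \<Rightarrow>\<^sub>0 'k::comm_ring_1) \<Rightarrow> 'b::comm_ring_1" where
  "mp_subst h x p = (\<Sum>m\<in>keys p. h (lookup p m) * monom_eval x m)"

lemma mpoly_eval_eq_subst: "mpoly_eval x p = mp_subst (\<lambda>c. c) x p"
  by (simp add: mpoly_eval_def mp_subst_def monom_eval_def)

lemma monom_eval_superset:
  "finite S \<Longrightarrow> keys m \<subseteq> S \<Longrightarrow> monom_eval x m = (\<Prod>v\<in>S. x v ^ lookup m v)"
  unfolding monom_eval_def by (rule prod.mono_neutral_left) (auto simp: in_keys_iff)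

lemma monom_eval_zero [simp]: "monom_eval x 0 = 1"
  by (simp add: monom_eval_def)

lemma monom_eval_single [simp]: "monom_eval x (single v n) = x v ^ n"
  by (simp add: monom_eval_def)

lemma monom_eval_add: "monom_eval x (m + n) = monom_eval x m * monom_eval x n"
proof -
  let ?S = "keys m \<union> keys n"
  have "monom_eval x (m + n) = (\<Prod>v\<in>?S. x v ^ lookup (m + n) v)"
    by (rule monom_eval_superset) (use keys_add[of m n] in auto)
  also have "\<dots> = (\<Prod>v\<in>?S. x v ^ lookup m v) * (\<Prod>v\<in>?S. x v ^ lookup n v)"
    by (simp add: lookup_add power_add prod.distrib)
  also have "\<dots> = monom_eval x m * monom_eval x n"
    by (simp add: monom_eval_superset[of ?S])
  finally show ?thesis .
qed

lemma mp_sum_singles: "p = (\<Sum>m\<in>keys p. single m (lookup p m))"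
proof (rule poly_mapping_eqI)
  fix m
  show "lookup p m = lookup (\<Sum>m\<in>keys p. single m (lookup p m)) m"
    by (simp add: lookup_sum lookup_single when_def in_keys_iff)
qed

lemma mp_single_eq: "single m c = mp_const c * single m 1"
  by (simp add: mp_const_def mult_single)

lemma single_one_eq_monom_eval: "single m 1 = monom_eval mp_var m"
proof -
  have pow: "(mp_var v :: ('a \<Rightarrow>\<^sub>0 nat) \<Rightarrow>\<^sub>0 'b) ^ n = single (single v n) 1" for v n
    by (induction n) (simp_all add: mp_var_def mult_single single_add[symmetric])
  have prod: "finite S \<Longrightarrow> (\<Prod>v\<in>S. (mp_var v :: ('a \<Rightarrow>\<^sub>0 nat) \<Rightarrow>\<^sub>0 'b) ^ f v) =
      single (\<Sum>v\<in>S. single v (f v)) 1" for S f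
    by (induction S rule: finite_induct) (simp_all add: pow mult_single)
  show ?thesis unfolding monom_eval_def by (simp add: prod mp_sum_singles[symmetric])
qed

context comm_ring_hom begin

lemma mp_subst_superset:
  "finite S \<Longrightarrow> keys p \<subseteq> S \<Longrightarrow> mp_subst hom x p = (\<Sum>m\<in>S. hom (lookup p m) * monom_eval x m)"
  unfolding mp_subst_def by (rule sum.mono_neutral_left) (auto simp: in_keys_iff)

lemma mp_subst_zero [simp]: "mp_subst hom x 0 = 0"
  by (simp add: mp_subst_def)

lemma mp_subst_single [simp]: "mp_subst hom x (single m c) = hom c * monom_eval x m"
  by (simp add: mp_subst_superset[of "{m}"])

lemma mp_subst_add: "mp_subst hom x (p + q) = mp_subst hom x p + mp_subst hom x q"
proof -
  let ?S = "keys p \<union> keys q"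
  have "mp_subst hom x (p + q) = (\<Sum>m\<in>?S. hom (lookup (p + q) m) * monom_eval x m)"
    by (rule mp_subst_superset) (use keys_add[of p q] in auto)
  also have "\<dots> = mp_subst hom x p + mp_subst hom x q"
    by (simp add: lookup_add hom_add distrib_right sum.distrib mp_subst_superset[of ?S])
  finally show ?thesis .
qed

lemma mp_subst_sum: "mp_subst hom x (\<Sum>i\<in>S. f i) = (\<Sum>i\<in>S. mp_subst hom x (f i))"
  by (induction S rule: infinite_finite_induct) (simp_all add: mp_subst_add)

lemma mp_subst_mult: "mp_subst hom x (p * q) = mp_subst hom x p * mp_subst hom x q"
proof -
  let ?s = "\<lambda>p m. single m (lookup p m)"
  have "p * q = (\<Sum>m\<in>keys p. ?s p m) * (\<Sum>m\<in>keys q. ?s q m)"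
    using mp_sum_singles[of p] mp_sum_singles[of q] by simp
  also have "\<dots> = (\<Sum>m\<in>keys p. \<Sum>n\<in>keys q. ?s p m * ?s q n)"
    by (rule sum_product)
  finally have "mp_subst hom x (p * q) =
     (\<Sum>m\<in>keys p. \<Sum>n\<in>keys q. mp_subst hom x (?s p m) * mp_subst hom x (?s q n))"
    by (simp add: mp_subst_sum mult_single hom_mult monom_eval_add mult_ac)
  also have "\<dots> = mp_subst hom x (\<Sum>m\<in>keys p. ?s p m) * mp_subst hom x (\<Sum>m\<in>keys q. ?s q m)"
    by (simp add: mp_subst_sum sum_product)
  finally show ?thesis using mp_sum_singles[of p] mp_sum_singles[of q] by simp
qed

lemma comm_ring_hom_mp_subst: "comm_ring_hom (mp_subst hom x)"
proof
  have "mp_subst hom x 1 = hom 1 * monom_eval x 0"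
    using mp_subst_single[of x 0 1] by simp
  then show "mp_subst hom x 1 = 1" by simp
qed (simp_all add: mp_subst_add mp_subst_mult)

lemma mp_subst_const [simp]: "mp_subst hom x (mp_const c) = hom c"
  by (simp add: mp_const_def)

lemma mp_subst_var [simp]: "mp_subst hom x (mp_var v) = x v"
  by (simp add: mp_var_def)

end

lemma comm_ring_hom_mp_const: "comm_ring_hom mp_const"
  by unfold_locales (simp_all add: mp_const_def single_add mult_single)

lemma comm_ring_hom_ident: "comm_ring_hom (\<lambda>c::'a::comm_ring_1. c)"
  by unfold_locales simp_all

lemma comm_ring_hom_comp:
  assumes "comm_ring_hom f" "comm_ring_hom g"
  shows "comm_ring_hom (\<lambda>p. g (f p))"
proof -
  interpret f: comm_ring_hom f by fact
  interpret g: comm_ring_hom g by fact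
  show ?thesis by unfold_locales (simp_all add: f.hom_add g.hom_add f.hom_mult g.hom_mult)
qed

section \<open>The ring of polynomials in the variables of a set\<close>

abbreviation PI :: "'v set \<Rightarrow> (('v \<Rightarrow>\<^sub>0 nat) \<Rightarrow>\<^sub>0 'k::comm_ring_1) set" where
  "PI I \<equiv> carrier (mpoly_ring I)"

lemma PI_iff: "p \<in> PI I \<longleftrightarrow> (\<forall>m\<in>keys p. keys m \<subseteq> I)"
  by (simp add: mpoly_ring_def)

lemma mpoly_ring_simps [simp]:
  "p \<otimes>\<^bsub>mpoly_ring I\<^esub> q = p * q" "p \<oplus>\<^bsub>mpoly_ring I\<^esub> q = p + q"
  "\<one>\<^bsub>mpoly_ring I\<^esub> = 1" "\<zero>\<^bsub>mpoly_ring I\<^esub> = 0"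
  by (simp_all add: mpoly_ring_def)

lemma PI_const [simp]: "mp_const c \<in> PI I"
  by (simp add: PI_iff mp_const_def)

lemma PI_var [simp]: "v \<in> I \<Longrightarrow> mp_var v \<in> PI I"
  by (simp add: PI_iff mp_var_def)

lemma PI_zero [simp]: "0 \<in> PI I" and PI_one [simp]: "1 \<in> PI I"
  by (simp_all add: PI_iff)

lemma PI_add [simp]: "p \<in> PI I \<Longrightarrow> q \<in> PI I \<Longrightarrow> p + q \<in> PI I"
  using keys_add[of p q] unfolding PI_iff by blast

lemma PI_mult [simp]: "p \<in> PI I \<Longrightarrow> q \<in> PI I \<Longrightarrow> p * q \<in> PI I"
  unfolding PI_iff
proof
  fix m assume pq: "\<forall>m\<in>keys p. keys m \<subseteq> I" "\<forall>m\<in>keys q. keys m \<subseteq> I"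
    and "m \<in> keys (p * q)"
  then obtain a b where "m = a + b" "a \<in> keys p" "b \<in> keys q" using keys_mult[of p q] by blast
  then show "keys m \<subseteq> I" using pq keys_add[of a b] by blast
qed

lemma PI_uminus [simp]: "p \<in> PI I \<Longrightarrow> - p \<in> PI I"
  by (simp add: PI_iff in_keys_iff)

lemma PI_minus [simp]: "p \<in> PI I \<Longrightarrow> q \<in> PI I \<Longrightarrow> p - q \<in> PI I"
  using PI_add[of p I "- q"] by simp

lemma PI_sum: "(\<And>i. i \<in> S \<Longrightarrow> f i \<in> PI I) \<Longrightarrow> (\<Sum>i\<in>S. f i) \<in> PI I"
  by (induction S rule: infinite_finite_induct) simp_all

lemma PI_prod: "(\<And>i. i \<in> S \<Longrightarrow> f i \<in> PI I) \<Longrightarrow> (\<Prod>i\<in>S. f i) \<in> PI I"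
  by (induction S rule: infinite_finite_induct) simp_all

lemma PI_power [simp]: "p \<in> PI I \<Longrightarrow> p ^ n \<in> PI I"
  by (induction n) simp_all

lemma PI_single [simp]: "keys m \<subseteq> I \<Longrightarrow> single m c \<in> PI I"
  by (simp add: PI_iff)

lemma cring_mpoly_ring: "cring (mpoly_ring I)"
proof (rule cringI)
  show "abelian_group (mpoly_ring I)"
    by (rule abelian_groupI) (auto simp: add_ac intro: bexI[of _ "- x" for x])
  show "Group.comm_monoid (mpoly_ring I)"
    by (rule comm_monoidI) (auto simp: mult_ac)
qed (auto simp: distrib_right)

lemma mpoly_induct [consumes 1, case_names const var add mult]:
  assumes p: "p \<in> PI I" and const: "\<And>c. P (mp_const c)" and var: "\<And>v. v \<in> I \<Longrightarrow> P (mp_var v)"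
    and add: "\<And>p q. p \<in> PI I \<Longrightarrow> q \<in> PI I \<Longrightarrow> P p \<Longrightarrow> P q \<Longrightarrow> P (p + q)"
    and mult: "\<And>p q. p \<in> PI I \<Longrightarrow> q \<in> PI I \<Longrightarrow> P p \<Longrightarrow> P q \<Longrightarrow> P (p * q)"
  shows "P p"
proof -
  interpret c: comm_ring_hom "mp_const :: 'b \<Rightarrow> ('a \<Rightarrow>\<^sub>0 nat) \<Rightarrow>\<^sub>0 'b" by (rule comm_ring_hom_mp_const)
  have one: "P 1" using const[of 1] by simp
  have pow: "P (mp_var v ^ n)" if "v \<in> I" for v n
    using that one var mult by (induction n) simp_all
  have prod: "finite S \<Longrightarrow> S \<subseteq> I \<Longrightarrow> P (\<Prod>v\<in>S. mp_var v ^ f v)" for S f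
  proof (induction S rule: finite_induct)
    case (insert v S)
    then have "P (mp_var v ^ f v * (\<Prod>v\<in>S. mp_var v ^ f v))"
      by (intro mult pow) (auto intro!: PI_prod)
    then show ?case using insert by simp
  qed (use one in simp)
  have single: "P (single m c)" if "keys m \<subseteq> I" for m c
  proof -
    have "P (mp_const c * monom_eval mp_var m)"
      unfolding monom_eval_def using that by (intro mult const prod) (auto intro!: PI_prod)
    then show ?thesis using mp_single_eq[of m c] single_one_eq_monom_eval[of m] by metis
  qed
  have sum: "finite S \<Longrightarrow> S \<subseteq> {m. keys m \<subseteq> I} \<Longrightarrow> P (\<Sum>m\<in>S. single m (f m))" for S f
  proof (induction S rule: finite_induct)
    case (insert m S)
    then have "P (single m (f m) + (\<Sum>m\<in>S. single m (f m)))"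
      by (intro add single) (auto intro!: PI_sum)
    then show ?case using insert by simp
  qed (use const[of 0] in simp)
  show ?thesis using p sum[of "keys p" "lookup p"] mp_sum_singles[of p]
    by (auto simp: PI_iff)
qed

lemma mp_hom_eq_on:
  assumes f: "comm_ring_hom f" and g: "comm_ring_hom g" and p: "p \<in> PI I"
    and "\<And>c. f (mp_const c) = g (mp_const c)" "\<And>v. v \<in> I \<Longrightarrow> f (mp_var v) = g (mp_var v)"
  shows "f p = g p"
proof -
  interpret f: comm_ring_hom f by fact
  interpret g: comm_ring_hom g by fact
  show ?thesis using p by (induction rule: mpoly_induct) (simp_all add: assms f.hom_add g.hom_add f.hom_mult g.hom_mult)
qed

lemma mp_in_PI_UNIV: "p \<in> PI UNIV" by (simp add: PI_iff)

lemma mp_subst_comp: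
  assumes h: "comm_ring_hom h" and g: "comm_ring_hom g"
  shows "g (mp_subst h x p) = mp_subst (\<lambda>c. g (h c)) (\<lambda>v. g (x v)) p"
proof -
  interpret h: comm_ring_hom h by fact
  interpret gh: comm_ring_hom "\<lambda>c. g (h c)" by (rule comm_ring_hom_comp[OF h g])
  show ?thesis
    by (rule mp_hom_eq_on[OF comm_ring_hom_comp[OF h.comm_ring_hom_mp_subst g] gh.comm_ring_hom_mp_subst mp_in_PI_UNIV])
      simp_all
qed

lemma mp_subst_cong:
  assumes "p \<in> PI I" "\<And>v. v \<in> I \<Longrightarrow> x v = y v"
  shows "mp_subst h x p = mp_subst h y p"
proof -
  have "monom_eval x m = monom_eval y m" if "m \<in> keys p" for m
    unfolding monom_eval_def
  proof (rule prod.cong)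
    fix v assume "v \<in> keys m"
    then have "v \<in> I" using assms(1) that by (auto simp: PI_iff)
    then show "x v ^ lookup m v = y v ^ lookup m v" using assms(2) by simp
  qed simp
  then show ?thesis unfolding mp_subst_def by simp
qed

lemma mp_subst_ident: "mp_subst mp_const mp_var p = p"
proof -
  interpret c: comm_ring_hom "mp_const :: 'b \<Rightarrow> ('a \<Rightarrow>\<^sub>0 nat) \<Rightarrow>\<^sub>0 'b" by (rule comm_ring_hom_mp_const)
  show ?thesis
    by (rule mp_hom_eq_on[OF c.comm_ring_hom_mp_subst comm_ring_hom_ident mp_in_PI_UNIV]) simp_all
qed

lemma mp_subst_mem:
  assumes p: "p \<in> PI I" and h: "comm_ring_hom h"
    and "\<And>c. h c \<in> B" "\<And>v. v \<in> I \<Longrightarrow> x v \<in> B" "\<And>a b. a \<in> B \<Longrightarrow> b \<in> B \<Longrightarrow> a + b \<in> B"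
      "\<And>a b. a \<in> B \<Longrightarrow> b \<in> B \<Longrightarrow> a * b \<in> B"
  shows "mp_subst h x p \<in> B"
proof -
  interpret h: comm_ring_hom h by fact
  show ?thesis using p by (induction rule: mpoly_induct) (simp_all add: assms h.mp_subst_add h.mp_subst_mult)
qed

text \<open>The remainder modulo \<open>B\<close> gives digit 0, and what is left is
  \<open>B\<close> times the number with shifted digits. The Kronecker substitution and Nagata's
  change of variables both use this to tell monomials apart.\<close>

lemma base_expansion_inj:
  assumes "(\<Sum>i<n. d i * B ^ i) = (\<Sum>i<n. d' i * B ^ i)" "\<And>i. i < n \<Longrightarrow> d i < (B::nat)" "\<And>i. i < n \<Longrightarrow> d' i < B"
  shows "i < n \<Longrightarrow> d i = d' i"
  using assms
proof (induction n arbitrary: d d' i)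
  case (Suc n)
  have s: "(\<Sum>i<Suc n. e i * B ^ i) = e 0 + B * (\<Sum>i<n. e (Suc i) * B ^ i)" for e
    unfolding sum.lessThan_Suc_shift by (simp add: sum_distrib_left mult_ac)
  have eq: "d 0 + B * (\<Sum>i<n. d (Suc i) * B ^ i) = d' 0 + B * (\<Sum>i<n. d' (Suc i) * B ^ i)"
    using Suc.prems(2) unfolding s .
  have lt: "d 0 < B" "d' 0 < B" using Suc.prems by auto
  have "d 0 = (d 0 + B * (\<Sum>i<n. d (Suc i) * B ^ i)) mod B" using lt by simp
  also have "\<dots> = d' 0" unfolding eq using lt by simp
  finally have 0: "d 0 = d' 0" .
  then have "(\<Sum>i<n. d (Suc i) * B ^ i) = (\<Sum>i<n. d' (Suc i) * B ^ i)" using eq lt by simp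
  then have "d (Suc j) = d' (Suc j)" if "j < n" for j
    using Suc.IH[of j "\<lambda>i. d (Suc i)" "\<lambda>i. d' (Suc i)"] that Suc.prems by simp
  then show ?case using 0 Suc.prems(1) by (cases i) auto
qed simp

lemma exponents_bounded:
  fixes p :: "('v \<Rightarrow>\<^sub>0 nat) \<Rightarrow>\<^sub>0 'k::zero"
  obtains B where "B > 0" "\<And>m v. m \<in> keys p \<Longrightarrow> lookup m v < B"
proof -
  let ?E = "\<Union>m\<in>keys p. lookup m ` keys m"
  have f: "finite ?E" by auto
  show thesis
  proof
    show "Suc (Max (insert 0 ?E)) > 0" by simp
    fix m v assume m: "m \<in> keys p"
    show "lookup m v < Suc (Max (insert 0 ?E))"
    proof (cases "v \<in> keys m")
      case True
      then have "lookup m v \<in> insert 0 ?E" using m by blast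
      then show ?thesis using f by (metis Max_ge finite_insert less_Suc_eq_le)
    next
      case False
      then show ?thesis by (simp add: in_keys_iff)
    qed
  qed
qed

text \<open>The Kronecker substitution \<open>x\<^sub>i := t ^ (B ^ i)\<close> separates the monomials of \<open>p\<close>.\<close>

lemma exists_nonzero_value:
  fixes p :: "(nat \<Rightarrow>\<^sub>0 nat) \<Rightarrow>\<^sub>0 'k::idom"
  assumes inf: "infinite (UNIV :: 'k set)" and p: "p \<noteq> 0"
  shows "\<exists>x. mp_subst (\<lambda>c. c) x p \<noteq> 0"
proof -
  obtain B where B: "B > 0" "\<And>m v. m \<in> keys p \<Longrightarrow> lookup m v < B"
    using exponents_bounded[of p] by blast
  define S where "S = (\<Union>m\<in>keys p. keys m)"
  have "finite S" by (auto simp: S_def)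
  then obtain n where n: "S \<subseteq> {..<n}" using finite_nat_bounded by blast
  define w where "w m = (\<Sum>i<n. lookup m i * B ^ i)" for m :: "nat \<Rightarrow>\<^sub>0 nat"
  have keys: "keys m \<subseteq> {..<n}" if "m \<in> keys p" for m using n that S_def by auto
  have w_inj: "m = m'" if "m \<in> keys p" "m' \<in> keys p" "w m = w m'" for m m'
  proof (rule poly_mapping_eqI)
    fix i
    show "lookup m i = lookup m' i"
    proof (cases "i < n")
      case True
      then show ?thesis using base_expansion_inj[where n = n and d = "lookup m" and B = B and d' = "lookup m'" and i = i] that B(2)
        unfolding w_def by blast
    next
      case False
      then have "i \<notin> keys m" "i \<notin> keys m'" using keys[OF that(1)] keys[OF that(2)] by auto
      then show ?thesis by (simp add: in_keys_iff)
    qed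
  qed
  define g where "g = (\<Sum>m\<in>keys p. Polynomial.monom (lookup p m) (w m))"
  obtain m where m: "m \<in> keys p" using p by (metis ex_in_conv keys_eq_empty)
  have "Polynomial.coeff g (w m) = (\<Sum>m'\<in>keys p. if m' = m then lookup p m else 0)"
    unfolding g_def Polynomial.coeff_sum using w_inj m by (intro sum.cong) auto
  also have "\<dots> = lookup p m" using m by simp
  finally have "g \<noteq> 0" using m by (auto simp: in_keys_iff)
  then have "finite {t. poly g t = 0}" by (rule poly_roots_finite)
  then obtain t where t: "poly g t \<noteq> 0" using inf by (metis (mono_tags) UNIV_I ex_new_if_finite mem_Collect_eq)
  have "monom_eval (\<lambda>i. t ^ (B ^ i)) m = t ^ w m" if "m \<in> keys p" for m
    unfolding w_def by (subst monom_eval_superset[OF _ keys[OF that]])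
      (simp_all add: power_mult[symmetric] power_sum mult.commute)
  then have "mp_subst (\<lambda>c. c) (\<lambda>i. t ^ (B ^ i)) p = poly g t"
    unfolding mp_subst_def g_def poly_sum poly_monom by simp
  then have "mp_subst (\<lambda>c. c) (\<lambda>i. t ^ (B ^ i)) p \<noteq> 0" using t by simp
  then show ?thesis by blast
qed

text \<open>Over a finite field the polynomial 1 + \<Prod>(X - a), with a running over the field,
  has positive degree but takes the value 1 everywhere.\<close>

lemma infinite_UNIV_alg_closed: "infinite (UNIV :: 'k::alg_closed_field set)"
proof
  assume fin: "finite (UNIV :: 'k set)"
  define p where "p = (\<Prod>a\<in>UNIV. [:-a, 1:]) + (1 :: 'k poly)"
  have d: "Polynomial.degree (\<Prod>a\<in>(UNIV::'k set). [:-a, 1:]) = card (UNIV::'k set)" by (subst degree_prod_eq_sum_degree) auto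
  have "card (UNIV :: 'k set) > 0" using fin by (simp add: card_gt_0_iff)
  then have "Polynomial.degree p > 0" unfolding p_def using d by (subst degree_add_eq_left) simp_all
  then obtain x where "poly p x = 0" using alg_closed_imp_poly_has_root by blast
  moreover have "poly p x = 1" unfolding p_def using fin by (auto simp: poly_prod intro!: prod_zero)
  ultimately show False by simp
qed

section \<open>Leading monomials\<close>

definition mdeg :: "('v \<Rightarrow>\<^sub>0 nat) \<Rightarrow> nat" where
  "mdeg m = (\<Sum>v\<in>keys m. lookup m v)"

text \<open>Monomials are compared by degree first and then lexicographically, through \<open>mkey\<close>.\<close>

definition mkey :: "('v \<Rightarrow>\<^sub>0 nat) \<Rightarrow> nat \<times> ('v \<Rightarrow>\<^sub>0 nat)" where
  "mkey m = (mdeg m, m)"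

definition lm :: "(('v::linorder \<Rightarrow>\<^sub>0 nat) \<Rightarrow>\<^sub>0 'k::zero) \<Rightarrow> ('v \<Rightarrow>\<^sub>0 nat)" where
  "lm p = snd (Max (mkey ` keys p))"

definition lc :: "(('v::linorder \<Rightarrow>\<^sub>0 nat) \<Rightarrow>\<^sub>0 'k::zero) \<Rightarrow> 'k" where
  "lc p = lookup p (lm p)"

lemma mdeg_superset: "finite S \<Longrightarrow> keys m \<subseteq> S \<Longrightarrow> mdeg m = (\<Sum>v\<in>S. lookup m v)"
  unfolding mdeg_def by (rule sum.mono_neutral_left) (auto simp: in_keys_iff)

lemma mdeg_add: "mdeg (m + n) = mdeg m + mdeg n"
proof -
  let ?S = "keys m \<union> keys n"
  have "mdeg (m + n) = (\<Sum>v\<in>?S. lookup (m + n) v)"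
    by (rule mdeg_superset) (use keys_add[of m n] in auto)
  then show ?thesis by (simp add: mdeg_superset[of ?S] lookup_add sum.distrib)
qed

lemma lookup_le_mdeg: "lookup m v \<le> mdeg m"
proof (cases "v \<in> keys m")
  case True
  then show ?thesis unfolding mdeg_def by (intro member_le_sum) auto
qed (simp add: in_keys_iff)

lemma mkey_inject [simp]: "mkey m = mkey n \<longleftrightarrow> m = n"
  by (auto simp: mkey_def)

lemma mkey_add_less:
  fixes a b c d :: "'v::linorder \<Rightarrow>\<^sub>0 nat"
  assumes "mkey a \<le> mkey b" "mkey c < mkey d"
  shows "mkey (a + c) < mkey (b + d)"
proof -
  have "mkey (a + c) \<le> mkey (b + c)" using assms(1)
    by (auto simp: mkey_def less_eq_prod_def less_prod_def mdeg_add add_right_mono)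
  also have "\<dots> < mkey (b + d)" using assms(2)
    by (auto simp: mkey_def less_eq_prod_def less_prod_def mdeg_add add_strict_left_mono)
  finally show ?thesis .
qed

lemma mkey_add_le:
  fixes a b c d :: "'v::linorder \<Rightarrow>\<^sub>0 nat"
  assumes "mkey a \<le> mkey b" "mkey c \<le> mkey d"
  shows "mkey (a + c) \<le> mkey (b + d)"
  using mkey_add_less[OF assms(1), of c d] mkey_add_less[OF order.refl[of "mkey c"], of a b] assms
  by (cases "mkey c = mkey d"; cases "mkey a = mkey b") (auto simp: add.commute order.strict_iff_order)

lemma mkey_lm: "p \<noteq> 0 \<Longrightarrow> mkey (lm p) = Max (mkey ` keys p)"
proof -
  assume p: "p \<noteq> 0"
  then have "Max (mkey ` keys p) \<in> mkey ` keys p" by (intro Max_in) auto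
  then show ?thesis unfolding lm_def by (auto simp: mkey_def)
qed

lemma lm_in_keys: "p \<noteq> 0 \<Longrightarrow> lm p \<in> keys p"
proof -
  assume p: "p \<noteq> 0"
  then have "Max (mkey ` keys p) \<in> mkey ` keys p" by (intro Max_in) auto
  then show ?thesis unfolding mkey_lm[OF p, symmetric] by auto
qed

lemma lc_nonzero: "p \<noteq> 0 \<Longrightarrow> lc p \<noteq> 0"
  using lm_in_keys unfolding lc_def by (auto simp: in_keys_iff)

lemma mkey_le_lm: "m \<in> keys p \<Longrightarrow> mkey m \<le> mkey (lm p)"
  by (subst mkey_lm) auto

lemma lm_eqI:
  assumes "lookup p m \<noteq> 0" "\<And>n. n \<in> keys p \<Longrightarrow> mkey n \<le> mkey m"
  shows "lm p = m"
proof -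
  have m: "m \<in> keys p" using assms(1) by (simp add: in_keys_iff)
  then have "p \<noteq> 0" by auto
  then have "mkey (lm p) = mkey m" using assms(2)[OF lm_in_keys] mkey_le_lm[OF m] by (metis order.antisym)
  then show ?thesis by simp
qed

text \<open>When p and q are split into leading term and rest, only the product of the two leading
  terms reaches \<open>lm p + lm q\<close>; all other products of monomials are strictly smaller,
  since the order is compatible with addition.\<close>

lemma lookup_mult_lm:
  fixes p q :: "('v::linorder \<Rightarrow>\<^sub>0 nat) \<Rightarrow>\<^sub>0 'k::idom"
  assumes "p \<noteq> 0" "q \<noteq> 0"
  shows "lookup (p * q) (lm p + lm q) = lc p * lc q"
proof -
  define s where "s = single (lm p) (lc p)"
  define t where "t = single (lm q) (lc q)"
  have low: "mkey n < mkey (lm p)" if "n \<in> keys (p - single (lm p) (lc p))"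
    for n and p :: "('v \<Rightarrow>\<^sub>0 nat) \<Rightarrow>\<^sub>0 'k"
  proof -
    have "n \<noteq> lm p" using that by (auto simp: in_keys_iff lookup_minus lc_def)
    moreover have "n \<in> keys p" using that \<open>n \<noteq> lm p\<close>
      by (auto simp: in_keys_iff lookup_minus lookup_single when_def)
    ultimately show ?thesis using mkey_le_lm[of n p] by (simp add: order.strict_iff_order)
  qed
  have zero: "lookup (a * b) m = 0"
    if "\<And>i j. i \<in> keys a \<Longrightarrow> j \<in> keys b \<Longrightarrow> mkey (i + j) < mkey m"
    for a b :: "('v \<Rightarrow>\<^sub>0 nat) \<Rightarrow>\<^sub>0 'k" and m
  proof (rule ccontr)
    assume "lookup (a * b) m \<noteq> 0"
    then have "m \<in> keys (a * b)" by (simp add: in_keys_iff)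
    then obtain i j where "m = i + j" "i \<in> keys a" "j \<in> keys b"
      using keys_mult[of a b] by blast
    then show False using that by auto
  qed
  have "p * q = s * t + (s * (q - t) + (p - s) * q)" by (simp add: algebra_simps)
  moreover have "lookup (s * (q - t)) (lm p + lm q) = 0"
  proof (rule zero)
    fix i j assume "i \<in> keys s" "j \<in> keys (q - t)"
    then show "mkey (i + j) < mkey (lm p + lm q)"
      using mkey_add_less[OF order.refl low[of j q]] by (auto simp: s_def t_def split: if_splits)
  qed
  moreover have "lookup ((p - s) * q) (lm p + lm q) = 0"
  proof (rule zero)
    fix i j assume "i \<in> keys (p - s)" "j \<in> keys q"
    then have "mkey (j + i) < mkey (lm q + lm p)" unfolding s_def
      by (intro mkey_add_less mkey_le_lm low)
    then show "mkey (i + j) < mkey (lm p + lm q)" by (simp add: add.commute)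
  qed
  ultimately show ?thesis by (simp add: lookup_add s_def t_def mult_single)
qed

lemma lm_mult:
  fixes p q :: "('v::linorder \<Rightarrow>\<^sub>0 nat) \<Rightarrow>\<^sub>0 'k::idom"
  assumes "p \<noteq> 0" "q \<noteq> 0"
  shows "lm (p * q) = lm p + lm q"
proof (rule lm_eqI)
  show "lookup (p * q) (lm p + lm q) \<noteq> 0"
    using lookup_mult_lm[OF assms] lc_nonzero[OF assms(1)] lc_nonzero[OF assms(2)] by simp
  fix n assume "n \<in> keys (p * q)"
  then obtain i j where "n = i + j" "i \<in> keys p" "j \<in> keys q"
    using keys_mult[of p q] by blast
  then show "mkey n \<le> mkey (lm p + lm q)" by (auto intro: mkey_add_le mkey_le_lm)
qed

lemma lc_mult:
  fixes p q :: "('v::linorder \<Rightarrow>\<^sub>0 nat) \<Rightarrow>\<^sub>0 'k::idom"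
  shows "p \<noteq> 0 \<Longrightarrow> q \<noteq> 0 \<Longrightarrow> lc (p * q) = lc p * lc q"
  using lookup_mult_lm[of p q] lm_mult[of p q] unfolding lc_def by simp

lemma lm_single [simp]: "c \<noteq> 0 \<Longrightarrow> lm (single m c) = m"
  by (rule lm_eqI) (auto split: if_splits)

lemma lc_single [simp]: "c \<noteq> 0 \<Longrightarrow> lc (single m c) = c"
  by (simp add: lc_def)

lemma lookup_lm_power:
  fixes p :: "('v::linorder \<Rightarrow>\<^sub>0 nat) \<Rightarrow>\<^sub>0 'k::idom"
  assumes "p \<noteq> 0"
  shows "lookup (lm (p ^ n)) v = n * lookup (lm p) v"
proof (induction n)
  case 0
  have "lm (single 0 1 :: ('v \<Rightarrow>\<^sub>0 nat) \<Rightarrow>\<^sub>0 'k) = 0" by (rule lm_single) simp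
  then show ?case by simp
qed (use assms in \<open>simp add: lm_mult lookup_add\<close>)

lemma lm_diff_less:
  fixes p q :: "('v::linorder \<Rightarrow>\<^sub>0 nat) \<Rightarrow>\<^sub>0 'k::idom"
  assumes "q \<noteq> 0" "lm q = lm p" "lc q = lc p" "p - q \<noteq> 0"
  shows "mkey (lm (p - q)) < mkey (lm p)"
proof -
  have l: "lm (p - q) \<in> keys (p - q)" using assms(4) by (rule lm_in_keys)
  then have "lm (p - q) \<in> keys p \<or> lm (p - q) \<in> keys q"
    by (auto simp: in_keys_iff lookup_minus)
  then have "mkey (lm (p - q)) \<le> mkey (lm p)" using mkey_le_lm assms(2) by metis
  moreover have "lm (p - q) \<noteq> lm p" using l assms(2,3) by (auto simp: in_keys_iff lookup_minus lc_def)
  ultimately show ?thesis by (simp add: order.strict_iff_order)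
qed

section \<open>Finiteness of the set of smaller monomials\<close>

definition monomials_box :: "'v set \<Rightarrow> nat \<Rightarrow> ('v \<Rightarrow>\<^sub>0 nat) set" where
  "monomials_box I n = {m. keys m \<subseteq> I \<and> (\<forall>v. lookup m v \<le> n)}"

lemma bij_monomials_box:
  assumes "finite I"
  shows "bij_betw (\<lambda>m. restrict (lookup m) I) (monomials_box I n) (I \<rightarrow>\<^sub>E {..n})"
proof (rule bij_betw_imageI)
  show "inj_on (\<lambda>m. restrict (lookup m) I) (monomials_box I n)"
  proof (rule inj_onI, rule poly_mapping_eqI)
    fix a b :: "'a \<Rightarrow>\<^sub>0 nat" and v
    assume ab: "a \<in> monomials_box I n" "b \<in> monomials_box I n"
      "restrict (lookup a) I = restrict (lookup b) I"
    show "lookup a v = lookup b v"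
    proof (cases "v \<in> I")
      case True
      then show ?thesis using fun_cong[OF ab(3), of v] by simp
    next
      case False
      then have "v \<notin> keys a" "v \<notin> keys b" using ab by (auto simp: monomials_box_def)
      then show ?thesis by (simp add: in_keys_iff)
    qed
  qed
  show "(\<lambda>m. restrict (lookup m) I) ` monomials_box I n = I \<rightarrow>\<^sub>E {..n}"
  proof
    show "(\<lambda>m. restrict (lookup m) I) ` monomials_box I n \<subseteq> I \<rightarrow>\<^sub>E {..n}"
      by (auto simp: monomials_box_def)
    show "I \<rightarrow>\<^sub>E {..n} \<subseteq> (\<lambda>m. restrict (lookup m) I) ` monomials_box I n"
    proof
      fix f assume f: "f \<in> I \<rightarrow>\<^sub>E {..n}"
      define m where "m = Abs_poly_mapping (\<lambda>v. if v \<in> I then f v else 0)"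
      have "finite {v. (if v \<in> I then f v else 0) \<noteq> 0}" by (rule finite_subset[OF _ assms]) auto
      then have l: "lookup m = (\<lambda>v. if v \<in> I then f v else 0)"
        unfolding m_def by (rule lookup_Abs_poly_mapping)
      have "m \<in> monomials_box I n" using f by (fastforce simp: monomials_box_def l in_keys_iff split: if_splits)
      moreover have "f = restrict (lookup m) I" using f by (auto simp: l fun_eq_iff PiE_def extensional_def)
      ultimately show "f \<in> (\<lambda>m. restrict (lookup m) I) ` monomials_box I n" by blast
    qed
  qed
qed

lemma finite_monomials_box: "finite I \<Longrightarrow> finite (monomials_box I n)"
  using bij_betw_finite[OF bij_monomials_box[of I n]] by (simp add: finite_PiE)

lemma card_monomials_box: "finite I \<Longrightarrow> card (monomials_box I n) = (n + 1) ^ card I"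
  using bij_betw_same_card[OF bij_monomials_box[of I n]] by (simp add: card_PiE)

text \<open>Comparing degrees before exponents leaves only finitely many monomials in a finite set
  of variables below a given one. The rank therefore turns the cancellation of leading terms into an
  induction on natural numbers.\<close>

definition lm_rank :: "'v set \<Rightarrow> ('v::linorder \<Rightarrow>\<^sub>0 nat) \<Rightarrow> nat" where
  "lm_rank I m = card {n. keys n \<subseteq> I \<and> mkey n < mkey m}"

lemma lm_rank_less:
  assumes I: "finite I" and "keys m \<subseteq> I" "mkey m < mkey n"
  shows "lm_rank I m < lm_rank I n"
  unfolding lm_rank_def
proof (rule psubset_card_mono)
  have "{k. keys k \<subseteq> I \<and> mkey k < mkey n} \<subseteq> monomials_box I (mdeg n)"
    using lookup_le_mdeg by (fastforce simp: monomials_box_def mkey_def less_prod_def intro: order.trans)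
  then show "finite {k. keys k \<subseteq> I \<and> mkey k < mkey n}"
    using finite_monomials_box[OF I] finite_subset by blast
  show "{k. keys k \<subseteq> I \<and> mkey k < mkey m} \<subset> {k. keys k \<subseteq> I \<and> mkey k < mkey n}"
    using assms(2,3) by (auto intro: less_trans)
qed

section \<open>Hilbert's basis theorem\<close>

lemma exists_incseq_subseq: "\<exists>g. strict_mono g \<and> incseq (\<lambda>n. (u :: nat \<Rightarrow> nat) (g n))"
proof -
  obtain f where f: "strict_mono f" "monoseq (\<lambda>n. u (f n))" using seq_monosub[of u] by blast
  show ?thesis
  proof (cases "incseq (\<lambda>n. u (f n))")
    case False
    then have d: "decseq (\<lambda>n. u (f n))" using f(2) by (simp add: monoseq_iff)
    obtain N where N: "\<And>n. u (f N) \<le> u (f n)" using ex_has_least_nat[of "\<lambda>_. True" _ "\<lambda>n. u (f n)"] by auto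
    have "u (f (N + n)) = u (f N)" for n
      using N[of "N + n"] decseqD[OF d, of N "N + n"] by simp
    then have "incseq (\<lambda>n. u (f (N + n)))" by (simp add: incseq_def)
    moreover have "strict_mono (\<lambda>n. f (N + n))" using f(1) by (simp add: strict_mono_def)
    ultimately show ?thesis by blast
  qed (use f in blast)
qed

text \<open>Dickson's lemma through subsequences: the sequence is thinned out once per coordinate,
  and the coordinates already treated stay increasing.\<close>

lemma dickson_subseq:
  "finite I \<Longrightarrow> \<exists>g. strict_mono g \<and> (\<forall>v\<in>I. incseq (\<lambda>n. (u :: nat \<Rightarrow> 'v \<Rightarrow> nat) (g n) v))"
proof (induction I rule: finite_induct)
  case empty
  show ?case by (rule exI[of _ "\<lambda>n. n"]) (simp add: strict_mono_def)
next
  case (insert w I)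
  then obtain g where g: "strict_mono g" "\<forall>v\<in>I. incseq (\<lambda>n. u (g n) v)" by blast
  obtain h where h: "strict_mono h" "incseq (\<lambda>n. u (g (h n)) w)" using exists_incseq_subseq[of "\<lambda>n. u (g n) w"] by blast
  have "strict_mono (\<lambda>n. g (h n))" using g(1) h(1) by (simp add: strict_mono_def)
  moreover have "incseq (\<lambda>n. u (g (h n)) v)" if "v \<in> I" for v
    using g(2) that h(1) unfolding incseq_def by (simp add: strict_mono_less_eq)
  ultimately show ?case using h(2) by (intro exI[of _ "\<lambda>n. g (h n)"]) auto
qed

lemma dickson: "finite I \<Longrightarrow> \<exists>i j. i < j \<and> (\<forall>v\<in>I. (u :: nat \<Rightarrow> 'v \<Rightarrow> nat) i v \<le> u j v)"
proof -
  assume "finite I"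
  then obtain g where g: "strict_mono g" "\<forall>v\<in>I. incseq (\<lambda>n. u (g n) v)" using dickson_subseq[of I u] by blast
  then have "g 0 < g 1" "\<forall>v\<in>I. u (g 0) v \<le> u (g 1) v" by (auto simp: strict_mono_def incseq_def)
  then show ?thesis by blast
qed

text \<open>If \<open>J\<close> is not finitely generated, one adds forever an element of
  \<open>J\<close> outside the ideal generated so far, with smallest possible leading monomial.
  Dickson's lemma finds an earlier \<open>p\<close> whose leading monomial divides that of a later
  \<open>q\<close>; after cancelling its leading term with \<open>p\<close>, \<open>q\<close> is
  still outside the ideal, which contradicts minimality.\<close>

theorem noetherian_mpoly_ring:
  fixes I :: "'v::linorder set"
  assumes I: "finite I"
  shows "noetherian_ring (mpoly_ring I :: (('v \<Rightarrow>\<^sub>0 nat) \<Rightarrow>\<^sub>0 'k::field) ring)"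
proof -
  interpret R: cring "mpoly_ring I :: (('v \<Rightarrow>\<^sub>0 nat) \<Rightarrow>\<^sub>0 'k) ring" by (rule cring_mpoly_ring)
  show ?thesis
  proof (rule R.noetherian_ringI, rule ccontr)
    fix J :: "(('v \<Rightarrow>\<^sub>0 nat) \<Rightarrow>\<^sub>0 'k) set"
    assume J: "ideal J (mpoly_ring I)"
      and nfg: "\<not> (\<exists>A\<subseteq>PI I. finite A \<and> J = Idl\<^bsub>mpoly_ring I\<^esub> A)"
    have Jc: "p \<in> PI I" if "p \<in> J" for p using R.ideal_carrier[OF J that] .
    let ?new = "\<lambda>A q. q \<in> J - Idl\<^bsub>mpoly_ring I\<^esub> A"
    define f where "f A = arg_min (\<lambda>q. lm_rank I (lm q)) (?new A)" for A
    have ex: "\<exists>q. ?new A q" if "finite A" "A \<subseteq> J" for A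
    proof -
      have A: "A \<subseteq> PI I" using that(2) Jc by blast
      have "Idl\<^bsub>mpoly_ring I\<^esub> A \<subseteq> J" by (rule R.genideal_minimal[OF J that(2)])
      then show ?thesis using nfg A that(1) by blast
    qed
    have f: "?new A (f A)" "\<And>q. ?new A q \<Longrightarrow> lm_rank I (lm (f A)) \<le> lm_rank I (lm q)" if A: "finite A" "A \<subseteq> J" for A
    proof -
      obtain q where "?new A q" using ex[OF A] by blast
      then show "?new A (f A)" unfolding f_def by (rule arg_min_natI)
      fix q assume "?new A q"
      then show "lm_rank I (lm (f A)) \<le> lm_rank I (lm q)" unfolding f_def by (rule arg_min_nat_le)
    qed
    define S where "S = rec_nat {} (\<lambda>_ A. insert (f A) A)"
    have S0: "S 0 = {}" and SS: "S (Suc n) = insert (f (S n)) (S n)" for n by (simp_all add: S_def)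
    have S: "finite (S n) \<and> S n \<subseteq> J" for n
    proof (induction n)
      case (Suc n)
      then show ?case using f(1)[of "S n"] by (simp add: SS)
    qed (simp add: S0)
    have mono: "i < j \<Longrightarrow> f (S i) \<in> S j" for i j
      by (induction j) (auto simp: SS less_Suc_eq)
    obtain i j where ij: "i < j" "\<And>v. v \<in> I \<Longrightarrow> lookup (lm (f (S i))) v \<le> lookup (lm (f (S j))) v"
      using dickson[OF I, of "\<lambda>n. lookup (lm (f (S n)))"] by blast
    define p where "p = f (S i)"
    define q where "q = f (S j)"
    have pS: "p \<in> S j" unfolding p_def by (rule mono[OF ij(1)])
    have q: "?new (S j) q" "\<And>q'. ?new (S j) q' \<Longrightarrow> lm_rank I (lm q) \<le> lm_rank I (lm q')"
      unfolding q_def using f[of "S j"] S[of j] by blast+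
    have p: "?new (S i) p" unfolding p_def using f[of "S i"] S[of i] by blast
    have SJc: "S n \<subseteq> PI I" for n using S[of n] Jc by blast
    have idl: "ideal (Idl\<^bsub>mpoly_ring I\<^esub> (S n)) (mpoly_ring I)" for n by (rule R.genideal_ideal[OF SJc])
    have p0: "p \<noteq> 0" using p R.ideal_zero_mem[OF idl[of i]] by auto
    have q0: "q \<noteq> 0" using q R.ideal_zero_mem[OF idl[of j]] by auto
    have pc: "p \<in> PI I" "q \<in> PI I" using p q Jc by auto
    have pI: "keys (lm p) \<subseteq> I" "keys (lm q) \<subseteq> I"
      using pc lm_in_keys[OF p0] lm_in_keys[OF q0] by (auto simp: PI_iff)
    have le: "lookup (lm p) v \<le> lookup (lm q) v" for v
    proof (cases "v \<in> I")
      case True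
      then show ?thesis using ij(2)[of v] by (simp add: p_def q_def)
    next
      case False
      then have "v \<notin> keys (lm p)" using pI(1) by blast
      then show ?thesis by (simp add: in_keys_iff)
    qed
    define w where "w = lm q - lm p"
    have w: "w + lm p = lm q" by (rule poly_mapping_eqI) (simp add: w_def lookup_add lookup_minus le)
    have wI: "keys w \<subseteq> I" using pI(2) unfolding w[symmetric]
      by (auto simp: in_keys_iff lookup_add subset_iff)
    define \<mu> where "\<mu> = single w (lc q / lc p)"
    have c: "lc q / lc p \<noteq> 0" using lc_nonzero[OF p0] lc_nonzero[OF q0] by simp
    have \<mu>0: "\<mu> \<noteq> 0" unfolding \<mu>_def using c by (metis lookup_single_eq lookup_zero)
    have \<mu>p: "\<mu> * p \<noteq> 0" "lm (\<mu> * p) = lm q" "lc (\<mu> * p) = lc q"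
      using \<mu>0 p0 c w lc_nonzero[OF p0] by (simp_all add: lm_mult lc_mult \<mu>_def)
    have \<mu>c: "\<mu> \<in> PI I" unfolding \<mu>_def using wI by simp
    have pIdl: "\<mu> * p \<in> Idl\<^bsub>mpoly_ring I\<^esub> (S j)"
      using R.ideal_mult_left[OF idl[of j] \<mu>c, of p] R.genideal_self[OF SJc[of j]] pS by auto
    have \<mu>pJ: "- (\<mu> * p) \<in> J"
      using R.ideal_mult_left[OF J, of "- \<mu>" p] p \<mu>c by simp
    have "q - \<mu> * p \<in> J" using R.ideal_add_mem[OF J, of q "- (\<mu> * p)"] q \<mu>pJ by simp
    moreover have notin: "q - \<mu> * p \<notin> Idl\<^bsub>mpoly_ring I\<^esub> (S j)"
    proof
      assume "q - \<mu> * p \<in> Idl\<^bsub>mpoly_ring I\<^esub> (S j)"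
      from R.ideal_add_mem[OF idl this pIdl] q show False by simp
    qed
    ultimately have new: "?new (S j) (q - \<mu> * p)" by blast
    have nz: "q - \<mu> * p \<noteq> 0" using notin R.ideal_zero_mem[OF idl[of j]] by auto
    have "mkey (lm (q - \<mu> * p)) < mkey (lm q)" by (rule lm_diff_less[OF \<mu>p nz])
    moreover have "keys (lm (q - \<mu> * p)) \<subseteq> I"
      using lm_in_keys[OF nz] PI_minus[OF pc(2) PI_mult[OF \<mu>c pc(1)]] by (auto simp: PI_iff)
    ultimately have "lm_rank I (lm (q - \<mu> * p)) < lm_rank I (lm q)" using lm_rank_less[OF I] by blast
    then show False using q(2)[OF new] by simp
  qed
qed

lemma noetherian_ring_surj:
  assumes h: "ring_hom_ring R S h" and surj: "h ` carrier R = carrier S" and N: "noetherian_ring R"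
  shows "noetherian_ring S"
proof -
  interpret h: ring_hom_ring R S h by fact
  interpret N: noetherian_ring R by fact
  show ?thesis
  proof (rule h.S.noetherian_ringI)
    fix K assume K: "ideal K S"
    obtain T where T: "T \<subseteq> carrier R" "finite T" "{r \<in> carrier R. h r \<in> K} = Idl\<^bsub>R\<^esub> T"
      using N.finetely_gen[OF h.ideal_vimage[OF K]] by blast
    have T': "h ` T \<subseteq> carrier S" using T(1) by auto
    have "K = Idl\<^bsub>S\<^esub> (h ` T)"
    proof
      show "Idl\<^bsub>S\<^esub> (h ` T) \<subseteq> K"
        using T(3) h.R.genideal_self[OF T(1)] by (intro h.S.genideal_minimal[OF K]) blast
      have "Idl\<^bsub>R\<^esub> T \<subseteq> {r \<in> carrier R. h r \<in> Idl\<^bsub>S\<^esub> (h ` T)}"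
        using T(1) h.S.genideal_self[OF T']
        by (intro h.R.genideal_minimal h.ideal_vimage h.S.genideal_ideal[OF T']) auto
      moreover have "K \<subseteq> h ` {r \<in> carrier R. h r \<in> K}"
        using surj ideal.Icarr[OF K] by (auto simp: image_iff)
      ultimately show "K \<subseteq> Idl\<^bsub>S\<^esub> (h ` T)" using T(3) by blast
    qed
    then show "\<exists>A\<subseteq>carrier S. finite A \<and> K = Idl\<^bsub>S\<^esub> A" using T T' by (intro exI[of _ "h ` T"]) auto
  qed
qed

section \<open>Rings spanned by monomials\<close>

definition monomial_ring :: "('v \<Rightarrow>\<^sub>0 nat) set \<Rightarrow> (('v \<Rightarrow>\<^sub>0 nat) \<Rightarrow>\<^sub>0 'k::zero) set" where
  "monomial_ring M = {p. keys p \<subseteq> M}"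

lemma monomial_ring_closed:
  assumes M: "0 \<in> M" "\<forall>a\<in>M. \<forall>b\<in>M. a + b \<in> M"
  shows "0 \<in> (monomial_ring M :: (('v \<Rightarrow>\<^sub>0 nat) \<Rightarrow>\<^sub>0 'k::comm_ring_1) set)"
    and "1 \<in> (monomial_ring M :: (('v \<Rightarrow>\<^sub>0 nat) \<Rightarrow>\<^sub>0 'k) set)"
    and "\<And>p q :: ('v \<Rightarrow>\<^sub>0 nat) \<Rightarrow>\<^sub>0 'k. p \<in> monomial_ring M \<Longrightarrow> q \<in> monomial_ring M \<Longrightarrow> p + q \<in> monomial_ring M"
    and "\<And>p :: ('v \<Rightarrow>\<^sub>0 nat) \<Rightarrow>\<^sub>0 'k. p \<in> monomial_ring M \<Longrightarrow> - p \<in> monomial_ring M"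
    and "\<And>p q :: ('v \<Rightarrow>\<^sub>0 nat) \<Rightarrow>\<^sub>0 'k. p \<in> monomial_ring M \<Longrightarrow> q \<in> monomial_ring M \<Longrightarrow> p * q \<in> monomial_ring M"
proof -
  show "0 \<in> (monomial_ring M :: (('v \<Rightarrow>\<^sub>0 nat) \<Rightarrow>\<^sub>0 'k) set)" "1 \<in> (monomial_ring M :: (('v \<Rightarrow>\<^sub>0 nat) \<Rightarrow>\<^sub>0 'k) set)"
    using M by (auto simp: monomial_ring_def)
  fix p q :: "('v \<Rightarrow>\<^sub>0 nat) \<Rightarrow>\<^sub>0 'k" assume p: "p \<in> monomial_ring M"
  then show "- p \<in> monomial_ring M" by (auto simp: monomial_ring_def in_keys_iff)
  assume q: "q \<in> monomial_ring M"
  show "p + q \<in> monomial_ring M" using keys_add[of p q] p q by (auto simp: monomial_ring_def)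
  show "p * q \<in> monomial_ring M" unfolding monomial_ring_def
  proof (rule CollectI, rule subsetI)
    fix m assume "m \<in> keys (p * q)"
    then obtain a b where "m = a + b" "a \<in> keys p" "b \<in> keys q"
      using keys_mult[of p q] by blast
    then show "m \<in> M" using p q M(2) by (auto simp: monomial_ring_def)
  qed
qed

text \<open>Complete integral closedness is inherited from the monoid: the leading monomials show
  that the leading monomial of \<open>g\<close> divides that of \<open>f\<close>, and subtracting a monomial multiple of
  \<open>g\<close> from \<open>f\<close> preserves the hypothesis.\<close>

lemma monomial_ring_almost_integral:
  fixes M :: "('v::linorder \<Rightarrow>\<^sub>0 nat) set" and f g c :: "('v \<Rightarrow>\<^sub>0 nat) \<Rightarrow>\<^sub>0 'k::field"
  assumes I: "finite I" "\<And>m. m \<in> M \<Longrightarrow> keys m \<subseteq> I"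
    and M: "0 \<in> M" "\<forall>a\<in>M. \<forall>b\<in>M. a + b \<in> M"
    and normal: "\<And>a b c. a \<in> M \<Longrightarrow> b \<in> M \<Longrightarrow> c \<in> M \<Longrightarrow>
      (\<And>n. \<exists>h\<in>M. \<forall>v. lookup c v + n * lookup a v =
         n * lookup b v + lookup h v) \<Longrightarrow> \<exists>w\<in>M. w + b = a"
    and g: "g \<in> monomial_ring M" "g \<noteq> 0" and c: "c \<in> monomial_ring M" "c \<noteq> 0"
  shows "f \<in> monomial_ring M \<Longrightarrow> (\<And>n. \<exists>h\<in>monomial_ring M. c * f ^ n = g ^ n * h) \<Longrightarrow> \<exists>h\<in>monomial_ring M. f = g * h"
proof (induction "lm_rank I (lm f)" arbitrary: f rule: less_induct)
  case less
  note cl = monomial_ring_closed[OF M, where 'k = 'k]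
  have lmM: "lm p \<in> M" if "p \<in> monomial_ring M" "p \<noteq> 0" for p :: "('v \<Rightarrow>\<^sub>0 nat) \<Rightarrow>\<^sub>0 'k"
    using lm_in_keys[OF that(2)] that(1) by (auto simp: monomial_ring_def)
  show ?case
  proof (cases "f = 0")
    case True
    then show ?thesis using cl(1) by (intro bexI[of _ 0]) auto
  next
    case f0: False
    have "\<exists>w\<in>M. w + lm g = lm f"
    proof (rule normal[OF lmM[OF less.prems(1) f0] lmM[OF g] lmM[OF c]])
      fix n
      obtain h where h: "h \<in> monomial_ring M" "c * f ^ n = g ^ n * h" using less.prems(2) by blast
      then have h0: "h \<noteq> 0" using c(2) f0 by auto
      have "lm (c * f ^ n) = lm (g ^ n * h)" using h(2) by simp
      then have "lm c + lm (f ^ n) = lm (g ^ n) + lm h" using c(2) f0 g(2) h0 by (simp add: lm_mult)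
      then have "lookup (lm c + lm (f ^ n)) v = lookup (lm (g ^ n) + lm h) v" for v by simp
      then show "\<exists>h\<in>M. \<forall>v. lookup (lm c) v + n * lookup (lm f) v =
         n * lookup (lm g) v + lookup h v"
        using lmM[OF h(1) h0] f0 g(2) by (intro bexI[of _ "lm h"]) (auto simp: lookup_add lookup_lm_power)
    qed
    then obtain w where w: "w \<in> M" "w + lm g = lm f" by blast
    define \<mu> where "\<mu> = single w (lc f / lc g)"
    have q: "lc f / lc g \<noteq> 0" using lc_nonzero[OF f0] lc_nonzero[OF g(2)] by simp
    have \<mu>: "\<mu> \<in> monomial_ring M" using w(1) by (simp add: \<mu>_def monomial_ring_def)
    have \<mu>0: "\<mu> \<noteq> 0" unfolding \<mu>_def using q by (metis lookup_single_eq lookup_zero)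
    have \<mu>g: "g * \<mu> \<noteq> 0" "lm (g * \<mu>) = lm f" "lc (g * \<mu>) = lc f"
      using \<mu>0 g(2) q w(2) lc_nonzero[OF g(2)] by (simp_all add: lm_mult lc_mult \<mu>_def add.commute)
    have f': "f - g * \<mu> \<in> monomial_ring M"
      using cl(3)[OF less.prems(1) cl(4)[OF cl(5)[OF g(1) \<mu>]]] by simp
    show ?thesis
    proof (cases "f - g * \<mu> = 0")
      case True
      then show ?thesis using \<mu> by (intro bexI[of _ \<mu>]) auto
    next
      case nz: False
      have pw: "p ^ n \<in> monomial_ring M" if "p \<in> monomial_ring M" for p :: "('v \<Rightarrow>\<^sub>0 nat) \<Rightarrow>\<^sub>0 'k" and n
        using that by (induction n) (auto intro: cl)
      have sm: "(\<Sum>i\<in>S. u i) \<in> monomial_ring M" if "\<And>i. i \<in> S \<Longrightarrow> u i \<in> monomial_ring M" for u :: "nat \<Rightarrow> ('v \<Rightarrow>\<^sub>0 nat) \<Rightarrow>\<^sub>0 'k" and S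
        using that by (induction S rule: infinite_finite_induct) (auto intro: cl)
      have nt: "of_nat n \<in> (monomial_ring M :: (('v \<Rightarrow>\<^sub>0 nat) \<Rightarrow>\<^sub>0 'k) set)" for n
        by (induction n) (auto intro: cl)
      have "mkey (lm (f - g * \<mu>)) < mkey (lm f)" by (rule lm_diff_less[OF \<mu>g nz])
      then have "lm_rank I (lm (f - g * \<mu>)) < lm_rank I (lm f)"
        by (rule lm_rank_less[OF I(1) I(2)[OF lmM[OF f' nz]]])
      then have "\<exists>h\<in>monomial_ring M. f - g * \<mu> = g * h"
      proof (rule less.hyps[OF _ f'])
        fix n
        obtain h where h: "\<And>i. h i \<in> monomial_ring M" "\<And>i. c * f ^ i = g ^ i * h i" using less.prems(2) by metis
        \<comment> \<open>Every binomial term is divisible by g^n: c f^i contributes g^i, and (g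
          \<mu>)^(n-i) the remaining factor. So the hypothesis passes from f to f - g \<mu> with the
          same c.\<close>
        have "c * (f - g * \<mu>) ^ n = c * (\<Sum>i\<le>n. of_nat (n choose i) * f ^ i * (- (g * \<mu>)) ^ (n - i))"
          using binomial_ring[of f "- (g * \<mu>)" n] by simp
        also have "\<dots> = (\<Sum>i\<le>n. of_nat (n choose i) * (c * f ^ i) * (- (g * \<mu>)) ^ (n - i))"
          by (simp add: sum_distrib_left mult_ac)
        also have "\<dots> = (\<Sum>i\<le>n. g ^ n * (of_nat (n choose i) * h i * (- \<mu>) ^ (n - i)))"
        proof (rule sum.cong)
          fix i assume "i \<in> {..n}"
          then have "g ^ n = g ^ i * g ^ (n - i)" by (simp add: power_add[symmetric])
          moreover have "(- (g * \<mu>)) ^ (n - i) = g ^ (n - i) * (- \<mu>) ^ (n - i)"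
            by (simp add: power_mult_distrib[symmetric])
          ultimately show "of_nat (n choose i) * (c * f ^ i) * (- (g * \<mu>)) ^ (n - i) = g ^ n * (of_nat (n choose i) * h i * (- \<mu>) ^ (n - i))"
            unfolding h(2) by (simp add: mult_ac)
        qed simp
        finally show "\<exists>h\<in>monomial_ring M. c * (f - g * \<mu>) ^ n = g ^ n * h"
          unfolding sum_distrib_left[symmetric] by (auto intro!: sm cl(5) nt h(1) pw cl(4) \<mu>)
      qed
      then obtain h where "h \<in> monomial_ring M" "f = g * (\<mu> + h)" by (auto simp: algebra_simps)
      then show ?thesis using cl(3)[OF \<mu>] by blast
    qed
  qed
qed

section \<open>Algebraic dependence and chains of prime ideals\<close>

text \<open>Bounding each exponent instead of the total degree gives exactly (n + 1)^(card I)
  monomials for finite \<open>I\<close>, which makes the count in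
  \<open>algebraically_dependent\<close> explicit.\<close>

definition mp_box :: "'v set \<Rightarrow> nat \<Rightarrow> (('v \<Rightarrow>\<^sub>0 nat) \<Rightarrow>\<^sub>0 'k::comm_ring_1) set" where
  "mp_box I n = {p. keys p \<subseteq> monomials_box I n}"

lemma mp_box_mono: "p \<in> mp_box I a \<Longrightarrow> a \<le> b \<Longrightarrow> p \<in> mp_box I b"
  unfolding mp_box_def monomials_box_def by (auto intro: order.trans)

lemma mp_box_one: "1 \<in> mp_box I a"
  by (auto simp: mp_box_def monomials_box_def)

lemma mp_box_mult: "p \<in> mp_box I a \<Longrightarrow> q \<in> mp_box I b \<Longrightarrow> p * q \<in> mp_box I (a + b)"
  unfolding mp_box_def
proof (rule CollectI, rule subsetI, elim CollectE)
  fix m assume pq: "keys p \<subseteq> monomials_box I a" "keys q \<subseteq> monomials_box I b"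
    and "m \<in> keys (p * q)"
  then obtain i j where "m = i + j" "i \<in> keys p" "j \<in> keys q"
    using keys_mult[of p q] by blast
  then show "m \<in> monomials_box I (a + b)" using pq keys_add[of i j]
    by (auto simp: monomials_box_def lookup_add intro!: add_mono) blast
qed

lemma mp_box_power: "p \<in> mp_box I a \<Longrightarrow> p ^ k \<in> mp_box I (k * a)"
  by (induction k) (auto intro: mp_box_one dest: mp_box_mult)

lemma mp_box_prod: "finite S \<Longrightarrow> (\<And>i. i \<in> S \<Longrightarrow> f i \<in> mp_box I (a i)) \<Longrightarrow> (\<Prod>i\<in>S. f i) \<in> mp_box I (\<Sum>i\<in>S. a i)"
  by (induction S rule: finite_induct) (auto intro: mp_box_one mp_box_mult)

lemma vector_space_mp: "vector_space (\<lambda>(c::'k::field) (p :: ('v \<Rightarrow>\<^sub>0 nat) \<Rightarrow>\<^sub>0 'k). mp_const c * p)"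
proof -
  interpret c: comm_ring_hom "mp_const :: 'k \<Rightarrow> ('v \<Rightarrow>\<^sub>0 nat) \<Rightarrow>\<^sub>0 'k" by (rule comm_ring_hom_mp_const)
  show ?thesis by unfold_locales (simp_all add: algebra_simps c.hom_add c.hom_mult)
qed

text \<open>There are (N + 1)^n exponent vectors with entries at most \<open>N\<close>, but the
  corresponding monomials in the \<open>x i\<close> lie in a space spanned by at most (D N +
  1)^(card I) elements, which is fewer for large \<open>N\<close> because
  \<open>card I < n\<close>.\<close>

lemma algebraically_dependent:
  fixes x :: "nat \<Rightarrow> ('v \<Rightarrow>\<^sub>0 nat) \<Rightarrow>\<^sub>0 'k::field"
  assumes I: "finite I" and x: "\<And>i. i < n \<Longrightarrow> x i \<in> PI I" and card: "card I < n"
  shows "\<exists>F\<in>PI {..<n}. F \<noteq> 0 \<and> mp_subst mp_const x F = 0"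
proof -
  interpret c: comm_ring_hom "mp_const :: 'k \<Rightarrow> ('v \<Rightarrow>\<^sub>0 nat) \<Rightarrow>\<^sub>0 'k" by (rule comm_ring_hom_mp_const)
  interpret vs: vector_space "\<lambda>(c::'k) (p :: ('v \<Rightarrow>\<^sub>0 nat) \<Rightarrow>\<^sub>0 'k). mp_const c * p" by (rule vector_space_mp)
  have "\<forall>i. \<exists>B. \<forall>m v. m \<in> keys (x i) \<longrightarrow> lookup m v < B"
  proof
    fix i
    obtain B where "B > 0" "\<And>m v. m \<in> keys (x i) \<Longrightarrow> lookup m v < B"
      using exponents_bounded[of "x i"] by blast
    then show "\<exists>B. \<forall>m v. m \<in> keys (x i) \<longrightarrow> lookup m v < B" by blast
  qed
  then obtain B where B: "\<And>i m v. m \<in> keys (x i) \<Longrightarrow> lookup m v < B i" by metis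
  \<comment> \<open>With d = card I, the choice N = D^d gives (D N + 1)^d \<le> D^d (N + 1)^d = N (N
    + 1)^d < (N + 1)^(d + 1). The \<open>Suc\<close> ensures D \<ge> 1, on which the first
    inequality depends.\<close>
  define D where "D = Suc (\<Sum>i<n. B i)"
  define N where "N = D ^ card I"
  define E where "E = monomials_box {..<n} N"
  define T where "T = (\<lambda>m. single m (1::'k)) ` monomials_box I (D * N)"
  have xB: "x i \<in> mp_box I (B i)" if "i < n" for i
    using x[OF that] B by (auto simp: mp_box_def monomials_box_def PI_iff intro: less_imp_le)
  have E: "monom_eval x e = (\<Prod>i<n. x i ^ lookup e i)" if "e \<in> E" for e
    using that by (intro monom_eval_superset) (auto simp: E_def monomials_box_def)
  have box: "monom_eval x e \<in> mp_box I (D * N)" if e: "e \<in> E" for e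
  proof -
    have 1: "(\<Prod>i<n. x i ^ lookup e i) \<in> mp_box I (\<Sum>i<n. lookup e i * B i)"
      by (intro mp_box_prod mp_box_power xB) auto
    have "(\<Sum>i<n. lookup e i * B i) \<le> (\<Sum>i<n. N * B i)"
      using e by (intro sum_mono mult_right_mono) (auto simp: E_def monomials_box_def)
    also have "\<dots> \<le> D * N" by (simp add: D_def sum_distrib_left[symmetric])
    finally show ?thesis unfolding E[OF e] by (rule mp_box_mono[OF 1])
  qed
  have span: "p \<in> vs.span T" if "p \<in> mp_box I (D * N)" for p
  proof -
    have "(\<Sum>m\<in>keys p. mp_const (lookup p m) * single m 1) \<in> vs.span T"
      using that by (intro vs.span_sum vs.span_scale vs.span_base) (auto simp: T_def mp_box_def)
    then show ?thesis using mp_sum_singles[of p] unfolding mp_single_eq[of _ "lookup p _", symmetric] by simp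
  qed
  have fE: "finite E" unfolding E_def by (rule finite_monomials_box) simp
  have cE: "card E = (N + 1) ^ n" unfolding E_def by (subst card_monomials_box) simp_all
  have fT: "finite T" unfolding T_def using finite_monomials_box[OF I] by simp
  have D1: "D \<ge> 1" by (simp add: D_def)
  have "card T \<le> (D * N + 1) ^ card I" unfolding T_def
    using card_image_le[OF finite_monomials_box[OF I]] card_monomials_box[OF I] by metis
  also have "\<dots> \<le> (D * (N + 1)) ^ card I" using D1 by (intro power_mono) auto
  also have "\<dots> = N * (N + 1) ^ card I" by (simp only: power_mult_distrib N_def)
  also have "\<dots> < (N + 1) ^ Suc (card I)" by simp
  also have "\<dots> \<le> (N + 1) ^ n" using card by (intro power_increasing) auto
  finally have cT: "card T < card E" unfolding cE .
  have E_PI: "e \<in> E \<Longrightarrow> keys e \<subseteq> {..<n}" for e by (auto simp: E_def monomials_box_def)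
  show ?thesis
  \<comment> \<open>Linear dependence speaks of the set of values, so the count applies only if
    different exponent vectors have different values. If two of them agree, the difference of the
    two monomials is already a relation.\<close>
  proof (cases "inj_on (monom_eval x) E")
    case True
    have "vs.dependent (monom_eval x ` E)"
    proof (rule ccontr)
      assume "\<not> vs.dependent (monom_eval x ` E)"
      moreover have "monom_eval x ` E \<subseteq> vs.span T" using span box by auto
      ultimately have "card (monom_eval x ` E) \<le> card T" using vs.independent_span_bound[OF fT] by blast
      then show False using card_image[OF True] cT by simp
    qed
    then obtain u e where u: "(\<Sum>p\<in>monom_eval x ` E. mp_const (u p) * p) = 0" "e \<in> E" "u (monom_eval x e) \<noteq> 0"
      using vs.dependent_finite[of "monom_eval x ` E"] fE by auto
    define F where "F = (\<Sum>e\<in>E. single e (u (monom_eval x e)))"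
    have "lookup F e = u (monom_eval x e)"
      using u(2) fE by (simp add: F_def lookup_sum lookup_single when_def)
    then have "F \<noteq> 0" using u(3) by auto
    moreover have "mp_subst mp_const x F = 0"
      using u(1) by (simp add: F_def c.mp_subst_sum sum.reindex[OF True])
    moreover have "F \<in> PI {..<n}" unfolding F_def using E_PI by (intro PI_sum PI_single)
    ultimately show ?thesis by blast
  next
    case False
    then obtain e e' where e: "e \<in> E" "e' \<in> E" "e \<noteq> e'" "monom_eval x e = monom_eval x e'" by (auto simp: inj_on_def)
    define F where "F = single e (1::'k) + single e' (-1)"
    have "lookup F e = 1" using e(3) by (simp add: F_def lookup_add lookup_single)
    then have "F \<noteq> 0" by auto
    moreover have "mp_subst mp_const x F = 0" using e(4) by (simp add: F_def c.mp_subst_add c.hom_uminus)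
    moreover have "F \<in> PI {..<n}" unfolding F_def using E_PI e by simp
    ultimately show ?thesis by blast
  qed
qed

text \<open>One step of elimination: the part of F without \<open>v\<close> involves one variable
  fewer, and when that part is zero, F can be divided by \<open>v\<close>.\<close>

lemma mp_split_variable:
  fixes F :: "('v \<Rightarrow>\<^sub>0 nat) \<Rightarrow>\<^sub>0 'k::comm_ring_1"
  assumes "F \<in> PI V"
  shows "mp_subst mp_const (mp_var(v := 0)) F \<in> PI (V - {v})"
    and "\<exists>G\<in>PI (insert v V). F = mp_subst mp_const (mp_var(v := 0)) F + mp_var v * G"
proof -
  interpret c: comm_ring_hom "mp_const :: 'k \<Rightarrow> ('v \<Rightarrow>\<^sub>0 nat) \<Rightarrow>\<^sub>0 'k" by (rule comm_ring_hom_mp_const)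
  show "mp_subst mp_const (mp_var(v := 0)) F \<in> PI (V - {v})"
    by (rule mp_subst_mem[OF assms comm_ring_hom_mp_const]) auto
  let ?z = "mp_subst mp_const (mp_var(v := 0 :: ('v \<Rightarrow>\<^sub>0 nat) \<Rightarrow>\<^sub>0 'k))"
  show "\<exists>G\<in>PI (insert v V). F = ?z F + mp_var v * G" using assms
  proof (induction rule: mpoly_induct)
    case (const c)
    show ?case by (rule bexI[of _ 0]) simp_all
  next
    case (var w)
    show ?case using var by (cases "w = v") (auto intro: bexI[of _ 0] bexI[of _ 1])
  next
    case (add p q)
    obtain G where G: "G \<in> PI (insert v V)" "p = ?z p + mp_var v * G" using add by blast
    obtain H where H: "H \<in> PI (insert v V)" "q = ?z q + mp_var v * H" using add by blast
    have "p + q = (?z p + mp_var v * G) + (?z q + mp_var v * H)" by (rule arg_cong2[OF G(2) H(2)])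
    also have "\<dots> = ?z (p + q) + mp_var v * (G + H)" by (simp add: c.mp_subst_add algebra_simps)
    finally show ?case by (rule bexI) (simp add: G(1) H(1))
  next
    case (mult p q)
    obtain G where G: "G \<in> PI (insert v V)" "p = ?z p + mp_var v * G" using mult by blast
    obtain H where H: "H \<in> PI (insert v V)" "q = ?z q + mp_var v * H" using mult by blast
    have z: "?z p \<in> PI (insert v V)" "?z q \<in> PI (insert v V)"
      by (rule mp_subst_mem[OF mult(1) comm_ring_hom_mp_const], auto)
        (rule mp_subst_mem[OF mult(2) comm_ring_hom_mp_const], auto)
    have "p * q = (?z p + mp_var v * G) * (?z q + mp_var v * H)" by (rule arg_cong2[OF G(2) H(2)])
    also have "\<dots> = ?z (p * q) + mp_var v * (?z p * H + G * ?z q + mp_var v * (G * H))"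
      by (simp add: c.mp_subst_mult algebra_simps)
    finally show ?case by (rule bexI) (simp add: G(1) H(1) z)
  qed
qed

text \<open>From \<open>x\<^sub>i \<in> P\<^sub>i\<^sub>+\<^sub>1 - P\<^sub>i\<close> and a relation \<open>F(x\<^sub>0, ..., x\<^sub>n\<^sub>-\<^sub>1) \<in> P\<^sub>0\<close>, one variable at a time is
  eliminated from \<open>F\<close>: divide by a power of \<open>x\<^sub>i\<close> modulo \<open>P\<^sub>i\<close>, then reduce modulo \<open>P\<^sub>i\<^sub>+\<^sub>1\<close>.\<close>

lemma prime_chain_le:
  fixes P :: "nat \<Rightarrow> (('v \<Rightarrow>\<^sub>0 nat) \<Rightarrow>\<^sub>0 'k::field) set"
    and \<phi> :: "(('v \<Rightarrow>\<^sub>0 nat) \<Rightarrow>\<^sub>0 'k) \<Rightarrow> ('w \<Rightarrow>\<^sub>0 nat) \<Rightarrow>\<^sub>0 'k"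
  assumes \<phi>: "comm_ring_hom \<phi>" "\<And>c. \<phi> (mp_const c) = mp_const c" "\<And>p. p \<in> PI I \<Longrightarrow> \<phi> p \<in> PI W"
    and W: "finite W"
    and ker: "\<And>p. p \<in> PI I \<Longrightarrow> \<phi> p = 0 \<Longrightarrow> p \<in> P 0"
    and prime: "\<And>i. i \<le> n \<Longrightarrow> primeideal (P i) (mpoly_ring I)"
    and strict: "\<And>i. i < n \<Longrightarrow> P i \<subset> P (Suc i)"
  shows "n \<le> card W"
proof (rule ccontr)
  assume "\<not> n \<le> card W"
  then have n: "card W < n" by simp
  interpret R: cring "mpoly_ring I :: (('v \<Rightarrow>\<^sub>0 nat) \<Rightarrow>\<^sub>0 'k) ring" by (rule cring_mpoly_ring)
  interpret \<phi>: comm_ring_hom \<phi> by fact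
  interpret c: comm_ring_hom "mp_const :: 'k \<Rightarrow> ('v \<Rightarrow>\<^sub>0 nat) \<Rightarrow>\<^sub>0 'k" by (rule comm_ring_hom_mp_const)
  have id: "ideal (P i) (mpoly_ring I)" if "i \<le> n" for i using prime[OF that] by (simp add: primeideal_def)
  have Pc: "p \<in> PI I" if "p \<in> P i" "i \<le> n" for p i using R.ideal_carrier[OF id[OF that(2)] that(1)] .
  have "\<forall>i. \<exists>x. i < n \<longrightarrow> x \<in> P (Suc i) - P i" using strict by blast
  then obtain x where x: "\<And>i. i < n \<Longrightarrow> x i \<in> P (Suc i)" "\<And>i. i < n \<Longrightarrow> x i \<notin> P i" by (metis DiffE)
  have xc: "x i \<in> PI I" if "i < n" for i using Pc[OF x(1)[OF that]] that by simp
  let ?s = "mp_subst mp_const x"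
  have sc: "?s F \<in> PI I" if "F \<in> PI V" "V \<subseteq> {..<n}" for F V
    by (rule mp_subst_mem[OF that(1) comm_ring_hom_mp_const]) (use that(2) xc in auto)
  have step: "\<exists>F\<in>PI {i..<n}. F \<noteq> 0 \<and> ?s F \<in> P i" if "i \<le> n" for i
    using that
  proof (induction i)
    case 0
    \<comment> \<open>The relation is found among the images under \<phi>, in a polynomial ring with
      too few variables; the kernel hypothesis brings it back into \<open>P 0\<close>.\<close>
    obtain F where F: "F \<in> PI {..<n}" "F \<noteq> 0" "mp_subst mp_const (\<lambda>i. \<phi> (x i)) F = 0"
      using algebraically_dependent[OF W _ n, of "\<lambda>i. \<phi> (x i)"] \<phi>(3) xc by blast
    have "\<phi> (?s F) = 0"
      using F(3) mp_subst_comp[OF comm_ring_hom_mp_const \<phi>(1), of x F] by (simp add: \<phi>(2))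
    then have "?s F \<in> P 0" using sc[OF F(1)] by (intro ker) auto
    then show ?case using F by (auto simp: atLeast0LessThan)
  next
    case (Suc i)
    then have i: "i < n" "i \<le> n" by auto
    let ?Q = "\<lambda>F. F \<in> PI {i..<n} \<and> F \<noteq> 0 \<and> ?s F \<in> P i"
    obtain F0 where "?Q F0" using Suc by auto
    \<comment> \<open>A relation whose leading monomial has minimal degree is not divisible by the
      variable i: since \<open>x i\<close> lies outside the prime \<open>P i\<close>, the quotient
      would be a smaller relation.\<close>
    then obtain F where F: "?Q F" and min: "\<And>G. ?Q G \<Longrightarrow> mdeg (lm F) \<le> mdeg (lm G)"
      using ex_has_least_nat[of ?Q F0 "\<lambda>F. mdeg (lm F)"] by blast
    let ?F0 = "mp_subst mp_const (mp_var(i := 0)) F"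
    have V: "{i..<n} - {i} = {Suc i..<n}" "insert i {i..<n} = {i..<n}" using i by auto
    have F0: "?F0 \<in> PI {Suc i..<n}" using mp_split_variable(1)[of F "{i..<n}" i] F V by simp
    obtain G where G: "G \<in> PI {i..<n}" "F = ?F0 + mp_var i * G"
      using mp_split_variable(2)[of F "{i..<n}" i] F V by auto
    have sF: "?s F = ?s ?F0 + x i * ?s G" by (subst G(2)) (simp add: c.mp_subst_add c.mp_subst_mult)
    have sG: "?s G \<in> PI I" by (rule sc[OF G(1)]) auto
    have "?F0 \<noteq> 0"
    proof
      assume z: "?F0 = 0"
      then have FG: "F = mp_var i * G" using G(2) by simp
      then have G0: "G \<noteq> 0" using F by auto
      have "x i * ?s G \<in> P i" using F sF z by simp
      then have "?s G \<in> P i" using primeideal.I_prime[OF prime[OF i(2)], of "x i" "?s G"] x(2)[OF i(1)] xc[OF i(1)] sG by simp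
      then have "mdeg (lm F) \<le> mdeg (lm G)" using min[of G] G(1) G0 by blast
      moreover have v0: "mp_var i \<noteq> (0 :: (nat \<Rightarrow>\<^sub>0 nat) \<Rightarrow>\<^sub>0 'k)" unfolding mp_var_def by (metis lookup_single_eq lookup_zero one_neq_zero)
      then have "lm F = single i 1 + lm G" unfolding FG using G0 by (simp add: lm_mult) (simp add: mp_var_def)
      then have "mdeg (lm F) = Suc (mdeg (lm G))" by (simp add: mdeg_add) (simp add: mdeg_def)
      ultimately show False by simp
    qed
    moreover have "?s ?F0 \<in> P (Suc i)"
    proof -
      have 1: "?s F \<in> P (Suc i)" using F strict[OF i(1)] by blast
      have 2: "- ?s G * x i \<in> P (Suc i)"
        using R.ideal_mult_left[OF id[OF Suc.prems], of "- ?s G" "x i"] sG x(1)[OF i(1)] by simp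
      have "?s F + - ?s G * x i \<in> P (Suc i)"
        using R.ideal_add_mem[OF id[OF Suc.prems] 1 2] by (simp only: mpoly_ring_simps)
      then show ?thesis unfolding sF by (simp add: mult.commute)
    qed
    ultimately show ?case using F0 by blast
  qed
  obtain F where F: "F \<in> PI {}" "F \<noteq> 0" "?s F \<in> P n" using step[of n] by auto
  have "F = mp_const (lookup F 0)"
  proof (rule poly_mapping_eqI)
    fix m
    show "lookup F m = lookup (mp_const (lookup F 0)) m"
      using F(1) by (cases "m = 0") (auto simp: mp_const_def lookup_single PI_iff in_keys_iff)
  qed
  then obtain a where a: "F = mp_const a" by blast
  then have a0: "a \<noteq> 0" using F(2) by (auto simp: mp_const_def)
  have "mp_const a \<in> P n" using F(3) a by simp
  then have "mp_const (inverse a) * mp_const a \<in> P n"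
    using R.ideal_mult_left[OF id[of n], of "mp_const (inverse a)" "mp_const a"] by simp
  then have "1 \<in> P n" using a0 by (simp add: c.hom_mult[symmetric])
  then show False using ideal.one_imp_carrier[OF id[of n]] primeideal.I_notcarr[OF prime[of n]] by simp
qed

section \<open>Zariski's lemma\<close>

text \<open>Nakayama's lemma modulo \<open>M\<close>, by elimination of one generator at a time.\<close>

lemma nakayama_elimination:
  fixes M B :: "'b::comm_ring_1 set" and v :: "nat \<Rightarrow> 'b" and Q :: "nat \<Rightarrow> nat \<Rightarrow> 'b"
  assumes B: "0 \<in> B" "1 \<in> B" "\<And>a b. a \<in> B \<Longrightarrow> b \<in> B \<Longrightarrow> a + b \<in> B" "\<And>a b. a \<in> B \<Longrightarrow> b \<in> B \<Longrightarrow> a * b \<in> B"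
      "\<And>a. a \<in> B \<Longrightarrow> - a \<in> B"
    and M: "0 \<in> M" "\<And>a b. a \<in> M \<Longrightarrow> b \<in> M \<Longrightarrow> a + b \<in> M" "\<And>a b. a \<in> B \<Longrightarrow> b \<in> M \<Longrightarrow> a * b \<in> M"
    and p: "p \<in> B"
  shows "(\<And>i j. i < N \<Longrightarrow> j < N \<Longrightarrow> Q i j \<in> B) \<Longrightarrow> (\<And>i. i < N \<Longrightarrow> v i - p * (\<Sum>j<N. Q i j * v j) \<in> M) \<Longrightarrow>
    \<exists>z\<in>B. \<forall>i<N. (1 - p * z) * v i \<in> M"
proof (induction N arbitrary: Q)
  case 0
  show ?case using B(1) by blast
next
  case (Suc N)
  have sumM: "(\<Sum>j\<in>S. f j) \<in> M" if "\<And>j. j \<in> S \<Longrightarrow> f j \<in> M" for S and f :: "nat \<Rightarrow> 'b"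
    using that by (induction S rule: infinite_finite_induct) (auto intro: M)
  define w where "w = 1 - p * Q N N"
  have QB: "Q i j \<in> B" if "i < Suc N" "j < Suc N" for i j using Suc.prems(1) that by blast
  have wB: "w \<in> B" using B(3)[OF B(2) B(5)[OF B(4)[OF p QB[of N N]]]] by (simp add: w_def)
  define r where "r = w * v N - p * (\<Sum>j<N. Q N j * v j)"
  have r: "r \<in> M" using Suc.prems(2)[of N] by (simp add: r_def w_def algebra_simps)
  \<comment> \<open>The last relation says that w v_N equals p times the sum of the Q_Nj v_j over j
    < N, modulo \<open>M\<close>. Multiplying row i by w allows v_N to be replaced by this; since w
    v_i = v_i - p Q_NN v_i, the factor w costs an extra Q_NN on the diagonal.\<close>
  define Q' where "Q' i j = w * Q i j + p * Q i N * Q N j + (if j = i then Q N N else 0)" for i j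
  have "\<exists>z\<in>B. \<forall>i<N. (1 - p * z) * v i \<in> M"
  proof (rule Suc.IH[of Q'])
    fix i j assume "i < N" "j < N"
    then show "Q' i j \<in> B" unfolding Q'_def
      by (intro B(3) B(4) wB p QB) (auto intro: QB B(1))
  next
    fix i assume i: "i < N"
    have s: "(\<Sum>j<N. Q' i j * v j) = w * (\<Sum>j<N. Q i j * v j) + p * Q i N * (\<Sum>j<N. Q N j * v j) + Q N N * v i"
    proof -
      have "(\<Sum>j<N. Q' i j * v j) = (\<Sum>j<N. w * (Q i j * v j) + p * Q i N * (Q N j * v j) + (if j = i then Q N N * v i else 0))"
        by (rule sum.cong) (auto simp: Q'_def algebra_simps)
      then show ?thesis using i by (simp add: sum.distrib sum_distrib_left)
    qed
    have "w * (v i - p * (\<Sum>j<Suc N. Q i j * v j)) + (p * Q i N) * r \<in> M"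
      using i by (intro M(2) M(3) wB B(4) p QB r Suc.prems(2)) auto
    also have "w * (v i - p * (\<Sum>j<Suc N. Q i j * v j)) + (p * Q i N) * r = v i - p * (\<Sum>j<N. Q' i j * v j)"
      unfolding s r_def by (simp add: algebra_simps) (simp add: w_def algebra_simps)
    finally show "v i - p * (\<Sum>j<N. Q' i j * v j) \<in> M" .
  qed
  then obtain z where z: "z \<in> B" "\<And>i. i < N \<Longrightarrow> (1 - p * z) * v i \<in> M" by blast
  have zB: "1 - p * z \<in> B" using B(3)[OF B(2) B(5)[OF B(4)[OF p z(1)]]] by simp
  \<comment> \<open>Chosen so that 1 - p z' = (1 - p z) w; the extra factor w is what handles the
    eliminated generator.\<close>
  define z' where "z' = z + (Q N N + - (p * (z * Q N N)))"
  have z'B: "z' \<in> B" unfolding z'_def by (intro B z p QB) auto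
  have z': "1 - p * z' = (1 - p * z) * w" by (simp add: z'_def w_def algebra_simps)
  have "(1 - p * z') * v i \<in> M" if "i < Suc N" for i
  proof (cases "i = N")
    case True
    have "(1 - p * z) * r + p * (\<Sum>j<N. Q N j * ((1 - p * z) * v j)) \<in> M"
      using QB by (intro M(2) M(3) zB r p sumM z) auto
    also have "(1 - p * z) * r + p * (\<Sum>j<N. Q N j * ((1 - p * z) * v j)) = (1 - p * z) * (w * v N)"
    proof -
      have "(\<Sum>j<N. Q N j * ((1 - p * z) * v j)) = (1 - p * z) * (\<Sum>j<N. Q N j * v j)"
        by (simp add: sum_distrib_left mult_ac)
      moreover define T where "T = (\<Sum>j<N. Q N j * v j)"
      ultimately show ?thesis unfolding r_def T_def[symmetric] by (simp only:) (simp add: algebra_simps)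
    qed
    finally show ?thesis unfolding z' using True by (simp add: mult.assoc)
  next
    case False
    then have "w * ((1 - p * z) * v i) \<in> M" using that by (intro M(3) wB z(2)) auto
    then show ?thesis unfolding z' by (simp add: mult_ac)
  qed
  then show ?case using z'B by blast
qed

lemma subst_image_closed:
  fixes h :: "'k::comm_ring_1 \<Rightarrow> 'b::comm_ring_1" and x :: "'v \<Rightarrow> 'b" and S :: "'v set"
  assumes h: "comm_ring_hom h"
  defines "B \<equiv> mp_subst h x ` PI S"
  shows "h c \<in> B" "0 \<in> B" "1 \<in> B" "v \<in> S \<Longrightarrow> x v \<in> B" "a \<in> B \<Longrightarrow> b \<in> B \<Longrightarrow> a + b \<in> B"
    "a \<in> B \<Longrightarrow> b \<in> B \<Longrightarrow> a * b \<in> B" "a \<in> B \<Longrightarrow> - a \<in> B"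
proof -
  interpret h: comm_ring_hom h by fact
  interpret s: comm_ring_hom "mp_subst h x" by (rule h.comm_ring_hom_mp_subst)
  show "h c \<in> B" unfolding B_def by (rule image_eqI[of _ _ "mp_const c"]) simp_all
  show "0 \<in> B" unfolding B_def by (rule image_eqI[of _ _ 0]) simp_all
  show "1 \<in> B" unfolding B_def by (rule image_eqI[of _ _ 1]) simp_all
  show "v \<in> S \<Longrightarrow> x v \<in> B" unfolding B_def by (rule image_eqI[of _ _ "mp_var v"]) simp_all
  show "a \<in> B \<Longrightarrow> b \<in> B \<Longrightarrow> a + b \<in> B" unfolding B_def by (auto simp: s.hom_add[symmetric])
  show "a \<in> B \<Longrightarrow> b \<in> B \<Longrightarrow> a * b \<in> B" unfolding B_def by (auto simp: s.hom_mult[symmetric])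
  show "a \<in> B \<Longrightarrow> - a \<in> B" unfolding B_def by (auto simp: s.hom_uminus[symmetric])
qed

text \<open>Nagata's change of variables \<open>x\<^sub>i' = x\<^sub>i - y ^ (B ^ (i - j))\<close>, \<open>y = x\<^sub>j\<close>, turns the relation \<open>F\<close> into a
  polynomial in \<open>y\<close> with constant leading coefficient (note \<open>x\<^sub>j' = 0\<close>).\<close>

lemma nagata_relation:
  fixes F :: "(nat \<Rightarrow>\<^sub>0 nat) \<Rightarrow>\<^sub>0 'k::field" and \<kappa> :: "'k \<Rightarrow> 'b::comm_ring_1"
  assumes \<kappa>: "comm_ring_hom \<kappa>" and F: "F \<in> PI {j..<j + k}" "F \<noteq> 0"
  obtains B N a c where "c \<noteq> 0" "mp_subst \<kappa> x F = \<kappa> c * x j ^ N + (\<Sum>i<N. a i * x j ^ i)"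
    "\<And>i. a i \<in> mp_subst \<kappa> (\<lambda>i. x i - x j ^ (B ^ (i - j))) ` PI {Suc j..<j + k}"
proof -
  interpret \<kappa>: comm_ring_hom \<kappa> by fact
  obtain B where B0: "B > 0" and B: "\<And>m v. m \<in> keys F \<Longrightarrow> lookup m v < B"
    using exponents_bounded[of F] by blast
  define x' where "x' = (\<lambda>i. x i - x j ^ (B ^ (i - j)))"
  define A where "A = mp_subst \<kappa> x' ` PI {Suc j..<j + k}"
  note A = subst_image_closed[OF \<kappa>, where x = x' and S = "{Suc j..<j + k}", folded A_def]
  have x'j: "x' j = 0" by (simp add: x'_def)
  have xA: "x' i \<in> A" if "i \<in> {j..<j + k}" for i
    using that x'j A(2) A(4)[of i] by (cases "i = j") auto
  \<comment> \<open>A polynomial in one new variable that becomes \<open>x i\<close> when the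
    variable is set to \<open>x j\<close>. For the indices that occur in \<open>F\<close>, its
    coefficients lie in \<open>A\<close>, and it is monic of degree B^(i-j).\<close>
  define t where "t i = [:x' i:] + Polynomial.monom 1 (B ^ (i - j))" for i
  define hc where "hc c = [:\<kappa> c:]" for c
  have hc: "comm_ring_hom hc" by unfold_locales (simp_all add: hc_def \<kappa>.hom_add \<kappa>.hom_mult pCons_one)
  interpret hc: comm_ring_hom hc by fact
  define g where "g = mp_subst hc t F"
  define w where "w m = (\<Sum>i<k. lookup m (j + i) * B ^ i)" for m :: "nat \<Rightarrow>\<^sub>0 nat"
  have keys: "keys m \<subseteq> {j..<j + k}" if "m \<in> keys F" for m using F(1) that by (auto simp: PI_iff)
  have w_inj: "m = m'" if "m \<in> keys F" "m' \<in> keys F" "w m = w m'" for m m'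
  proof (rule poly_mapping_eqI)
    fix i
    show "lookup m i = lookup m' i"
    proof (cases "i \<in> {j..<j + k}")
      case True
      then obtain l where l: "i = j + l" "l < k" by (metis atLeastLessThan_iff le_Suc_ex nat_add_left_cancel_less)
      show ?thesis
        using base_expansion_inj[where n = k and d = "\<lambda>i. lookup m (j + i)" and B = B
            and d' = "\<lambda>i. lookup m' (j + i)" and i = l] that B l
        unfolding w_def by blast
    next
      case False
      then have "i \<notin> keys m" "i \<notin> keys m'" using keys[OF that(1)] keys[OF that(2)] by auto
      then show ?thesis by (simp add: in_keys_iff)
    qed
  qed
  \<comment> \<open>The ring \<open>'b\<close> may have zero divisors; being monic is therefore
    tracked as a degree bound together with the coefficient 1 at that bound.\<close>
  have monic_mult: "Polynomial.degree (p * q) \<le> a + b \<and> Polynomial.coeff (p * q) (a + b) = 1"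
    if "Polynomial.degree p \<le> a \<and> Polynomial.coeff p a = 1" "Polynomial.degree q \<le> b \<and> Polynomial.coeff q b = 1"
    for p q :: "'b poly" and a b
  proof
    show "Polynomial.degree (p * q) \<le> a + b" using that by (intro order.trans[OF degree_mult_le] add_mono) auto
    have "Polynomial.coeff (p * q) (a + b) = (\<Sum>i\<le>a + b. if i = a then 1 else 0)"
      unfolding coeff_mult
    proof (rule sum.cong)
      fix i assume "i \<in> {..a + b}"
      show "Polynomial.coeff p i * Polynomial.coeff q (a + b - i) = (if i = a then 1 else 0)"
      proof (cases i a rule: linorder_cases)
        case less
        then have "Polynomial.coeff q (a + b - i) = 0" using that by (intro Polynomial.coeff_eq_0) auto
        then show ?thesis using less by simp
      next
        case greater
        then have "Polynomial.coeff p i = 0" using that by (intro Polynomial.coeff_eq_0) auto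
        then show ?thesis using greater by simp
      qed (use that in simp)
    qed simp
    then show "Polynomial.coeff (p * q) (a + b) = 1" by simp
  qed
  have monic_power: "Polynomial.degree (p ^ n) \<le> n * a \<and> Polynomial.coeff (p ^ n) (n * a) = 1"
    if "Polynomial.degree p \<le> a \<and> Polynomial.coeff p a = 1" for p :: "'b poly" and a n
    using monic_mult[OF that] by (induction n) (simp_all add: that)
  have monic_prod: "Polynomial.degree (\<Prod>i<n. p i) \<le> (\<Sum>i<n. a i) \<and> Polynomial.coeff (\<Prod>i<n. p i) (\<Sum>i<n. a i) = 1"
    if "\<And>i. i < n \<Longrightarrow> Polynomial.degree (p i) \<le> a i \<and> Polynomial.coeff (p i) (a i) = 1" for p :: "nat \<Rightarrow> 'b poly" and a n
    using that
  proof (induction n)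
    case (Suc n)
    then show ?case using monic_mult[of "\<Prod>i<n. p i" "\<Sum>i<n. a i" "p n" "a n"] by simp
  qed simp
  have t: "Polynomial.degree (t i) \<le> B ^ (i - j) \<and> Polynomial.coeff (t i) (B ^ (i - j)) = 1" for i
  proof -
    have "B ^ (i - j) \<noteq> 0" using B0 by simp
    then show ?thesis unfolding t_def
      by (auto simp: coeff_pCons degree_monom_le intro!: degree_add_le split: nat.splits)
  qed
  have mt: "Polynomial.degree (monom_eval t m) \<le> w m \<and> Polynomial.coeff (monom_eval t m) (w m) = 1"
    if "m \<in> keys F" for m
  proof -
    have "monom_eval t m = (\<Prod>i\<in>{j..<j + k}. t i ^ lookup m i)"
      by (rule monom_eval_superset[OF _ keys[OF that]]) simp
    also have "\<dots> = (\<Prod>i<k. t (j + i) ^ lookup m (j + i))"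
      by (rule prod.reindex_bij_witness[of _ "\<lambda>i. j + i" "\<lambda>i. i - j"]) auto
    finally have mt: "monom_eval t m = (\<Prod>i<k. t (j + i) ^ lookup m (j + i))" .
    have "Polynomial.degree (t (j + i) ^ e) \<le> e * B ^ i \<and> Polynomial.coeff (t (j + i) ^ e) (e * B ^ i) = 1" for i e
      using monic_power[OF t[of "j + i"], of e] by simp
    then show ?thesis unfolding w_def mt by (intro monic_prod)
  qed
  have "keys F \<noteq> {}" using F(2) by (metis keys_eq_empty)
  then have "Max (w ` keys F) \<in> w ` keys F" by (intro Max_in) auto
  then obtain m where m: "m \<in> keys F" and "w m = Max (w ` keys F)" by auto
  then have w_le: "w m' \<le> w m" if "m' \<in> keys F" for m' using that by simp
  define c where "c = lookup F m"
  have c0: "c \<noteq> 0" using m by (simp add: c_def in_keys_iff)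
  have gs: "g = (\<Sum>m\<in>keys F. Polynomial.smult (\<kappa> (lookup F m)) (monom_eval t m))"
    unfolding g_def mp_subst_def hc_def by simp
  have dg: "Polynomial.degree g \<le> w m"
    unfolding gs using w_le mt by (intro degree_sum_le) (auto intro: order.trans[OF degree_smult_le] order.trans)
  have cg: "Polynomial.coeff g (w m) = \<kappa> c"
  proof -
    have "Polynomial.coeff g (w m) = (\<Sum>m'\<in>keys F. if m' = m then \<kappa> c else 0)"
      unfolding gs Polynomial.coeff_sum
    proof (rule sum.cong)
      fix m' assume m': "m' \<in> keys F"
      show "Polynomial.coeff (Polynomial.smult (\<kappa> (lookup F m')) (monom_eval t m')) (w m) = (if m' = m then \<kappa> c else 0)"
      proof (cases "m' = m")
        case True
        then show ?thesis using mt[OF m'] by (simp add: c_def)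
      next
        case False
        then have "w m' < w m" using w_le[OF m'] w_inj[OF m' m] by (cases "w m' = w m") auto
        then have "Polynomial.degree (monom_eval t m') < w m" using mt[OF m'] by simp
        then show ?thesis using False by (simp add: Polynomial.coeff_eq_0)
      qed
    qed simp
    then show ?thesis using m by simp
  qed
  have gA: "\<forall>i. Polynomial.coeff g i \<in> A"
  proof -
    have sA: "(\<Sum>i\<in>S. f i) \<in> A" if "\<And>i. i \<in> S \<Longrightarrow> f i \<in> A" for S :: "nat set" and f
      using that by (induction S rule: infinite_finite_induct) (auto intro: A)
    have "g \<in> {p. \<forall>i. Polynomial.coeff p i \<in> A}" unfolding g_def
    proof (rule mp_subst_mem[OF F(1) hc])
      show "hc c \<in> {p. \<forall>i. Polynomial.coeff p i \<in> A}" for c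
        using A by (auto simp: hc_def coeff_pCons split: nat.splits)
      show "t v \<in> {p. \<forall>i. Polynomial.coeff p i \<in> A}" if "v \<in> {j..<j + k}" for v
        using A xA[OF that] by (auto simp: t_def coeff_pCons intro!: A(5) split: nat.splits)
    qed (auto simp: coeff_mult intro!: A(5) A(6) sA)
    then show ?thesis by simp
  qed
  have ev: "comm_ring_hom (\<lambda>p. poly p (x j))" by unfold_locales simp_all
  have "poly g (x j) = mp_subst (\<lambda>c. poly (hc c) (x j)) (\<lambda>v. poly (t v) (x j)) F"
    unfolding g_def by (rule mp_subst_comp[OF hc ev])
  also have "\<dots> = mp_subst \<kappa> x F" by (simp add: hc_def t_def poly_monom x'_def)
  finally have "mp_subst \<kappa> x F = (\<Sum>i\<le>w m. Polynomial.coeff g i * x j ^ i)"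
    using sum.mono_neutral_left[of "{..w m}" "{..Polynomial.degree g}" "\<lambda>i. Polynomial.coeff g i * x j ^ i"] dg
    by (force simp: poly_altdef Polynomial.coeff_eq_0)
  also have "\<dots> = \<kappa> c * x j ^ w m + (\<Sum>i<w m. Polynomial.coeff g i * x j ^ i)"
    unfolding lessThan_Suc_atMost[symmetric] by (simp add: cg)
  finally have "mp_subst \<kappa> x F = \<kappa> c * x j ^ w m + (\<Sum>i<w m. Polynomial.coeff g i * x j ^ i)" .
  then show thesis using gA unfolding A_def x'_def by (intro that[OF c0, of "w m" "Polynomial.coeff g" B]) auto
qed

lemma poly_map_poly_hom:
  assumes "comm_ring_hom \<kappa>"
  shows "poly (map_poly \<kappa> (p + q)) y = poly (map_poly \<kappa> p) y + poly (map_poly \<kappa> q) y"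
    and "poly (map_poly \<kappa> (Polynomial.smult c p)) y = \<kappa> c * poly (map_poly \<kappa> p) y"
    and "poly (map_poly \<kappa> (Polynomial.monom c n)) y = \<kappa> c * y ^ n"
    and "poly (map_poly \<kappa> ([:c, 1:] * p)) y = (y + \<kappa> c) * poly (map_poly \<kappa> p) y"
proof -
  interpret \<kappa>: comm_ring_hom \<kappa> by fact
  have p: "poly (map_poly \<kappa> (pCons c p)) y = \<kappa> c + y * poly (map_poly \<kappa> p) y" for c p
    by (simp add: map_poly_pCons)
  show add: "poly (map_poly \<kappa> (p + q)) y = poly (map_poly \<kappa> p) y + poly (map_poly \<kappa> q) y" for p q
    by (induction p q rule: poly_induct2) (simp_all add: p \<kappa>.hom_add algebra_simps)
  show smult: "poly (map_poly \<kappa> (Polynomial.smult c p)) y = \<kappa> c * poly (map_poly \<kappa> p) y" for c p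
    by (induction p) (simp_all add: p \<kappa>.hom_mult algebra_simps)
  show "poly (map_poly \<kappa> (Polynomial.monom c n)) y = \<kappa> c * y ^ n"
    by (induction n) (simp_all add: monom_0 monom_Suc p)
  show "poly (map_poly \<kappa> ([:c, 1:] * p)) y = (y + \<kappa> c) * poly (map_poly \<kappa> p) y"
    by (simp add: add smult p algebra_simps)
qed

text \<open>A field is represented by the algebra A generated by the \<open>x i\<close> and a set
  \<open>M\<close> modulo which everything in A outside \<open>M\<close> is invertible. A relation
  for the first generator y is y itself or comes from its inverse. Nagata's change of variables
  makes A finite over an algebra A' with one generator fewer, Nakayama makes A' a field modulo
  \<open>M\<close> again, and by induction the equation of y gets coefficients in k, where it
  splits. \<open>M\<close> is only required to be closed under multiplication by A, so the same set
  serves A'.\<close>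

lemma zariski:
  fixes \<kappa> :: "'k::alg_closed_field \<Rightarrow> 'b::comm_ring_1" and x :: "nat \<Rightarrow> 'b" and i j k :: nat
  assumes \<kappa>: "comm_ring_hom \<kappa>" and M: "0 \<in> M" "\<And>a b. a \<in> M \<Longrightarrow> b \<in> M \<Longrightarrow> a + b \<in> M" and one: "1 \<notin> M"
  shows "(\<And>a b. a \<in> mp_subst \<kappa> x ` PI {j..<j + k} \<Longrightarrow> b \<in> M \<Longrightarrow> a * b \<in> M) \<Longrightarrow>
    (\<And>p. p \<in> mp_subst \<kappa> x ` PI {j..<j + k} \<Longrightarrow> p \<notin> M \<Longrightarrow> \<exists>q\<in>mp_subst \<kappa> x ` PI {j..<j + k}. p * q - 1 \<in> M) \<Longrightarrow>
    i \<in> {j..<j + k} \<Longrightarrow> \<exists>\<alpha>. x i - \<kappa> \<alpha> \<in> M"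
proof (induction k arbitrary: j x i)
  case 0
  then show ?case by simp
next
  case (Suc k)
  interpret \<kappa>: comm_ring_hom \<kappa> by fact
  define A where "A = mp_subst \<kappa> x ` PI {j..<j + Suc k}"
  note A = subst_image_closed[OF \<kappa>, where x = x and S = "{j..<j + Suc k}", folded A_def]
  note MA = Suc.prems(1)[folded A_def]
  note inv = Suc.prems(2)[folded A_def]
  define y where "y = x j"
  have yA: "y \<in> A" unfolding y_def by (rule A(4)) simp
  have "\<exists>F\<in>PI {j..<j + Suc k}. F \<noteq> 0 \<and> mp_subst \<kappa> x F \<in> M"
  proof (cases "y \<in> M")
    case True
    have "mp_var j \<noteq> (0 :: (nat \<Rightarrow>\<^sub>0 nat) \<Rightarrow>\<^sub>0 'k)" unfolding mp_var_def by (metis lookup_single_eq lookup_zero one_neq_zero)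
    then show ?thesis using True by (intro bexI[of _ "mp_var j"]) (auto simp: y_def)
  next
    case False
    then obtain G where G: "G \<in> PI {j..<j + Suc k}" "y * mp_subst \<kappa> x G - 1 \<in> M" using inv[OF yA] by (auto simp: A_def)
    define F where "F = mp_var j * G - 1"
    interpret s: comm_ring_hom "mp_subst \<kappa> x" by (rule \<kappa>.comm_ring_hom_mp_subst)
    have "mp_subst \<kappa> x F \<in> M" using G(2) by (simp add: F_def s.hom_minus s.hom_mult y_def)
    moreover have "F \<noteq> 0"
    proof
      assume "F = 0"
      then have 1: "mp_var j * G = 1" by (simp add: F_def)
      then have G0: "G \<noteq> 0" by auto
      have v0: "mp_var j \<noteq> (0 :: (nat \<Rightarrow>\<^sub>0 nat) \<Rightarrow>\<^sub>0 'k)" unfolding mp_var_def by (metis lookup_single_eq lookup_zero one_neq_zero)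
      have "lm (mp_var j * G) = 0" unfolding 1 using lm_single[of "1::'k" 0] by simp
      moreover have "lm (mp_var j * G) = single j 1 + lm G"
        using G0 v0 by (simp add: lm_mult) (simp add: mp_var_def)
      ultimately have "lookup (single j 1 + lm G) j = 0" by simp
      then show False by (simp add: lookup_add)
    qed
    moreover have "F \<in> PI {j..<j + Suc k}" unfolding F_def using G(1) by (intro PI_minus PI_mult PI_var PI_one) auto
    ultimately show ?thesis by blast
  qed
  then obtain F where F: "F \<in> PI {j..<j + Suc k}" "F \<noteq> 0" "mp_subst \<kappa> x F \<in> M" by blast
  obtain B N a c where c: "c \<noteq> 0" and rel: "mp_subst \<kappa> x F = \<kappa> c * x j ^ N + (\<Sum>i<N. a i * x j ^ i)"
    "\<And>i. a i \<in> mp_subst \<kappa> (\<lambda>i. x i - x j ^ (B ^ (i - j))) ` PI {Suc j..<j + Suc k}"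
    by (rule nagata_relation[OF \<kappa> F(1,2), of x]) (rule that)
  define x' where "x' = (\<lambda>i. x i - x j ^ (B ^ (i - j)))"
  have range: "{Suc j..<j + Suc k} = {Suc j..<Suc j + k}" by simp
  define A' where "A' = mp_subst \<kappa> x' ` PI {Suc j..<Suc j + k}"
  note A' = subst_image_closed[OF \<kappa>, where x = x' and S = "{Suc j..<Suc j + k}", folded A'_def]
  have F_eq: "mp_subst \<kappa> x F = \<kappa> c * y ^ N + (\<Sum>i<N. a i * y ^ i)" and aA': "a i \<in> A'" for i
    using rel unfolding A'_def range x'_def y_def by auto
  have powA: "u ^ n \<in> A" if "u \<in> A" for u n using that by (induction n) (auto intro: A)
  have x'A: "x' i \<in> A" if "i \<in> {j..<j + Suc k}" for i
  proof -
    have "x i + - (y ^ (B ^ (i - j))) \<in> A" by (intro A(5) A(4) A(7) powA yA that)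
    then show ?thesis by (simp add: x'_def y_def)
  qed
  have A'A: "u \<in> A" if "u \<in> A'" for u
    using that unfolding A'_def by (auto intro!: mp_subst_mem[OF _ \<kappa>] A x'A)
  have x'A': "x' i \<in> A'" if "i \<in> {j..<j + Suc k}" for i
    using that A'(2) A'(4)[of i] by (cases "i = j") (auto simp: x'_def)
  have minusM: "- u \<in> M" if "u \<in> M" for u using MA[OF A(7)[OF A(3)] that] by simp
  have sumM: "(\<Sum>j\<in>S. f j) \<in> M" if "\<And>j. j \<in> S \<Longrightarrow> f j \<in> M" for S and f :: "nat \<Rightarrow> 'b"
    using that by (induction S rule: infinite_finite_induct) (auto intro: M)
  define b where "b i = - (\<kappa> (inverse c) * a i)" for i
  have bA': "b i \<in> A'" for i unfolding b_def by (intro A'(1) A'(6) A'(7) aA')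
  have cc: "\<kappa> (inverse c) * \<kappa> c = 1" using c by (simp add: \<kappa>.hom_mult[symmetric])
  have monic: "y ^ N - (\<Sum>i<N. b i * y ^ i) \<in> M"
  proof -
    have "\<kappa> (inverse c) * mp_subst \<kappa> x F \<in> M" by (intro MA A F)
    also have "\<kappa> (inverse c) * mp_subst \<kappa> x F = (\<kappa> (inverse c) * \<kappa> c) * y ^ N + \<kappa> (inverse c) * (\<Sum>i<N. a i * y ^ i)"
      by (simp add: F_eq algebra_simps)
    also have "\<dots> = y ^ N - (\<Sum>i<N. b i * y ^ i)" unfolding cc
      by (simp add: b_def sum_negf sum_distrib_left mult.assoc)
    finally show ?thesis .
  qed
  have "N \<noteq> 0"
  proof
    assume "N = 0"
    then show False using monic one by simp
  qed
  then obtain N' where N: "N = Suc N'" using not0_implies_Suc by blast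
  \<comment> \<open>The span of 1, ..., y^(N-1) over A', modulo \<open>M\<close>. It is stable under
    A' and, by the monic relation, under y; as it contains 1, it contains all of A.\<close>
  define W where "W = {u. \<exists>e. (\<forall>i. e i \<in> A') \<and> u - (\<Sum>i<N. e i * y ^ i) \<in> M}"
  have WI: "u \<in> W" if "\<And>i. e i \<in> A'" "u - (\<Sum>i<N. e i * y ^ i) \<in> M" for u e using that unfolding W_def by blast
  have WE: "\<exists>e. (\<forall>i. e i \<in> A') \<and> u - (\<Sum>i<N. e i * y ^ i) \<in> M" if "u \<in> W" for u using that unfolding W_def by blast
  have W_add: "u + v \<in> W" if uv: "u \<in> W" "v \<in> W" for u v
  proof -
    obtain d e where d: "\<And>i. d i \<in> A'" "u - (\<Sum>i<N. d i * y ^ i) \<in> M" and e: "\<And>i. e i \<in> A'" "v - (\<Sum>i<N. e i * y ^ i) \<in> M"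
      using WE[OF uv(1)] WE[OF uv(2)] by blast
    show ?thesis
    proof (rule WI[of "\<lambda>i. d i + e i"])
      show "u + v - (\<Sum>i<N. (d i + e i) * y ^ i) \<in> M"
        using M(2)[OF d(2) e(2)] by (simp add: sum.distrib algebra_simps)
    qed (intro A' d e)
  qed
  have W_mult: "p * u \<in> W" if p: "p \<in> A'" and u: "u \<in> W" for p u
  proof -
    obtain d where d: "\<And>i. d i \<in> A'" "u - (\<Sum>i<N. d i * y ^ i) \<in> M" using WE[OF u] by blast
    show ?thesis
    proof (rule WI[of "\<lambda>i. p * d i"])
      show "p * u - (\<Sum>i<N. p * d i * y ^ i) \<in> M"
        using MA[OF A'A[OF p] d(2)] by (simp add: sum_distrib_left algebra_simps)
    qed (intro A' d p)
  qed
  have W_y: "y * u \<in> W" if u: "u \<in> W" for u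
  proof -
    obtain d where d: "\<And>i. d i \<in> A'" "u - (\<Sum>i<N. d i * y ^ i) \<in> M" using WE[OF u] by blast
    \<comment> \<open>Multiplication by y shifts the coefficients up by one, and the overflow at y^N
      is rewritten by the monic relation with coefficients \<open>b\<close>.\<close>
    let ?e = "\<lambda>i. (case i of 0 \<Rightarrow> 0 | Suc i \<Rightarrow> d i) + d N' * b i"
    show ?thesis
    proof (rule WI[of ?e])
      show "?e i \<in> A'" for i by (intro A'(5) A'(6) d bA') (auto intro: A' d split: nat.splits)
      have s: "(\<Sum>i<N. ?e i * y ^ i) = (\<Sum>i<N'. d i * y ^ Suc i) + d N' * (\<Sum>i<N. b i * y ^ i)"
      proof -
        have "(\<Sum>i<N. (case i of 0 \<Rightarrow> 0 | Suc i \<Rightarrow> d i) * y ^ i) = (\<Sum>i<N'. d i * y ^ Suc i)"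
          unfolding N sum.lessThan_Suc_shift by simp
        then show ?thesis by (simp add: distrib_right sum.distrib sum_distrib_left mult.assoc)
      qed
      have t: "y * (\<Sum>i<N. d i * y ^ i) = (\<Sum>i<N'. d i * y ^ Suc i) + d N' * y ^ N"
        by (simp add: N distrib_left sum_distrib_left mult_ac)
      have "y * (u - (\<Sum>i<N. d i * y ^ i)) + d N' * (y ^ N - (\<Sum>i<N. b i * y ^ i)) \<in> M"
        by (intro M(2) MA yA d A'A monic)
      then show "y * u - (\<Sum>i<N. ?e i * y ^ i) \<in> M"
        unfolding s right_diff_distrib t by (simp add: algebra_simps)
    qed
  qed
  have W_ypow: "y ^ n * u \<in> W" if u: "u \<in> W" for u n
    by (induction n) (use u W_y in \<open>auto simp: mult.assoc\<close>)
  have W_one: "1 \<in> W"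
  proof (rule WI[of "\<lambda>i. if i = 0 then 1 else 0"])
    have "(\<Sum>i<N. (if i = 0 then 1 else 0) * y ^ i) = 1" unfolding N sum.lessThan_Suc_shift by simp
    then show "1 - (\<Sum>i<N. (if i = 0 then 1 else 0) * y ^ i) \<in> M" using M(1) by simp
  qed (use A' in auto)
  have AW: "u \<in> W" if "u \<in> A" for u
  proof -
    have "\<forall>u\<in>W. mp_subst \<kappa> x G * u \<in> W" if "G \<in> PI {j..<j + Suc k}" for G using that
    proof (induction rule: mpoly_induct)
      case (var i)
      have "x i * u = x' i * u + y ^ (B ^ (i - j)) * u" for u by (simp add: x'_def y_def algebra_simps)
      then show ?case using W_add W_mult[OF x'A'[OF var]] W_ypow by simp
    next
      case (const c)
      show ?case using W_mult[OF A'(1)] by simp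
    next
      case (add p q)
      then show ?case using W_add by (simp add: \<kappa>.mp_subst_add distrib_right)
    next
      case (mult p q)
      then show ?case by (simp add: \<kappa>.mp_subst_mult mult.assoc)
    qed
    then show ?thesis using that W_one unfolding A_def by fastforce
  qed
  \<comment> \<open>The given inverse q of p lies only in A. Writing each q y^i in the powers of y
    over A' yields y^i congruent to p times the sum of the Q_ij y^j, and elimination finds z in A'
    with (1 - p z) y^i in \<open>M\<close>. The case i = 0 says that z inverts p.\<close>
  have inv': "\<exists>q\<in>A'. p * q - 1 \<in> M" if p: "p \<in> A'" "p \<notin> M" for p
  proof -
    obtain q where q: "q \<in> A" "p * q - 1 \<in> M" using inv[OF A'A[OF p(1)] p(2)] by blast
    have "\<forall>i. \<exists>e. (\<forall>j. e j \<in> A') \<and> q * y ^ i - (\<Sum>j<N. e j * y ^ j) \<in> M"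
      using WE[OF AW[OF A(6)[OF q(1) powA[OF yA]]]] by blast
    then obtain Q where Q: "\<And>i j. Q i j \<in> A'" "\<And>i. q * y ^ i - (\<Sum>j<N. Q i j * y ^ j) \<in> M" by metis
    have "\<exists>z\<in>A'. \<forall>i<N. (1 - p * z) * y ^ i \<in> M"
    proof (rule nakayama_elimination[of A' M p N Q "\<lambda>i. y ^ i"])
      fix i
      have "p * (q * y ^ i - (\<Sum>j<N. Q i j * y ^ j)) + - (y ^ i * (p * q - 1)) \<in> M"
        by (intro M(2) MA A'A p Q minusM q powA yA)
      then show "y ^ i - p * (\<Sum>j<N. Q i j * y ^ j) \<in> M" by (simp add: algebra_simps)
    qed (use A' M MA A'A p Q in auto)
    then obtain z where z: "z \<in> A'" "(1 - p * z) * y ^ 0 \<in> M" using \<open>N \<noteq> 0\<close> by blast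
    then show ?thesis using minusM[of "1 - p * z"] by auto
  qed
  have IH: "\<exists>\<alpha>. x' i - \<kappa> \<alpha> \<in> M" if "i \<in> {Suc j..<Suc j + k}" for i
    using Suc.IH[of x' "Suc j" i, folded A'_def] MA A'A inv' that by blast
  have prod_res: "u * v - \<kappa> (\<alpha> * \<beta>) \<in> M" if "u \<in> A" "u - \<kappa> \<alpha> \<in> M" "v - \<kappa> \<beta> \<in> M" for u v \<alpha> \<beta>
  proof -
    have "u * (v - \<kappa> \<beta>) + \<kappa> \<beta> * (u - \<kappa> \<alpha>) \<in> M" by (intro M(2) MA that A)
    then show ?thesis by (simp add: \<kappa>.hom_mult algebra_simps)
  qed
  have res: "\<exists>\<alpha>. u - \<kappa> \<alpha> \<in> M" if "u \<in> A'" for u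
  proof -
    have "\<exists>\<alpha>. mp_subst \<kappa> x' G - \<kappa> \<alpha> \<in> M" if "G \<in> PI {Suc j..<Suc j + k}" for G using that
    proof (induction rule: mpoly_induct)
      case (const c)
      show ?case using M(1) by (intro exI[of _ c]) simp
    next
      case (var v)
      then show ?case using IH by simp
    next
      case (add p q)
      then obtain \<alpha> \<beta> where *: "mp_subst \<kappa> x' p - \<kappa> \<alpha> \<in> M" "mp_subst \<kappa> x' q - \<kappa> \<beta> \<in> M" by blast
      show ?case using M(2)[OF *] by (intro exI[of _ "\<alpha> + \<beta>"]) (simp add: \<kappa>.mp_subst_add \<kappa>.hom_add algebra_simps)
    next
      case (mult p q)
      then obtain \<alpha> \<beta> where *: "mp_subst \<kappa> x' p - \<kappa> \<alpha> \<in> M" "mp_subst \<kappa> x' q - \<kappa> \<beta> \<in> M" by blast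
      have "mp_subst \<kappa> x' p \<in> A" using mult(1) by (intro A'A) (simp add: A'_def)
      then show ?case using prod_res[OF _ *] by (intro exI[of _ "\<alpha> * \<beta>"]) (simp add: \<kappa>.mp_subst_mult)
    qed
    then show ?thesis using that unfolding A'_def by blast
  qed
  obtain \<beta> where \<beta>: "\<And>i. b i - \<kappa> (\<beta> i) \<in> M" using res[OF bA'] by metis
  \<comment> \<open>The monic relation with its coefficients replaced by their residues in k; the
    error is a combination of the elements \<open>b i - \<kappa> (\<beta> i)\<close> of
    \<open>M\<close>.\<close>
  define f where "f = Polynomial.monom 1 N + (\<Sum>i<N. Polynomial.monom (- \<beta> i) i)"
  let ?E = "\<lambda>p. poly (map_poly \<kappa> p) y"
  note E = poly_map_poly_hom[OF \<kappa>]
  have "?E f \<in> M"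
  proof -
    have "?E (\<Sum>i\<in>S. Polynomial.monom (- \<beta> i) i) = - (\<Sum>i\<in>S. \<kappa> (\<beta> i) * y ^ i)" for S
      by (induction S rule: infinite_finite_induct) (simp_all add: E \<kappa>.hom_uminus)
    then have "?E f = (y ^ N - (\<Sum>i<N. b i * y ^ i)) + (\<Sum>i<N. y ^ i * (b i - \<kappa> (\<beta> i)))"
      unfolding f_def by (simp add: E sum_subtractf right_diff_distrib mult.commute)
    also have "\<dots> \<in> M" by (intro M(2) sumM MA powA yA \<beta> monic)
    finally show ?thesis .
  qed
  moreover have "f \<noteq> 0"
  proof -
    have "Polynomial.coeff f N = 1 + (\<Sum>i<N. if i = N then - \<beta> i else 0)" unfolding f_def
      by (simp add: Polynomial.coeff_sum)
    also have "\<dots> = 1" by simp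
    finally show ?thesis by auto
  qed
  moreover have EA: "?E p \<in> A" for p
  proof (induction p)
    case (pCons c p)
    then show ?case using A yA by (simp add: map_poly_pCons)
  qed (use A in simp)
  \<comment> \<open>A root in k splits off a linear factor; modulo \<open>M\<close> either this
    factor vanishes at y or it is invertible and can be cancelled.\<close>
  have "p \<noteq> 0 \<Longrightarrow> ?E p \<in> M \<Longrightarrow> \<exists>\<beta>. y - \<kappa> \<beta> \<in> M" for p
  proof (induction "Polynomial.degree p" arbitrary: p rule: less_induct)
    case less
    show ?case
    proof (cases "Polynomial.degree p = 0")
      case True
      then obtain c where c: "p = [:c:]" by (rule degree_eq_zeroE)
      then have "\<kappa> c \<in> M" "c \<noteq> 0" using less.prems by (auto simp: map_poly_pCons)
      then have "\<kappa> (inverse c) * \<kappa> c \<in> M" by (intro MA A)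
      then show ?thesis using one \<open>c \<noteq> 0\<close> by (simp add: \<kappa>.hom_mult[symmetric])
    next
      case False
      then obtain \<gamma> where "poly p \<gamma> = 0" using alg_closed_imp_poly_has_root by blast
      then obtain q where q: "p = [:- \<gamma>, 1:] * q" using poly_eq_0_iff_dvd by (metis dvdE)
      then have q0: "q \<noteq> 0" using less.prems by auto
      have deg: "Polynomial.degree q < Polynomial.degree p" unfolding q by (subst degree_mult_eq) (use q0 in auto)
      have Eq: "(y - \<kappa> \<gamma>) * ?E q \<in> M" using less.prems(2) unfolding q E by (simp add: \<kappa>.hom_uminus)
      show ?thesis
      proof (cases "y - \<kappa> \<gamma> \<in> M")
        case False
        have "y + - \<kappa> \<gamma> \<in> A" by (intro A(5) yA A(7) A(1))
        then obtain u where u: "u \<in> A" "(y - \<kappa> \<gamma>) * u - 1 \<in> M" using inv[of "y - \<kappa> \<gamma>"] False by auto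
        have "u * ((y - \<kappa> \<gamma>) * ?E q) + - (?E q * ((y - \<kappa> \<gamma>) * u - 1)) \<in> M"
          by (intro M(2) MA u Eq minusM EA)
        then have "?E q \<in> M" by (simp add: algebra_simps)
        then show ?thesis using less.hyps[OF deg q0] by blast
      qed blast
    qed
  qed
  ultimately obtain \<gamma> where \<gamma>: "y - \<kappa> \<gamma> \<in> M" by blast
  have ypow: "y ^ n - \<kappa> (\<gamma> ^ n) \<in> M" for n
  proof (induction n)
    case (Suc n)
    then show ?case using prod_res[OF yA \<gamma> Suc] by simp
  qed (use M in simp)
  show ?case
  proof (cases "i = j")
    case True
    then show ?thesis using \<gamma> by (auto simp: y_def)
  next
    case False
    then obtain \<alpha> where \<alpha>: "x' i - \<kappa> \<alpha> \<in> M" using IH[of i] Suc.prems(3) by auto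
    have "(x' i - \<kappa> \<alpha>) + (y ^ (B ^ (i - j)) - \<kappa> (\<gamma> ^ (B ^ (i - j)))) \<in> M" by (intro M(2) \<alpha> ypow)
    then show ?thesis by (intro exI[of _ "\<alpha> + \<gamma> ^ (B ^ (i - j))"]) (simp add: x'_def y_def \<kappa>.hom_add algebra_simps)
  qed
qed

section \<open>The coordinate ring as a monomial ring\<close>

text \<open>Turns a subset of a type-class ring into a ring record: its ideals can be formed, while
  its elements are still computed with in the ambient ring.\<close>

definition subring_of :: "'b::comm_ring_1 set \<Rightarrow> 'b ring" where
  "subring_of B = \<lparr>carrier = B, mult = (*), one = 1, ring.zero = 0, add = (+)\<rparr>"

lemma subring_of_simps [simp]:
  "carrier (subring_of B) = B" "p \<otimes>\<^bsub>subring_of B\<^esub> q = p * q" "p \<oplus>\<^bsub>subring_of B\<^esub> q = p + q"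
  "\<one>\<^bsub>subring_of B\<^esub> = 1" "\<zero>\<^bsub>subring_of B\<^esub> = 0"
  by (simp_all add: subring_of_def)

definition subring_closed :: "'b::comm_ring_1 set \<Rightarrow> bool" where
  "subring_closed B \<longleftrightarrow> 0 \<in> B \<and> 1 \<in> B \<and> (\<forall>a\<in>B. \<forall>b\<in>B. a + b \<in> B) \<and> (\<forall>a\<in>B. \<forall>b\<in>B. a * b \<in> B) \<and> (\<forall>a\<in>B. - a \<in> B)"

lemma subring_closedD:
  assumes "subring_closed B"
  shows "0 \<in> B" "1 \<in> B" "a \<in> B \<Longrightarrow> b \<in> B \<Longrightarrow> a + b \<in> B" "a \<in> B \<Longrightarrow> b \<in> B \<Longrightarrow> a * b \<in> B" "a \<in> B \<Longrightarrow> - a \<in> B"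
    "a \<in> B \<Longrightarrow> b \<in> B \<Longrightarrow> a - b \<in> B"
  using assms unfolding subring_closed_def by (blast, blast, blast, blast, blast, metis add_uminus_conv_diff)

lemma subring_closed_sum:
  assumes "subring_closed B" "\<And>i. i \<in> S \<Longrightarrow> f i \<in> B"
  shows "(\<Sum>i\<in>S. f i) \<in> B"
  using assms(2) by (induction S rule: infinite_finite_induct) (auto intro: subring_closedD[OF assms(1)])

lemma cring_subring_of:
  assumes "subring_closed B"
  shows "cring (subring_of B)"
proof (rule cringI)
  note B = subring_closedD[OF assms]
  show "abelian_group (subring_of B)"
    by (rule abelian_groupI) (auto simp: add_ac B intro: bexI[of _ "- x" for x])
  show "Group.comm_monoid (subring_of B)"
    by (rule comm_monoidI) (auto simp: mult_ac B)
qed (auto simp: distrib_right)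

text \<open>Variable \<open>0\<close> is the common ratio \<open>\<zeta> = a\<^sub>i / b\<^sub>i\<close>, variable \<open>i \<in> {1..r}\<close> is \<open>b\<^sub>i\<close> and variable \<open>r + i\<close> is
  \<open>c\<^sub>i\<close>; the monomials are those in \<open>b\<^sub>i\<close>, \<open>a\<^sub>i = \<zeta> * b\<^sub>i\<close> and \<open>c\<^sub>i\<close>.\<close>

definition segre_monomials :: "nat \<Rightarrow> (nat \<Rightarrow>\<^sub>0 nat) set" where
  "segre_monomials r = {m. keys m \<subseteq> {..2 * r} \<and>
     lookup m 0 \<le> (\<Sum>i=1..r. lookup m i)}"

abbreviation segre :: "nat \<Rightarrow> ((nat \<Rightarrow>\<^sub>0 nat) \<Rightarrow>\<^sub>0 'k::comm_ring_1) set" where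
  "segre r \<equiv> monomial_ring (segre_monomials r)"

lemma segre_monomials_zero: "0 \<in> segre_monomials r"
  by (simp add: segre_monomials_def)

lemma segre_monomials_add: "\<forall>a\<in>segre_monomials r. \<forall>b\<in>segre_monomials r. a + b \<in> segre_monomials r"
proof (intro ballI)
  fix a b assume ab: "a \<in> segre_monomials r" "b \<in> segre_monomials r"
  then have "keys (a + b) \<subseteq> {..2 * r}" using keys_add[of a b] by (auto simp: segre_monomials_def)
  then show "a + b \<in> segre_monomials r"
    using ab by (auto simp: segre_monomials_def lookup_add sum.distrib add_mono)
qed

lemma subring_closed_segre: "subring_closed (segre r)"
  unfolding subring_closed_def using monomial_ring_closed[OF segre_monomials_zero segre_monomials_add] by blast

lemmas segre_closed = subring_closedD[OF subring_closed_segre]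

lemma segre_const [simp]: "mp_const c \<in> segre r"
  using segre_monomials_zero by (auto simp: mp_const_def monomial_ring_def)

lemma segre_gens:
  assumes "i \<in> {1..r}"
  shows "mp_var i \<in> segre r" "mp_var 0 * mp_var i \<in> segre r" "mp_var (r + i) \<in> segre r"
proof -
  have 1: "single i 1 \<in> segre_monomials r"
    using assms by (auto simp: segre_monomials_def lookup_single when_def)
  then show "mp_var i \<in> segre r" by (auto simp: mp_var_def monomial_ring_def)
  have "(\<Sum>j=1..r. lookup (single 0 1 + single i 1) j) = 1"
    using assms by (simp add: lookup_add lookup_single when_def)
  moreover have "keys (single 0 1 + single i (1::nat)) \<subseteq> {..2 * r}"
    using assms keys_add[of "single 0 1" "single i (1::nat)"] by auto
  ultimately have "single 0 1 + single i 1 \<in> segre_monomials r"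
    using assms by (simp add: segre_monomials_def lookup_add lookup_single when_def)
  then show "mp_var 0 * mp_var i \<in> segre r" by (auto simp: mp_var_def mult_single monomial_ring_def)
  have "single (r + i) 1 \<in> segre_monomials r"
    using assms by (auto simp: segre_monomials_def lookup_single)
  then show "mp_var (r + i) \<in> segre r" by (auto simp: mp_var_def monomial_ring_def)
qed

text \<open>Whenever \<zeta> occurs in a monomial, the defining inequality provides some b_i to pair
  it with, and removing the pair a_i = \<zeta> b_i preserves the inequality. The induction on the
  exponent of \<zeta> ends with products of the b_i and c_i.\<close>

lemma segre_subset:
  fixes B :: "((nat \<Rightarrow>\<^sub>0 nat) \<Rightarrow>\<^sub>0 'k::comm_ring_1) set"
  assumes const: "\<And>c. mp_const c \<in> B" and add: "\<And>a b. a \<in> B \<Longrightarrow> b \<in> B \<Longrightarrow> a + b \<in> B"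
    and mult: "\<And>a b. a \<in> B \<Longrightarrow> b \<in> B \<Longrightarrow> a * b \<in> B"
    and gens: "\<And>i. i \<in> {1..r} \<Longrightarrow> mp_var i \<in> B \<and> mp_var 0 * mp_var i \<in> B \<and> mp_var (r + i) \<in> B"
  shows "segre r \<subseteq> B"
proof
  interpret c: comm_ring_hom "mp_const :: 'k \<Rightarrow> (nat \<Rightarrow>\<^sub>0 nat) \<Rightarrow>\<^sub>0 'k" by (rule comm_ring_hom_mp_const)
  have zero: "0 \<in> B" and one: "1 \<in> B" using const[of 0] const[of 1] by simp_all
  have pow: "a ^ n \<in> B" if "a \<in> B" for a n using that one mult by (induction n) simp_all
  have prod: "(\<Prod>i\<in>S. f i) \<in> B" if "\<And>i. i \<in> S \<Longrightarrow> f i \<in> B" for S :: "nat set" and f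
    using that one mult by (induction S rule: infinite_finite_induct) auto
  have sum: "(\<Sum>i\<in>S. f i) \<in> B" if "\<And>i. i \<in> S \<Longrightarrow> f i \<in> B" for S :: "(nat \<Rightarrow>\<^sub>0 nat) set" and f
    using that zero add by (induction S rule: infinite_finite_induct) auto
  have mono: "m \<in> segre_monomials r \<Longrightarrow> single m 1 \<in> B" for m
  proof (induction "lookup m 0" arbitrary: m)
    case 0
    have "mp_var v ^ lookup m v \<in> B" if "v \<in> keys m" for v
    proof (rule pow)
      have v: "v \<noteq> 0" using 0(1) that by (intro notI) (simp add: in_keys_iff)
      have "v \<le> 2 * r" using 0(2) that by (auto simp: segre_monomials_def)
      with v have "v \<in> {1..r} \<or> (\<exists>i\<in>{1..r}. v = r + i)"
      proof (cases "v \<le> r")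
        case False
        then have "v - r \<in> {1..r}" "v = r + (v - r)" using \<open>v \<le> 2 * r\<close> by auto
        then show ?thesis by blast
      qed (use v in auto)
      then show "mp_var v \<in> B" using gens by blast
    qed
    then show ?case unfolding single_one_eq_monom_eval monom_eval_def by (rule prod)
  next
    case (Suc n)
    have "(\<Sum>i=1..r. lookup m i) \<noteq> 0"
      using Suc(2,3) by (simp add: segre_monomials_def del: sum_eq_0_iff)
    then obtain i where i: "i \<in> {1..r}" "lookup m i \<noteq> 0"
      by (rule sum.not_neutral_contains_not_neutral)
    define m' where "m' = m - (single 0 1 + single i 1)"
    have m: "m = (single 0 1 + single i 1) + m'"
      using i Suc(2) by (intro poly_mapping_eqI) (auto simp: m'_def lookup_add lookup_minus lookup_single when_def)
    have l: "lookup m' 0 = n" using i Suc(2) by (simp add: m'_def lookup_minus lookup_add lookup_single)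
    have "(\<Sum>j=1..r. lookup m j) = (\<Sum>j=1..r. (if j = i then 1 else 0) + lookup m' j)"
      by (subst m, rule sum.cong) (auto simp: lookup_add lookup_single when_def)
    also have "\<dots> = 1 + (\<Sum>j=1..r. lookup m' j)" using i(1) by (simp add: sum.distrib del: One_nat_def)
    finally have "lookup m' 0 \<le> (\<Sum>j=1..r. lookup m' j)"
      using Suc(2,3) l by (simp add: segre_monomials_def)
    moreover have "keys m' \<subseteq> keys m" by (subst m) (auto simp: in_keys_iff lookup_add)
    ultimately have "m' \<in> segre_monomials r" using Suc(3) by (auto simp: segre_monomials_def)
    then have "single m' 1 \<in> B" using Suc(1)[of m'] l by simp
    then have "(mp_var 0 * mp_var i) * single m' 1 \<in> B" using gens[OF i(1)] mult[of "mp_var 0 * mp_var i"] by blast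
    also have "(mp_var 0 * mp_var i) * single m' 1 = single m 1"
      by (subst m) (simp add: mp_var_def mult_single)
    finally show ?case .
  qed
  fix p :: "(nat \<Rightarrow>\<^sub>0 nat) \<Rightarrow>\<^sub>0 'k" assume p: "p \<in> segre r"
  have "(\<Sum>m\<in>keys p. mp_const (lookup p m) * single m 1) \<in> B"
    using p by (intro sum mult const mono) (auto simp: monomial_ring_def)
  then show "p \<in> B" using mp_sum_singles[of p] unfolding mp_single_eq[of _ "lookup p _", symmetric] by simp
qed

text \<open>The exponents are cut out by linear inequalities. If c + n (a - b) satisfies them for
  every n, then so does a - b, because a violation grows with n beyond what c can compensate; taking
  n one more than the contribution of c is enough.\<close>

lemma segre_almost_integral:
  fixes f g c :: "(nat \<Rightarrow>\<^sub>0 nat) \<Rightarrow>\<^sub>0 'k::field"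
  assumes "f \<in> segre r" "g \<in> segre r" "c \<in> segre r" "g \<noteq> 0" "c \<noteq> 0"
    and "\<And>n. \<exists>h\<in>segre r. c * f ^ n = g ^ n * h"
  shows "\<exists>h\<in>segre r. f = g * h"
proof (rule monomial_ring_almost_integral[where I = "{..2 * r}" and M = "segre_monomials r" and f = f and g = g and c = c])
  fix a b c assume a: "a \<in> segre_monomials r" and b: "b \<in> segre_monomials r" and c: "c \<in> segre_monomials r"
    and ex: "\<And>n. \<exists>h\<in>segre_monomials r. \<forall>v. lookup c v + n * lookup a v =
         n * lookup b v + lookup h v"
  have le: "lookup b v \<le> lookup a v" for v
  proof (rule ccontr)
    assume "\<not> ?thesis"
    then have "Suc (lookup a v) \<le> lookup b v" by simp
    let ?n = "Suc (lookup c v)"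
    have "?n * Suc (lookup a v) \<le> ?n * lookup b v"
      using \<open>Suc (lookup a v) \<le> lookup b v\<close> by (intro mult_left_mono) auto
    moreover obtain h where "lookup c v + ?n * lookup a v = ?n * lookup b v + lookup h v"
      using ex by blast
    ultimately show False by simp
  qed
  define w where "w = a - b"
  have w: "w + b = a" by (rule poly_mapping_eqI) (simp add: w_def lookup_add lookup_minus le)
  have lw: "lookup a v = lookup w v + lookup b v" for v
    unfolding w[symmetric] by (simp add: lookup_add)
  have "lookup w 0 \<le> (\<Sum>i=1..r. lookup w i)"
  proof (rule ccontr)
    assume "\<not> ?thesis"
    then have W: "Suc (\<Sum>i=1..r. lookup w i) \<le> lookup w 0" by simp
    define n where "n = Suc (\<Sum>i=1..r. lookup c i)"
    obtain h where h: "h \<in> segre_monomials r" "\<And>v. lookup c v + n * lookup a v =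
         n * lookup b v + lookup h v" using ex by blast
    have hv: "lookup h v = lookup c v + n * lookup w v" for v
      using h(2)[of v] lw[of v] by (simp add: distrib_left)
    have "n * Suc (\<Sum>i=1..r. lookup w i) \<le> n * lookup w 0" using W by (rule mult_left_mono) simp
    also have "\<dots> \<le> lookup h 0" by (simp add: hv)
    also have "\<dots> \<le> (\<Sum>i=1..r. lookup h i)" using h(1) by (simp add: segre_monomials_def)
    also have "\<dots> = (\<Sum>i=1..r. lookup c i) + n * (\<Sum>i=1..r. lookup w i)"
      by (simp add: hv sum.distrib sum_distrib_left)
    finally show False by (simp add: n_def)
  qed
  moreover have "keys w \<subseteq> keys a" by (auto simp: in_keys_iff lw)
  then have "keys w \<subseteq> {..2 * r}" using a by (auto simp: segre_monomials_def)
  ultimately show "\<exists>w\<in>segre_monomials r. w + b = a" using w by (auto simp: segre_monomials_def)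
next
  show "keys m \<subseteq> {..2 * r}" if "m \<in> segre_monomials r" for m
    using that by (simp add: segre_monomials_def)
qed (use assms segre_monomials_zero segre_monomials_add in simp_all)

section \<open>Freeness over a polynomial ring\<close>

type_synonym 'k npoly = "(nat \<Rightarrow>\<^sub>0 nat) \<Rightarrow>\<^sub>0 'k"

text \<open>With \<open>\<zeta>\<close> and \<open>b\<^sub>i\<close> as above, the parameters are \<open>a\<^sub>1\<close>, the differences \<open>b\<^sub>i - a\<^sub>i\<^sub>+\<^sub>1\<close>, \<open>b\<^sub>r\<close> and
  the \<open>c\<^sub>i\<close>; \<open>1, b\<^sub>1, ..., b\<^sub>r\<^sub>-\<^sub>1\<close> is a basis over the polynomial ring they generate.\<close>

definition segre_param :: "nat \<Rightarrow> nat \<Rightarrow> (nat \<Rightarrow>\<^sub>0 nat) \<Rightarrow>\<^sub>0 'k::comm_ring_1" where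
  "segre_param r w = (if w = 0 then mp_var 0 * mp_var 1 else if w < r then mp_var w - mp_var 0 * mp_var (Suc w)
     else mp_var w)"

text \<open>The indices 0, ..., 2r do double duty: they name the variables of the ambient ring and,
  through \<open>segre_param\<close>, the 2r + 1 parameters. The map sends an abstract polynomial in
  the parameters to its value.\<close>

abbreviation param_subst :: "nat \<Rightarrow> ((nat \<Rightarrow>\<^sub>0 nat) \<Rightarrow>\<^sub>0 'k::comm_ring_1) \<Rightarrow> (nat \<Rightarrow>\<^sub>0 nat) \<Rightarrow>\<^sub>0 'k" where
  "param_subst r \<equiv> mp_subst mp_const (segre_param r)"

definition segre_basis :: "nat \<Rightarrow> (nat \<Rightarrow>\<^sub>0 nat) \<Rightarrow>\<^sub>0 'k::comm_ring_1" where
  "segre_basis i = (if i = 0 then 1 else mp_var i)"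

definition segre_comb :: "nat \<Rightarrow> (nat \<Rightarrow> (nat \<Rightarrow>\<^sub>0 nat) \<Rightarrow>\<^sub>0 'k::comm_ring_1) \<Rightarrow> (nat \<Rightarrow>\<^sub>0 nat) \<Rightarrow>\<^sub>0 'k" where
  "segre_comb r p = (\<Sum>i<r. param_subst r (p i) * segre_basis i)"

lemma segre_param_mem:
  assumes "r \<ge> 1" "w \<le> 2 * r"
  shows "segre_param r w \<in> (segre r :: 'k::comm_ring_1 npoly set)"
proof -
  have "mp_var w \<in> (segre r :: 'k npoly set)" if "w \<noteq> 0"
  proof (cases "w \<le> r")
    case True
    then show ?thesis using that by (intro segre_gens(1)) auto
  next
    case False
    then have "w - r \<in> {1..r}" using assms by auto
    from segre_gens(3)[OF this] show ?thesis using False by simp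
  qed
  then show ?thesis using assms
    by (auto simp: segre_param_def intro!: segre_gens(2) segre_closed(6))
qed

lemma segre_basis_mem: "i < r \<Longrightarrow> segre_basis i \<in> segre r"
  by (auto simp: segre_basis_def intro!: segre_gens(1) segre_closed(2))

section \<open>Generation over the parameters\<close>

context fixes r :: nat assumes r: "r \<ge> 1" begin

interpretation c: comm_ring_hom "mp_const :: 'k::comm_ring_1 \<Rightarrow> (nat \<Rightarrow>\<^sub>0 nat) \<Rightarrow>\<^sub>0 'k" by (rule comm_ring_hom_mp_const)
interpretation \<iota>: comm_ring_hom "param_subst r :: ((nat \<Rightarrow>\<^sub>0 nat) \<Rightarrow>\<^sub>0 'k::comm_ring_1) \<Rightarrow> _"
  by (rule c.comm_ring_hom_mp_subst)

lemma param_subst_mem: "p \<in> PI {..2 * r} \<Longrightarrow> param_subst r p \<in> segre r"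
  by (rule mp_subst_mem[OF _ comm_ring_hom_mp_const]) (auto intro: segre_closed segre_param_mem r)

lemma segre_comb_mem: "(\<And>i. i < r \<Longrightarrow> p i \<in> PI {..2 * r}) \<Longrightarrow> segre_comb r p \<in> segre r"
  unfolding segre_comb_def
  by (rule subring_closed_sum[OF subring_closed_segre]) (auto intro: segre_closed(4) param_subst_mem segre_basis_mem)

lemma segre_comb_add: "segre_comb r (\<lambda>i. p i + q i) = segre_comb r p + segre_comb r q"
  by (simp add: segre_comb_def \<iota>.hom_add distrib_right sum.distrib)

lemma segre_comb_mult: "segre_comb r (\<lambda>i. q * p i) = param_subst r q * segre_comb r p"
  by (simp add: segre_comb_def \<iota>.hom_mult sum_distrib_left mult.assoc)

definition segre_span :: "((nat \<Rightarrow>\<^sub>0 nat) \<Rightarrow>\<^sub>0 'k::comm_ring_1) set" where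
  "segre_span = {segre_comb r p | p. \<forall>i. p i \<in> PI {..2 * r}}"

lemma segre_span_add:
  assumes "u \<in> segre_span" "v \<in> segre_span"
  shows "u + v \<in> segre_span"
proof -
  obtain p q where "u = segre_comb r p" "v = segre_comb r q" "\<And>i. p i \<in> PI {..2 * r}" "\<And>i. q i \<in> PI {..2 * r}"
    using assms unfolding segre_span_def by blast
  then show ?thesis unfolding segre_span_def
    by (intro CollectI exI[of _ "\<lambda>i. p i + q i"]) (simp add: segre_comb_add)
qed

lemma segre_span_mult:
  assumes "q \<in> PI {..2 * r}" "u \<in> segre_span"
  shows "param_subst r q * u \<in> segre_span"
proof -
  obtain p where "u = segre_comb r p" "\<And>i. p i \<in> PI {..2 * r}" using assms unfolding segre_span_def by blast
  then show ?thesis using assms(1) unfolding segre_span_def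
    by (intro CollectI exI[of _ "\<lambda>i. q * p i"]) (simp add: segre_comb_mult)
qed

lemma segre_span_sum:
  assumes "\<And>i. i \<in> S \<Longrightarrow> f i \<in> segre_span" shows "(\<Sum>i\<in>S. f i) \<in> (segre_span :: ((nat \<Rightarrow>\<^sub>0 nat) \<Rightarrow>\<^sub>0 'k::comm_ring_1) set)"
proof -
  have "(0 :: (nat \<Rightarrow>\<^sub>0 nat) \<Rightarrow>\<^sub>0 'k) \<in> segre_span" unfolding segre_span_def
    by (intro CollectI exI[of _ "\<lambda>_. 0"]) (simp add: segre_comb_def)
  then show ?thesis using assms by (induction S rule: infinite_finite_induct) (auto intro: segre_span_add)
qed

lemma segre_span_basis:
  assumes i: "i < r"
  shows "segre_basis i \<in> (segre_span :: 'k::comm_ring_1 npoly set)"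
proof -
  have "segre_comb r (\<lambda>j. if j = i then 1 else 0) = (\<Sum>j<r. if j = i then segre_basis i else (0 :: 'k npoly))"
    unfolding segre_comb_def by (rule sum.cong) auto
  then have "segre_basis i = (segre_comb r (\<lambda>j. if j = i then 1 else 0) :: 'k npoly)" using i by simp
  then show ?thesis unfolding segre_span_def by (intro CollectI exI[of _ "\<lambda>j. if j = i then 1 else 0"]) auto
qed

lemma segre_span_param: "w \<le> 2 * r \<Longrightarrow> u \<in> segre_span \<Longrightarrow> segre_param r w * u \<in> segre_span"
  using segre_span_mult[of "mp_var w" u] by simp

lemma segre_span_var: "j \<in> {1..r} \<Longrightarrow> mp_var j \<in> (segre_span :: 'k::comm_ring_1 npoly set)"
proof (cases "j = r")
  case True
  have "segre_param r r * segre_basis 0 \<in> (segre_span :: 'k npoly set)" using r by (intro segre_span_param segre_span_basis) auto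
  then show ?thesis using True r by (simp add: segre_param_def segre_basis_def)
next
  case False
  assume "j \<in> {1..r}"
  then show ?thesis using segre_span_basis[of j] False by (simp add: segre_basis_def)
qed

text \<open>The relation \<open>a\<^sub>i b\<^sub>j\<^sub>+\<^sub>1 = a\<^sub>j\<^sub>+\<^sub>1 b\<^sub>i\<close> gives \<open>b\<^sub>i b\<^sub>j \<equiv> b\<^sub>i\<^sub>-\<^sub>1 b\<^sub>j\<^sub>+\<^sub>1\<close> modulo the span.\<close>

lemma segre_span_var_mult: "i \<in> {1..r} \<Longrightarrow> j \<in> {1..r} \<Longrightarrow> mp_var i * mp_var j \<in> (segre_span :: 'k::comm_ring_1 npoly set)"
proof (induction i arbitrary: j)
  case (Suc i)
  show ?case
  proof (cases "j = r")
    case True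
    have "segre_param r r * mp_var (Suc i) \<in> (segre_span :: 'k npoly set)" using Suc.prems by (intro segre_span_param segre_span_var) auto
    then show ?thesis using True r by (simp add: segre_param_def mult.commute)
  next
    case j: False
    then have j': "j < r" "Suc j \<in> {1..r}" "j \<noteq> 0" "j \<le> 2 * r" "i \<le> 2 * r" using Suc.prems by auto
    have 1: "segre_param r j * mp_var (Suc i) \<in> (segre_span :: 'k npoly set)" using Suc.prems j' by (intro segre_span_param segre_span_var) auto
    have 2: "segre_param r i * mp_var (Suc j) \<in> (segre_span :: 'k npoly set)" using Suc.prems j' by (intro segre_span_param segre_span_var) auto
    show ?thesis
    \<comment> \<open>Lowering one index and raising the other stops at either end: b_r is a
      parameter, and at the lower end b_1 b_j = a_1 b_(j+1) + (b_j - a_(j+1)) b_1, where a_1 is a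
      parameter.\<close>
    proof (cases "i = 0")
      case True
      have "mp_var (Suc i) * mp_var j = segre_param r i * mp_var (Suc j) + (segre_param r j * mp_var (Suc i) :: 'k npoly)"
        using True j' by (simp add: segre_param_def algebra_simps)
      then show ?thesis using segre_span_add[OF 2 1] by simp
    next
      case False
      then have "mp_var i * mp_var (Suc j) \<in> (segre_span :: 'k npoly set)" using Suc j' by auto
      moreover have "param_subst r (- 1) * (segre_param r i * mp_var (Suc j)) \<in> (segre_span :: 'k npoly set)"
        by (rule segre_span_mult[OF _ 2]) simp
      moreover have "mp_var (Suc i) * mp_var j = mp_var i * mp_var (Suc j) +
         (param_subst r (- 1) * (segre_param r i * mp_var (Suc j)) + (segre_param r j * mp_var (Suc i) :: 'k npoly))"
        using False Suc.prems j' by (simp add: segre_param_def \<iota>.hom_uminus algebra_simps)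
      ultimately show ?thesis using 1 by (simp only:) (intro segre_span_add)
    qed
  qed
qed simp

lemma segre_span_closed:
  assumes j: "j \<in> {1..r}" and u: "u \<in> segre_span"
  shows "mp_var j * u \<in> segre_span"
proof -
  obtain p where p: "\<And>i. p i \<in> PI {..2 * r}" "u = segre_comb r p" using u unfolding segre_span_def by blast
  have "mp_var j * u = (\<Sum>i<r. param_subst r (p i) * (mp_var j * segre_basis i))"
    unfolding p(2) segre_comb_def by (simp add: sum_distrib_left mult_ac)
  also have "\<dots> \<in> segre_span"
  proof (intro segre_span_sum segre_span_mult p)
    fix i assume "i \<in> {..<r}"
    then show "mp_var j * segre_basis i \<in> segre_span"
      using segre_span_var[OF j] segre_span_var_mult[OF j, of i] by (auto simp: segre_basis_def)
  qed
  finally show ?thesis .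
qed

text \<open>The elements that multiply the span into itself form a ring containing the constants and
  all generators. For a_i with i > 1 this follows from a_i = b_(i-1) - (b_(i-1) - a_i), whose second
  term is a parameter. Since 1 lies in the span, so does the whole ring.\<close>

lemma segre_subset_span: "segre r \<subseteq> (segre_span :: ((nat \<Rightarrow>\<^sub>0 nat) \<Rightarrow>\<^sub>0 'k::comm_ring_1) set)"
proof -
  let ?B = "{a :: (nat \<Rightarrow>\<^sub>0 nat) \<Rightarrow>\<^sub>0 'k. \<forall>u\<in>segre_span. a * u \<in> segre_span}"
  have "segre r \<subseteq> ?B"
  proof (rule segre_subset)
    show "mp_const c \<in> ?B" for c using segre_span_mult[of "mp_const c"] by simp
    fix i assume i: "i \<in> {1..r}"
    have 1: "mp_var i \<in> ?B" using segre_span_closed[OF i] by blast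
    have 2: "mp_var 0 * mp_var i * u \<in> segre_span" if u: "u \<in> segre_span" for u :: "'k npoly"
    proof (cases "i = 1")
      case True
      then show ?thesis using segre_span_param[of 0, OF _ u] by (simp add: segre_param_def)
    next
      case False
      have "param_subst r (- 1) * (segre_param r (i - 1) * u) \<in> segre_span"
        using i by (intro segre_span_mult segre_span_param u) auto
      moreover have "mp_var (i - 1) * u \<in> segre_span" using i False by (intro segre_span_closed u) auto
      moreover have "mp_var 0 * mp_var i * u = mp_var (i - 1) * u + param_subst r (- 1) * (segre_param r (i - 1) * u)"
      proof -
        have "mp_var 0 * mp_var i = mp_var (i - 1) - (segre_param r (i - 1) :: 'k npoly)"
          using i False by (auto simp: segre_param_def)
        then show ?thesis by (simp only: left_diff_distrib) (simp add: \<iota>.hom_uminus)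
      qed
      ultimately show ?thesis using segre_span_add by simp
    qed
    have "mp_var (r + i) * u \<in> segre_span" if u: "u \<in> segre_span" for u :: "'k npoly"
      using segre_span_param[of "r + i", OF _ u] i by (simp add: segre_param_def)
    then show "mp_var i \<in> ?B \<and> mp_var 0 * mp_var i \<in> ?B \<and> mp_var (r + i) \<in> ?B" using 1 2 by blast
  qed (auto simp: distrib_right mult.assoc intro: segre_span_add)
  moreover have "(1 :: (nat \<Rightarrow>\<^sub>0 nat) \<Rightarrow>\<^sub>0 'k) \<in> segre_span" using segre_span_basis[of 0] r by (simp add: segre_basis_def)
  ultimately show ?thesis by fastforce
qed

lemma segre_comb_exists:
  assumes "u \<in> segre r"
  shows "\<exists>p. (\<forall>i. p i \<in> PI {..2 * r}) \<and> u = segre_comb r p"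
  using assms segre_subset_span unfolding segre_span_def by blast

end

subsection \<open>Independence\<close>

text \<open>A nonzero term of highest degree has nothing to cancel against.\<close>

lemma sum_distinct_degrees:
  fixes f :: "nat \<Rightarrow> 'a::comm_ring_1 poly"
  assumes "finite S" "\<And>i j. i \<in> S \<Longrightarrow> j \<in> S \<Longrightarrow> f i \<noteq> 0 \<Longrightarrow> f j \<noteq> 0 \<Longrightarrow> Polynomial.degree (f i) = Polynomial.degree (f j) \<Longrightarrow> i = j"
    and "(\<Sum>i\<in>S. f i) = 0" and "i \<in> S"
  shows "f i = 0"
proof (rule ccontr)
  assume i: "f i \<noteq> 0"
  let ?S = "{i \<in> S. f i \<noteq> 0}"
  have fin: "finite ((\<lambda>i. Polynomial.degree (f i)) ` ?S)" using assms(1) by simp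
  have "Max ((\<lambda>i. Polynomial.degree (f i)) ` ?S) \<in> (\<lambda>i. Polynomial.degree (f i)) ` ?S"
    using i assms(4) by (intro Max_in fin) auto
  then obtain j where j: "j \<in> S" "f j \<noteq> 0" "Polynomial.degree (f j) = Max ((\<lambda>i. Polynomial.degree (f i)) ` ?S)" by auto
  have "Polynomial.coeff (\<Sum>i\<in>S. f i) (Polynomial.degree (f j)) = (\<Sum>i\<in>S. if i = j then Polynomial.coeff (f j) (Polynomial.degree (f j)) else 0)"
    unfolding Polynomial.coeff_sum
  proof (rule sum.cong)
    fix l assume l: "l \<in> S"
    show "Polynomial.coeff (f l) (Polynomial.degree (f j)) = (if l = j then Polynomial.coeff (f j) (Polynomial.degree (f j)) else 0)"
    proof (cases "l = j \<or> f l = 0")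
      case False
      then have "Polynomial.degree (f l) \<le> Polynomial.degree (f j)" unfolding j(3) using l fin by (intro Max_ge) auto
      moreover have "Polynomial.degree (f l) \<noteq> Polynomial.degree (f j)" using assms(2)[of l j] l j False by auto
      ultimately show ?thesis using False by (simp add: Polynomial.coeff_eq_0)
    qed auto
  qed simp
  also have "\<dots> = Polynomial.coeff (f j) (Polynomial.degree (f j))" using assms(1) j(1) by simp
  finally show False using assms(3) j(2) by simp
qed

text \<open>In the coordinates \<open>y\<^sub>1, ..., y\<^sub>r, c\<^sub>i, \<zeta>\<close>, with \<open>b\<^sub>i = \<Sum>l=i..r. y\<^sub>l \<zeta> ^ (l - i)\<close>, the parameter \<open>a\<^sub>1\<close> has
  degree \<open>r\<close> in \<open>\<zeta>\<close>, the other parameters have degree \<open>0\<close>, and \<open>b\<^sub>i\<close> has degree \<open>r - i\<close>. Hence the terms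
  of a linear relation have different degrees modulo \<open>r\<close>.\<close>

lemma segre_comb_eq_zero:
  fixes p :: "nat \<Rightarrow> (nat \<Rightarrow>\<^sub>0 nat) \<Rightarrow>\<^sub>0 'k::idom"
  assumes r: "r \<ge> 1" and p: "\<And>i. i < r \<Longrightarrow> p i \<in> PI {..2 * r}" and eq: "segre_comb r p = 0" and i: "i < r"
  shows "p i = 0"
proof -
  interpret c: comm_ring_hom "mp_const :: 'k \<Rightarrow> (nat \<Rightarrow>\<^sub>0 nat) \<Rightarrow>\<^sub>0 'k" by (rule comm_ring_hom_mp_const)
  define hc :: "'k \<Rightarrow> ((nat \<Rightarrow>\<^sub>0 nat) \<Rightarrow>\<^sub>0 'k) poly" where "hc c = [:mp_const c:]" for c
  have hc: "comm_ring_hom hc" by unfold_locales (simp_all add: hc_def c.hom_add c.hom_mult pCons_one)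
  interpret hc: comm_ring_hom hc by fact
  define b where "b i = (\<Sum>l=i..r. Polynomial.monom (mp_var l :: (nat \<Rightarrow>\<^sub>0 nat) \<Rightarrow>\<^sub>0 'k) (l - i))" for i
  define x where "x v = (if v = 0 then [:0, 1:] else if v \<le> r then b v else [:mp_var v:])" for v
  define \<psi> where "\<psi> = mp_subst hc x"
  interpret \<psi>: comm_ring_hom \<psi> unfolding \<psi>_def by (rule hc.comm_ring_hom_mp_subst)
  have \<psi>v: "\<psi> (mp_var v) = x v" and \<psi>c: "\<psi> (mp_const c) = hc c" for v c by (simp_all add: \<psi>_def)
  define T where "T = [:0, 1:] * b 1"
  have v0: "mp_var v \<noteq> (0 :: (nat \<Rightarrow>\<^sub>0 nat) \<Rightarrow>\<^sub>0 'k)" for v unfolding mp_var_def by (metis lookup_single_eq lookup_zero one_neq_zero)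
  have shift: "[:0, 1:] * Polynomial.monom a n = Polynomial.monom a (Suc n)" for a :: "(nat \<Rightarrow>\<^sub>0 nat) \<Rightarrow>\<^sub>0 'k" and n
    by (simp add: monom_Suc)
  have degb: "b i \<noteq> 0 \<and> Polynomial.degree (b i) = r - i" if "i \<le> r" for i
  proof -
    have "Polynomial.coeff (b i) (r - i) = (\<Sum>l=i..r. if l = r then mp_var r else 0)"
      unfolding b_def Polynomial.coeff_sum using that by (intro sum.cong) auto
    also have "\<dots> = mp_var r" using that by simp
    finally have c: "Polynomial.coeff (b i) (r - i) \<noteq> 0" using v0 by simp
    have "Polynomial.degree (b i) \<le> r - i" unfolding b_def
      by (intro degree_sum_le order.trans[OF degree_monom_le]) auto
    then show ?thesis using c le_degree[OF c] by auto
  qed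
  have degT: "Polynomial.degree T = r"
    unfolding T_def using degb[of 1] r by (subst degree_mult_eq) auto
  \<comment> \<open>A polynomial in the parameters is read as a polynomial in variable 0, the one
    standing for a_1, with coefficients in the others; evaluating at that variable undoes this,
    whence injectivity.\<close>
  define \<sigma> where "\<sigma> = mp_subst hc (\<lambda>v. if v = 0 then [:0, 1:] else [:mp_var v:])"
  interpret \<sigma>: comm_ring_hom \<sigma> unfolding \<sigma>_def by (rule hc.comm_ring_hom_mp_subst)
  have \<sigma>_inj: "q = 0" if "\<sigma> q = 0" for q
  proof -
    have ev: "comm_ring_hom (\<lambda>p. poly p (mp_var 0 :: (nat \<Rightarrow>\<^sub>0 nat) \<Rightarrow>\<^sub>0 'k))" by unfold_locales simp_all
    have "poly (\<sigma> q) (mp_var 0) = mp_subst (\<lambda>c. poly (hc c) (mp_var 0))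
        (\<lambda>v. poly (if v = 0 then [:0, 1:] else [:mp_var v:]) (mp_var 0)) q"
      unfolding \<sigma>_def by (rule mp_subst_comp[OF hc ev])
    also have "\<dots> = mp_subst mp_const mp_var q"
      by (rule arg_cong2[where f = "\<lambda>h x. mp_subst h x q"]) (auto simp: hc_def)
    also have "\<dots> = q" by (rule mp_subst_ident)
    finally show ?thesis using that by simp
  qed
  have step: "b i = [:mp_var i:] + [:0, 1:] * b (Suc i)" if "i < r" for i
  proof -
    have "b i = Polynomial.monom (mp_var i) 0 + (\<Sum>l=Suc i..r. Polynomial.monom (mp_var l) (l - i))"
      unfolding b_def using that by (subst sum.atLeast_Suc_atMost) auto
    also have "(\<Sum>l=Suc i..r. Polynomial.monom (mp_var l) (l - i)) = [:0, 1:] * b (Suc i)"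
      unfolding b_def sum_distrib_left by (rule sum.cong) (auto simp: shift Suc_diff_Suc simp del: mult_pCons_left)
    finally show ?thesis by (simp add: monom_0)
  qed
  have br: "b r = [:mp_var r:]" by (simp add: b_def monom_0)
  \<comment> \<open>Each b_v - \<zeta> b_(v+1) collapses to y_v, so among the images of the
    parameters only that of variable 0 involves \<zeta>: it is T, of degree r. The images of the
    coefficients thus have degrees divisible by r.\<close>
  have comp: "\<psi> (param_subst r q) = pcompose (\<sigma> q) T" if "q \<in> PI {..2 * r}" for q
  proof -
    have pc: "comm_ring_hom (\<lambda>p. pcompose p T)" by unfold_locales (simp_all add: pcompose_add pcompose_mult pcompose_1)
    have \<iota>: "comm_ring_hom (param_subst r :: ((nat \<Rightarrow>\<^sub>0 nat) \<Rightarrow>\<^sub>0 'k) \<Rightarrow> _)" by (rule c.comm_ring_hom_mp_subst)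
    show ?thesis
    proof (rule mp_hom_eq_on[OF comm_ring_hom_comp[OF \<iota> \<psi>.comm_ring_hom_axioms] comm_ring_hom_comp[OF \<sigma>.comm_ring_hom_axioms pc] that])
      show "\<psi> (param_subst r (mp_const c)) = pcompose (\<sigma> (mp_const c)) T" for c
        by (simp add: \<psi>c \<sigma>_def) (simp add: hc_def)
      fix v assume v: "v \<in> {..2 * r}"
      have "\<psi> (segre_param r v) = pcompose (if v = 0 then [:0, 1:] else [:mp_var v:]) T"
      proof (cases "v = 0")
        case True
        then show ?thesis using r by (simp add: segre_param_def \<psi>.hom_mult \<psi>v x_def T_def pcompose_pCons)
      next
        case False
        show ?thesis
        proof (cases "v < r")
          case True
          have "\<psi> (segre_param r v) = b v - [:0, 1:] * b (Suc v)"
            using True False by (simp add: segre_param_def \<psi>.hom_minus \<psi>.hom_mult \<psi>v x_def)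
          also have "\<dots> = [:mp_var v:]" using step[OF True] by simp
          finally show ?thesis using False by simp
        next
          case ge: False
          then have "\<psi> (segre_param r v) = [:mp_var v:]" using False br by (auto simp: segre_param_def \<psi>v x_def)
          then show ?thesis using False by simp
        qed
      qed
      then show "\<psi> (param_subst r (mp_var v)) = pcompose (\<sigma> (mp_var v)) T" by (simp add: \<sigma>_def)
    qed
  qed
  define e where "e i = (if i = 0 then 1 else b i)" for i
  \<comment> \<open>The degrees in \<zeta> of the basis elements. As 1 \<le> r - i < r for 1 \<le> i
    < r, they are distinct modulo r.\<close>
  define s where "s i = (if i = 0 then 0 else r - i)" for i
  have e: "e i \<noteq> 0" "Polynomial.degree (e i) = s i" if "i < r" for i using degb[of i] that by (auto simp: e_def s_def)
  define f where "f i = pcompose (\<sigma> (p i)) T * e i" for i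
  have "(\<Sum>i<r. f i) = \<psi> (segre_comb r p)"
    unfolding segre_comb_def \<psi>.hom_sum
  proof (rule sum.cong)
    fix i assume "i \<in> {..<r}"
    then show "f i = \<psi> (param_subst r (p i) * segre_basis i)"
      using comp[OF p[of i]] by (simp add: \<psi>.hom_mult f_def e_def segre_basis_def \<psi>v x_def)
  qed simp
  then have sum0: "(\<Sum>i<r. f i) = 0" using eq by simp
  have degf: "Polynomial.degree (f i) = Polynomial.degree (\<sigma> (p i)) * r + s i" if "i < r" "f i \<noteq> 0" for i
  proof -
    have "pcompose (\<sigma> (p i)) T \<noteq> 0" using that(2) by (auto simp: f_def)
    then show ?thesis unfolding f_def using e[OF that(1)] by (subst degree_mult_eq) (auto simp: degree_pcompose degT)
  qed
  have "f i = 0"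
  proof (rule sum_distinct_degrees[OF _ _ sum0])
    fix i j assume ij: "i \<in> {..<r}" "j \<in> {..<r}" "f i \<noteq> 0" "f j \<noteq> 0" "Polynomial.degree (f i) = Polynomial.degree (f j)"
    then have "(Polynomial.degree (\<sigma> (p i)) * r + s i) mod r = (Polynomial.degree (\<sigma> (p j)) * r + s j) mod r"
      using degf[of i] degf[of j] by simp
    then have "s i = s j" using ij(1,2) r by (simp add: s_def split: if_splits)
    then show "i = j" using ij(1,2) by (auto simp: s_def split: if_splits)
  qed (use i in auto)
  then have "pcompose (\<sigma> (p i)) T = 0" using e[OF i] by (simp add: f_def)
  then have "\<sigma> (p i) = 0" using pcompose_eq_0[of "\<sigma> (p i)" T] degT r by simp
  then show ?thesis by (rule \<sigma>_inj)
qed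

subsection \<open>A regular sequence in every maximal ideal\<close>

text \<open>By freeness the ideal of the first j elements consists of the combinations whose
  coefficients vanish when the first j variables are set to their constants. The next element
  multiplies all coefficients by a variable minus a constant, which stays nonzero under this
  specialization and cancels because polynomials form a domain. The ideal \<open>M\<close> shows
  that the sequence does not generate the whole ring.\<close>

lemma segre_regular_sequence:
  fixes M :: "'k::idom npoly set" and \<alpha> :: "nat \<Rightarrow> 'k"
  assumes r: "r \<ge> 1" and M: "ideal M (subring_of (segre r))" "M \<noteq> segre r"
    and mem: "\<And>w. w \<le> 2 * r \<Longrightarrow> segre_param r w - mp_const (\<alpha> w) \<in> M"
  shows "regular_sequence (subring_of (segre r)) (map (\<lambda>w. segre_param r w - mp_const (\<alpha> w)) [0..<2 * r + 1])"
proof -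
  let ?S = "subring_of (segre r :: 'k npoly set)"
  interpret S: cring ?S by (rule cring_subring_of[OF subring_closed_segre])
  interpret c: comm_ring_hom "mp_const :: 'k \<Rightarrow> 'k npoly" by (rule comm_ring_hom_mp_const)
  interpret \<iota>: comm_ring_hom "param_subst r :: 'k npoly \<Rightarrow> _" by (rule c.comm_ring_hom_mp_subst)
  define z :: "nat \<Rightarrow> 'k npoly" where "z w = mp_var w - mp_const (\<alpha> w)" for w
  define Z where "Z w = segre_param r w - mp_const (\<alpha> w)" for w
  have Z: "Z w = param_subst r (z w)" for w by (simp add: Z_def z_def \<iota>.hom_minus)
  have zP: "z w \<in> PI {..2 * r}" if "w \<le> 2 * r" for w using that by (simp add: z_def)
  have ZS: "Z w \<in> segre r" if "w \<le> 2 * r" for w unfolding Z by (rule param_subst_mem[OF r zP[OF that]])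
  define ev :: "nat \<Rightarrow> 'k npoly \<Rightarrow> 'k npoly" where
    "ev j = mp_subst mp_const (\<lambda>w. if w < j then mp_const (\<alpha> w) else mp_var w)" for j
  have ev: "comm_ring_hom (ev j)" for j unfolding ev_def by (rule c.comm_ring_hom_mp_subst)
  have evP: "ev j p \<in> PI {..2 * r}" if "p \<in> PI {..2 * r}" for j p
    unfolding ev_def by (rule mp_subst_mem[OF that comm_ring_hom_mp_const]) auto
  have ev_var: "ev j (mp_var w) = (if w < j then mp_const (\<alpha> w) else mp_var w)"
    and ev_const: "ev j (mp_const c) = mp_const c" for j w c by (simp_all add: ev_def)
  define K where "K j = {segre_comb r p | p. (\<forall>i. p i \<in> PI {..2 * r}) \<and> (\<forall>i. ev j (p i) = 0)}" for j
  have KI: "segre_comb r p \<in> K j" if "\<And>i. p i \<in> PI {..2 * r}" "\<And>i. ev j (p i) = 0" for p j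
    using that unfolding K_def by blast
  have KE: "\<exists>p. (\<forall>i. p i \<in> PI {..2 * r}) \<and> (\<forall>i. ev j (p i) = 0) \<and> u = segre_comb r p" if "u \<in> K j" for u j
    using that unfolding K_def by blast
  have K_ideal: "ideal (K j) ?S" for j
  proof -
    interpret ev: comm_ring_hom "ev j" by (rule ev)
    show ?thesis
    proof (rule S.idealI_mult)
      show "K j \<subseteq> carrier ?S" using KE segre_comb_mem[OF r] by fastforce
      have "segre_comb r (\<lambda>_. 0) \<in> K j" by (rule KI) simp_all
      then show "\<zero>\<^bsub>?S\<^esub> \<in> K j" by (simp add: segre_comb_def)
      fix u v assume uv: "u \<in> K j" "v \<in> K j"
      obtain p where p: "\<And>i. p i \<in> PI {..2 * r}" "\<And>i. ev j (p i) = 0" "u = segre_comb r p" using KE[OF uv(1)] by blast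
      obtain q where q: "\<And>i. q i \<in> PI {..2 * r}" "\<And>i. ev j (q i) = 0" "v = segre_comb r q" using KE[OF uv(2)] by blast
      have "segre_comb r (\<lambda>i. p i + q i) \<in> K j" by (rule KI) (simp_all add: p q ev.hom_add)
      then show "u \<oplus>\<^bsub>?S\<^esub> v \<in> K j" using p q by (simp add: segre_comb_add[OF r])
    next
      fix a u assume a: "a \<in> carrier ?S" and u: "u \<in> K j"
      obtain p where p: "\<And>i. p i \<in> PI {..2 * r}" "\<And>i. ev j (p i) = 0" "u = segre_comb r p" using KE[OF u] by blast
      \<comment> \<open>For a general factor \<open>a\<close>, each product with a basis element is
        expanded again; every new coefficient is a sum of multiples of the \<open>p i\<close> and so
        is still killed by \<open>ev j\<close>.\<close>
      have "\<forall>i. \<exists>s. i < r \<longrightarrow> (\<forall>k. s k \<in> PI {..2 * r}) \<and> a * segre_basis i = segre_comb r s"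
        using segre_comb_exists[OF r segre_closed(4)[OF _ segre_basis_mem]] a by auto
      then obtain s where s: "\<And>i k. i < r \<Longrightarrow> s i k \<in> PI {..2 * r}" "\<And>i. i < r \<Longrightarrow> a * segre_basis i = segre_comb r (s i)" by metis
      have "a * u = (\<Sum>i<r. param_subst r (p i) * (a * segre_basis i))"
        unfolding p(3) segre_comb_def by (simp add: sum_distrib_left mult_ac)
      also have "\<dots> = (\<Sum>i<r. \<Sum>k<r. param_subst r (p i * s i k) * segre_basis k)"
        by (rule sum.cong) (simp_all add: s(2) segre_comb_def sum_distrib_left \<iota>.hom_mult mult.assoc)
      also have "\<dots> = segre_comb r (\<lambda>k. \<Sum>i<r. p i * s i k)"
        unfolding segre_comb_def \<iota>.hom_sum sum_distrib_right by (rule sum.swap)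
      also have "\<dots> \<in> K j"
        by (rule KI) (auto intro!: PI_sum s(1) p(1) PI_mult simp: ev.hom_sum ev.hom_mult p(2))
      finally show "a \<otimes>\<^bsub>?S\<^esub> u \<in> K j" by simp
    qed
  qed
  have Idl_eq: "Idl\<^bsub>?S\<^esub> (Z ` {..<j}) = K j" if j: "j \<le> 2 * r + 1" for j
  proof
    interpret ev: comm_ring_hom "ev j" by (rule ev)
    have T: "Z ` {..<j} \<subseteq> carrier ?S" using ZS j by auto
    show "Idl\<^bsub>?S\<^esub> (Z ` {..<j}) \<subseteq> K j"
    proof (rule S.genideal_minimal[OF K_ideal], clarify)
      fix w assume w: "w < j"
      have "segre_comb r (\<lambda>i. if i = 0 then z w else 0) = (\<Sum>i<r. if i = 0 then Z w else 0)"
        unfolding segre_comb_def Z by (rule sum.cong) (auto simp: segre_basis_def)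
      also have "\<dots> = Z w" using r by simp
      finally have "Z w = segre_comb r (\<lambda>i. if i = 0 then z w else 0)" by simp
      also have "\<dots> \<in> K j"
      proof (rule KI)
        show "(if i = 0 then z w else 0) \<in> PI {..2 * r}" for i :: nat using zP[of w] w j by auto
        show "ev j (if i = 0 then z w else 0) = 0" for i :: nat
          using w by (simp add: z_def ev.hom_minus ev_var ev_const)
      qed
      finally show "Z w \<in> K j" .
    qed
    define I where "I = Idl\<^bsub>?S\<^esub> (Z ` {..<j})"
    have I: "ideal I ?S" unfolding I_def by (rule S.genideal_ideal[OF T])
    have I0: "0 \<in> I" and Iadd: "\<And>a b. a \<in> I \<Longrightarrow> b \<in> I \<Longrightarrow> a + b \<in> I" and Imult: "\<And>a b. a \<in> segre r \<Longrightarrow> b \<in> I \<Longrightarrow> a * b \<in> I"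
      using S.ideal_zero_mem[OF I] S.ideal_add_mem[OF I] S.ideal_mult_left[OF I] by simp_all
    have red: "param_subst r q - param_subst r (ev j q) \<in> I" if "q \<in> PI {..2 * r}" for q using that
    proof (induction rule: mpoly_induct)
      case (const c)
      then show ?case using I0 by (simp add: ev_const)
    next
      case (var w)
      show ?case
      proof (cases "w < j")
        case True
        then have "Z w \<in> I" unfolding I_def using S.genideal_self[OF T] by blast
        then show ?thesis using True by (simp add: ev_var Z_def)
      qed (simp add: ev_var I0)
    next
      case (add p q)
      then show ?case using Iadd[OF add(3,4)] by (simp add: \<iota>.hom_add ev.hom_add algebra_simps)
    next
      case (mult p q)
      have "param_subst r p * (param_subst r q - param_subst r (ev j q)) +
          param_subst r (ev j q) * (param_subst r p - param_subst r (ev j p)) \<in> I"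
        using mult by (intro Iadd Imult param_subst_mem[OF r] evP)
      then show ?case by (simp add: \<iota>.hom_mult ev.hom_mult algebra_simps)
    qed
    show "K j \<subseteq> Idl\<^bsub>?S\<^esub> (Z ` {..<j})" unfolding I_def[symmetric]
    proof
      fix u assume "u \<in> K j"
      then obtain p where p: "\<And>i. p i \<in> PI {..2 * r}" "\<And>i. ev j (p i) = 0" "u = segre_comb r p" using KE by blast
      have sumI: "(\<Sum>i\<in>A. f i) \<in> I" if "\<And>i. i \<in> A \<Longrightarrow> f i \<in> I" for A :: "nat set" and f
        using that I0 Iadd by (induction A rule: infinite_finite_induct) auto
      have "segre_basis i * param_subst r (p i) \<in> I" if "i < r" for i
        using red[OF p(1)[of i]] p(2)[of i] that by (intro Imult segre_basis_mem) simp_all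
      then show "u \<in> I" unfolding p(3) segre_comb_def by (intro sumI) (simp add: mult.commute)
    qed
  qed
  have take: "set (take i (map Z [0..<2 * r + 1])) = Z ` {..<i}" if "i \<le> 2 * r + 1" for i
    using that by (simp add: take_map atLeast0LessThan[symmetric] del: upt_Suc)
  have "regular_sequence ?S (map Z [0..<2 * r + 1])"
    unfolding regular_sequence_def
  proof (intro conjI allI impI ballI)
    show "set (map Z [0..<2 * r + 1]) \<subseteq> carrier ?S" using ZS by auto
    have "Idl\<^bsub>?S\<^esub> (set (map Z [0..<2 * r + 1])) \<subseteq> M"
      using mem by (intro S.genideal_minimal[OF M(1)]) (auto simp: Z_def)
    then show "Idl\<^bsub>?S\<^esub> (set (map Z [0..<2 * r + 1])) \<noteq> carrier ?S"
      using M(2) ideal.Icarr[OF M(1)] by auto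
    fix j a assume "j < length (map Z [0..<2 * r + 1])" and a: "a \<in> carrier ?S"
      and m: "map Z [0..<2 * r + 1] ! j \<otimes>\<^bsub>?S\<^esub> a \<in> Idl\<^bsub>?S\<^esub> (set (take j (map Z [0..<2 * r + 1])))"
    then have j: "j \<le> 2 * r" "j \<le> 2 * r + 1" by auto
    interpret ev: comm_ring_hom "ev j" by (rule ev)
    have "map Z [0..<2 * r + 1] ! j = Z j" using j by (simp del: upt_Suc)
    then have Za: "Z j * a \<in> K j" using m unfolding take[OF j(2)] Idl_eq[OF j(2)] by simp
    obtain q where q: "\<And>i. q i \<in> PI {..2 * r}" "a = segre_comb r q" using segre_comb_exists[OF r, of a] a by auto
    obtain p where p: "\<And>i. p i \<in> PI {..2 * r}" "\<And>i. ev j (p i) = 0" "Z j * a = segre_comb r p" using KE[OF Za] by blast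
    have "segre_comb r (\<lambda>i. z j * q i + (- 1) * p i) = 0"
      unfolding segre_comb_add[OF r] segre_comb_mult[OF r] using p(3) q(2) by (simp add: Z \<iota>.hom_uminus)
    then have eq: "z j * q i + (- 1) * p i = 0" if "i < r" for i
      by (rule segre_comb_eq_zero[OF r _ _ that, rotated]) (auto intro!: PI_minus PI_add PI_mult zP j q p)
    have "mp_var j \<noteq> (mp_const (\<alpha> j) :: 'k npoly)"
    proof
      assume "mp_var j = (mp_const (\<alpha> j) :: 'k npoly)"
      then have "lookup (mp_var j :: 'k npoly) (single j 1) = lookup (mp_const (\<alpha> j) :: 'k npoly) (single j 1)" by simp
      moreover have "(0 :: nat \<Rightarrow>\<^sub>0 nat) \<noteq> single j 1" by (metis lookup_single_eq lookup_zero one_neq_zero)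
      ultimately show False by (simp add: mp_var_def mp_const_def lookup_single)
    qed
    then have zj: "ev j (z j) \<noteq> 0" by (simp add: z_def ev.hom_minus ev_var ev_const)
    have ev0: "ev j (q i) = 0" if "i < r" for i
    proof -
      have "z j * q i = p i" using eq[OF that] by simp
      then have "ev j (z j) * ev j (q i) = 0" using p(2)[of i] by (simp add: ev.hom_mult[symmetric])
      then show ?thesis using zj by simp
    qed
    \<comment> \<open>Uniqueness of coefficients says nothing about indices from r on, which
      \<open>segre_comb\<close> ignores but \<open>K j\<close> constrains; they are reset to
      0.\<close>
    have "a = segre_comb r (\<lambda>i. if i < r then q i else 0)" unfolding q(2) segre_comb_def by (rule sum.cong) auto
    also have "\<dots> \<in> K j" by (rule KI) (auto simp: q(1) ev0)
    finally show "a \<in> Idl\<^bsub>?S\<^esub> (set (take j (map Z [0..<2 * r + 1])))" unfolding take[OF j(2)] Idl_eq[OF j(2)] .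
  qed
  then show ?thesis unfolding Z_def .
qed

text \<open>The quotient by \<open>M\<close> is a field generated over k by the 3r elements b_i, a_i
  and c_i, so Zariski's lemma gives each of them a residue in k. The elements congruent to constants
  form a subalgebra, which then contains everything.\<close>

lemma segre_maximalideal_residue:
  fixes M :: "'k::alg_closed_field npoly set"
  assumes M: "maximalideal M (subring_of (segre r))" and u: "u \<in> segre r"
  shows "\<exists>\<alpha>. u - mp_const \<alpha> \<in> M"
proof -
  let ?S = "subring_of (segre r :: 'k npoly set)"
  interpret S: cring ?S by (rule cring_subring_of[OF subring_closed_segre])
  interpret M: maximalideal M ?S by fact
  interpret c: comm_ring_hom "mp_const :: 'k \<Rightarrow> 'k npoly" by (rule comm_ring_hom_mp_const)
  have M0: "0 \<in> M" and Madd: "\<And>a b. a \<in> M \<Longrightarrow> b \<in> M \<Longrightarrow> a + b \<in> M" and Mmult: "\<And>a b. a \<in> segre r \<Longrightarrow> b \<in> M \<Longrightarrow> a * b \<in> M"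
    using S.ideal_zero_mem[OF M.is_ideal] S.ideal_add_mem[OF M.is_ideal] S.ideal_mult_left[OF M.is_ideal] by simp_all
  have MS: "a \<in> segre r" if "a \<in> M" for a using M.Icarr[OF that] by simp
  have one: "1 \<notin> M" using M.one_imp_carrier M.I_notcarr by auto
  \<comment> \<open>The 3r generators in three blocks, counted from 0. In the third block i = 2r + l
    stands for c_(l+1), whose variable r + l + 1 is i - r + 1.\<close>
  define x :: "nat \<Rightarrow> 'k npoly" where
    "x i = (if i < r then mp_var (i + 1) else if i < 2 * r then mp_var 0 * mp_var (i - r + 1) else mp_var (i - r + 1))" for i
  define A where "A = mp_subst mp_const x ` PI {0..<0 + 3 * r}"
  note A = subst_image_closed[OF comm_ring_hom_mp_const, where x = x and S = "{0..<0 + 3 * r}", folded A_def]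
  have "segre r \<subseteq> A"
  proof (rule segre_subset)
    fix i assume i: "i \<in> {1..r}"
    have "x (i - 1) = mp_var i" "x (r + (i - 1)) = mp_var 0 * mp_var i" "x (2 * r + (i - 1)) = mp_var (r + i)"
      using i by (auto simp: x_def)
    moreover have "i - 1 \<in> {0..<0 + 3 * r}" "r + (i - 1) \<in> {0..<0 + 3 * r}" "2 * r + (i - 1) \<in> {0..<0 + 3 * r}" using i by auto
    ultimately show "mp_var i \<in> A \<and> mp_var 0 * mp_var i \<in> A \<and> mp_var (r + i) \<in> A" using A(4) by metis
  qed (rule A, (rule A; assumption)+)
  moreover have "A \<subseteq> segre r"
  proof -
    have "x i \<in> segre r" if i: "i \<in> {0..<0 + 3 * r}" for i
    proof -
      consider "i < r" | "r \<le> i" "i < 2 * r" | "2 * r \<le> i" "i < 3 * r" using i by (cases "i < r"; cases "i < 2 * r") auto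
      then show ?thesis
      proof cases
        case 1
        then show ?thesis using segre_gens(1)[of "i + 1" r] by (simp add: x_def)
      next
        case 2
        then have "i - r + 1 \<in> {1..r}" by auto
        from segre_gens(2)[OF this] show ?thesis using 2 by (simp add: x_def)
      next
        case 3
        then have "i - 2 * r + 1 \<in> {1..r}" "r + (i - 2 * r + 1) = i - r + 1" by auto
        from segre_gens(3)[OF this(1)] this(2) show ?thesis using 3 by (simp add: x_def)
      qed
    qed
    then show ?thesis unfolding A_def by (auto intro!: mp_subst_mem[OF _ comm_ring_hom_mp_const] segre_closed)
  qed
  ultimately have AS: "A = segre r" by blast
  have inv: "\<exists>q\<in>A. p * q - 1 \<in> M" if p: "p \<in> A" "p \<notin> M" for p
  proof -
    define J where "J = {m + q * p | m q. m \<in> M \<and> q \<in> segre r}"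
    have JI: "m + q * p \<in> J" if "m \<in> M" "q \<in> segre r" for m q using that unfolding J_def by blast
    have JE: "\<exists>m q. a = m + q * p \<and> m \<in> M \<and> q \<in> segre r" if "a \<in> J" for a using that unfolding J_def by blast
    have J: "ideal J ?S"
    proof (rule S.idealI_mult)
      show "J \<subseteq> carrier ?S" using MS p AS by (auto simp: J_def intro!: segre_closed)
      show "\<zero>\<^bsub>?S\<^esub> \<in> J" using JI[OF M0 segre_closed(1)] by simp
      fix a b assume ab: "a \<in> J" "b \<in> J"
      obtain m q where 1: "a = m + q * p" "m \<in> M" "q \<in> segre r" using JE[OF ab(1)] by blast
      obtain m' q' where 2: "b = m' + q' * p" "m' \<in> M" "q' \<in> segre r" using JE[OF ab(2)] by blast
      have "a + b = (m + m') + (q + q') * p" using 1 2 by (simp add: algebra_simps)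
      then show "a \<oplus>\<^bsub>?S\<^esub> b \<in> J" using JI[OF Madd[OF 1(2) 2(2)] segre_closed(3)[OF 1(3) 2(3)]] by simp
    next
      fix a b assume a: "a \<in> carrier ?S" and b: "b \<in> J"
      then have a: "a \<in> segre r" by simp
      obtain m q where 1: "b = m + q * p" "m \<in> M" "q \<in> segre r" using JE[OF b] by blast
      have "a * b = a * m + (a * q) * p" using 1 by (simp add: algebra_simps)
      then show "a \<otimes>\<^bsub>?S\<^esub> b \<in> J" using JI[OF Mmult[OF a 1(2)] segre_closed(4)[OF a 1(3)]] by simp
    qed
    have "M \<subseteq> J"
    proof
      fix m assume m: "m \<in> M"
      show "m \<in> J" using JI[OF m segre_closed(1)] by simp
    qed
    moreover have "p \<in> J" using JI[OF M0 segre_closed(2)] by simp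
    moreover have "J \<subseteq> carrier ?S" using S.ideal_carrier[OF J] by blast
    ultimately have "J = carrier ?S" using M.I_maximal[OF J] p(2) by blast
    then have "1 \<in> J" using segre_closed(2) by simp
    then obtain m q where mq: "1 = m + q * p" "m \<in> M" "q \<in> segre r" using JE by blast
    have "p * q - 1 = p * q - (m + q * p)" using mq(1) by (simp only:)
    also have "\<dots> = (- 1) * m" by (simp add: algebra_simps)
    also have "\<dots> \<in> M" by (intro Mmult segre_closed mq(2))
    finally show ?thesis using mq(3) AS by blast
  qed
  have xres: "\<exists>\<alpha>. x i - mp_const \<alpha> \<in> M" if "i \<in> {0..<0 + 3 * r}" for i
  proof (rule zariski[where M = M and x = x and j = 0 and k = "3 * r"])
    show "a * b \<in> M" if "a \<in> mp_subst mp_const x ` PI {0..<0 + 3 * r}" "b \<in> M" for a b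
      using that AS unfolding A_def by (intro Mmult) simp_all
    show "\<exists>q\<in>mp_subst mp_const x ` PI {0..<0 + 3 * r}. p * q - 1 \<in> M"
      if "p \<in> mp_subst mp_const x ` PI {0..<0 + 3 * r}" "p \<notin> M" for p
      using inv[of p] that unfolding A_def by blast
  qed (fact comm_ring_hom_mp_const M0 Madd one that)+
  let ?B = "{u \<in> segre r. \<exists>\<alpha>. u - mp_const \<alpha> \<in> M}"
  have "segre r \<subseteq> ?B"
  proof (rule segre_subset)
    show "mp_const c \<in> ?B" for c using M0 by (auto intro!: exI[of _ c])
    show "a + b \<in> ?B" if ab: "a \<in> ?B" "b \<in> ?B" for a b
    proof -
      obtain \<alpha> \<beta> where *: "a - mp_const \<alpha> \<in> M" "b - mp_const \<beta> \<in> M" "a \<in> segre r" "b \<in> segre r" using ab by blast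
      have "a + b - mp_const (\<alpha> + \<beta>) \<in> M" using Madd[OF *(1,2)] by (simp add: c.hom_add algebra_simps)
      then show ?thesis using *(3,4) segre_closed(3) by blast
    qed
    show "a * b \<in> ?B" if ab: "a \<in> ?B" "b \<in> ?B" for a b
    proof -
      obtain \<alpha> \<beta> where *: "a - mp_const \<alpha> \<in> M" "b - mp_const \<beta> \<in> M" "a \<in> segre r" "b \<in> segre r" using ab by blast
      have "a * (b - mp_const \<beta>) + mp_const \<beta> * (a - mp_const \<alpha>) \<in> M" by (intro Madd Mmult * segre_const)
      then have "a * b - mp_const (\<alpha> * \<beta>) \<in> M" by (simp add: c.hom_mult algebra_simps)
      then show ?thesis using *(3,4) segre_closed(4) by blast
    qed
    fix i assume i: "i \<in> {1..r}"
    have "x (i - 1) = mp_var i" "x (r + (i - 1)) = mp_var 0 * mp_var i" "x (2 * r + (i - 1)) = mp_var (r + i)"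
      using i by (auto simp: x_def)
    moreover have "i - 1 \<in> {0..<0 + 3 * r}" "r + (i - 1) \<in> {0..<0 + 3 * r}" "2 * r + (i - 1) \<in> {0..<0 + 3 * r}" using i by auto
    ultimately show "mp_var i \<in> ?B \<and> mp_var 0 * mp_var i \<in> ?B \<and> mp_var (r + i) \<in> ?B"
      using xres[of "i - 1"] xres[of "r + (i - 1)"] xres[of "2 * r + (i - 1)"] segre_gens[OF i] by simp
  qed
  then show ?thesis using u by blast
qed

subsection \<open>Transport along an isomorphism\<close>

lemma regular_sequence_iso:
  assumes R: "ring R" and S: "ring S" and \<sigma>: "\<sigma> \<in> ring_hom S R" and \<tau>: "\<tau> \<in> ring_hom R S"
    and inv: "\<And>s. s \<in> carrier S \<Longrightarrow> \<tau> (\<sigma> s) = s" "\<And>a. a \<in> carrier R \<Longrightarrow> \<sigma> (\<tau> a) = a"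
    and reg: "regular_sequence S xs"
  shows "regular_sequence R (map \<sigma> xs)"
proof -
  interpret \<sigma>: ring_hom_ring S R \<sigma> using R S \<sigma> by (simp add: ring_hom_ringI2)
  interpret \<tau>: ring_hom_ring R S \<tau> using R S \<tau> by (simp add: ring_hom_ringI2)
  have xs: "set xs \<subseteq> carrier S" "Idl\<^bsub>S\<^esub> (set xs) \<noteq> carrier S"
    and rs: "\<And>i a. i < length xs \<Longrightarrow> a \<in> carrier S \<Longrightarrow> xs ! i \<otimes>\<^bsub>S\<^esub> a \<in> Idl\<^bsub>S\<^esub> (set (take i xs)) \<Longrightarrow>
        a \<in> Idl\<^bsub>S\<^esub> (set (take i xs))"
    using reg unfolding regular_sequence_def by auto
  have mem: "a \<in> Idl\<^bsub>R\<^esub> (\<sigma> ` T) \<longleftrightarrow> \<tau> a \<in> Idl\<^bsub>S\<^esub> T" if T: "T \<subseteq> carrier S" and a: "a \<in> carrier R" for T a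
  proof
    have T': "\<sigma> ` T \<subseteq> carrier R" using T by auto
    have "Idl\<^bsub>R\<^esub> (\<sigma> ` T) \<subseteq> {a \<in> carrier R. \<tau> a \<in> Idl\<^bsub>S\<^esub> T}"
      using T inv(1) \<sigma>.R.genideal_self[OF T]
      by (intro \<sigma>.S.genideal_minimal \<tau>.ideal_vimage \<sigma>.R.genideal_ideal[OF T]) (auto simp: subset_iff)
    then show "a \<in> Idl\<^bsub>R\<^esub> (\<sigma> ` T) \<Longrightarrow> \<tau> a \<in> Idl\<^bsub>S\<^esub> T" by blast
    have "Idl\<^bsub>S\<^esub> T \<subseteq> {s \<in> carrier S. \<sigma> s \<in> Idl\<^bsub>R\<^esub> (\<sigma> ` T)}"
      using T \<sigma>.S.genideal_self[OF T']
      by (intro \<sigma>.R.genideal_minimal \<sigma>.ideal_vimage \<sigma>.S.genideal_ideal[OF T']) auto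
    then show "\<tau> a \<in> Idl\<^bsub>S\<^esub> T \<Longrightarrow> a \<in> Idl\<^bsub>R\<^esub> (\<sigma> ` T)" using inv(2)[OF a] by force
  qed
  have one: "\<one>\<^bsub>S\<^esub> \<notin> Idl\<^bsub>S\<^esub> (set xs)"
    using ideal.one_imp_carrier[OF \<sigma>.R.genideal_ideal[OF xs(1)]] xs(2) by auto
  show ?thesis unfolding regular_sequence_def
  proof (intro conjI allI impI ballI)
    show "set (map \<sigma> xs) \<subseteq> carrier R" using xs by auto
    show "Idl\<^bsub>R\<^esub> (set (map \<sigma> xs)) \<noteq> carrier R"
      using mem[OF xs(1) \<sigma>.S.one_closed] one by auto
    fix i a assume i: "i < length (map \<sigma> xs)" and a: "a \<in> carrier R"
      and m: "map \<sigma> xs ! i \<otimes>\<^bsub>R\<^esub> a \<in> Idl\<^bsub>R\<^esub> (set (take i (map \<sigma> xs)))"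
    have T: "set (take i xs) \<subseteq> carrier S" using xs(1) set_take_subset by fastforce
    have x: "xs ! i \<in> carrier S" using xs(1) i by auto
    have e: "set (take i (map \<sigma> xs)) = \<sigma> ` set (take i xs)" by (simp add: take_map)
    have "\<tau> (\<sigma> (xs ! i) \<otimes>\<^bsub>R\<^esub> a) \<in> Idl\<^bsub>S\<^esub> (set (take i xs))"
      using m i x a unfolding e by (subst mem[OF T, symmetric]) auto
    then have "\<tau> a \<in> Idl\<^bsub>S\<^esub> (set (take i xs))" using rs[of i "\<tau> a"] i x a inv(1) by simp
    then show "a \<in> Idl\<^bsub>R\<^esub> (set (take i (map \<sigma> xs)))" unfolding e using mem[OF T a] by simp
  qed
qed

lemma cohen_macaulay_segre_iso:
  fixes R (structure) and \<sigma> :: "'k::alg_closed_field npoly \<Rightarrow> _"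
  assumes r: "r \<ge> 1" and R: "cring R" and N: "noetherian_ring R" and dim: "krull_dim R \<le> enat (2 * r + 1)"
    and \<sigma>: "\<sigma> \<in> ring_hom (subring_of (segre r)) R" and \<tau>: "\<tau> \<in> ring_hom R (subring_of (segre r))"
    and inv: "\<And>s. s \<in> segre r \<Longrightarrow> \<tau> (\<sigma> s) = s" "\<And>a. a \<in> carrier R \<Longrightarrow> \<sigma> (\<tau> a) = a"
  shows "cohen_macaulay R"
  unfolding cohen_macaulay_def
proof (intro conjI allI impI R N)
  fix M assume M: "maximalideal M R"
  let ?S = "subring_of (segre r :: 'k npoly set)"
  interpret R: cring R by fact
  interpret S: cring ?S by (rule cring_subring_of[OF subring_closed_segre])
  interpret M: maximalideal M R by fact
  interpret \<sigma>: ring_hom_ring ?S R \<sigma> using R.ring_axioms S.ring_axioms \<sigma> by (simp add: ring_hom_ringI2)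
  interpret \<tau>: ring_hom_ring R ?S \<tau> using R.ring_axioms S.ring_axioms \<tau> by (simp add: ring_hom_ringI2)
  define M' where "M' = {s \<in> carrier ?S. \<sigma> s \<in> M}"
  have M': "ideal M' ?S" unfolding M'_def by (rule \<sigma>.ideal_vimage[OF M.is_ideal])
  have "\<one> \<notin> M" using M.one_imp_carrier M.I_notcarr by auto
  then have one: "\<one>\<^bsub>?S\<^esub> \<notin> M'" unfolding M'_def using \<sigma>.hom_one by simp
  have max: "maximalideal M' ?S"
  proof (rule maximalidealI[OF M'])
    show "carrier ?S \<noteq> M'" using one S.one_closed by blast
    fix J assume J: "ideal J ?S" "M' \<subseteq> J" "J \<subseteq> carrier ?S"
    let ?J = "{a \<in> carrier R. \<tau> a \<in> J}"
    have Ji: "ideal ?J R" by (rule \<tau>.ideal_vimage[OF J(1)])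
    have "M \<subseteq> ?J"
    proof
      fix a assume a: "a \<in> M"
      then have ac: "a \<in> carrier R" by (rule M.Icarr)
      then have "\<tau> a \<in> M'" unfolding M'_def using inv(2) a \<tau>.hom_closed by simp
      then show "a \<in> ?J" using J(2) ac by blast
    qed
    then have "?J = M \<or> ?J = carrier R" using M.I_maximal[OF Ji] by blast
    then show "J = M' \<or> J = carrier ?S"
    proof
      assume e: "?J = M"
      have "J \<subseteq> M'"
      proof
        fix s assume s: "s \<in> J"
        then have sc: "s \<in> carrier ?S" using J(3) by blast
        then have "\<sigma> s \<in> ?J" using s inv(1) \<sigma>.hom_closed by simp
        then show "s \<in> M'" unfolding M'_def using e sc by blast
      qed
      then show ?thesis using J(2) by blast
    next
      assume e: "?J = carrier R"
      have "carrier ?S \<subseteq> J"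
      proof
        fix s assume s: "s \<in> carrier ?S"
        then have "\<sigma> s \<in> ?J" using e \<sigma>.hom_closed by blast
        then show "s \<in> J" using inv(1) s by simp
      qed
      then show ?thesis using J(3) by blast
    qed
  qed
  have "\<exists>\<alpha>. \<forall>w\<le>2 * r. segre_param r w - mp_const (\<alpha> w) \<in> M'"
    using segre_maximalideal_residue[OF max segre_param_mem[OF r]] by metis
  then obtain \<alpha> where \<alpha>: "\<And>w. w \<le> 2 * r \<Longrightarrow> segre_param r w - mp_const (\<alpha> w) \<in> M'" by blast
  define xs where "xs = map (\<lambda>w. segre_param r w - mp_const (\<alpha> w)) [0..<2 * r + 1]"
  have "M' \<noteq> segre r" using one S.one_closed by auto
  then have "regular_sequence ?S xs" unfolding xs_def by (rule segre_regular_sequence[OF r M' _ \<alpha>])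
  then have "regular_sequence R (map \<sigma> xs)"
    using inv by (intro regular_sequence_iso[OF R.ring_axioms S.ring_axioms \<sigma> \<tau>]) auto
  moreover have "set (map \<sigma> xs) \<subseteq> M" using \<alpha> by (auto simp: xs_def M'_def)
  ultimately show "cohen_macaulay_local (localization_at R M)"
    using R.maximalideal_prime[OF M] N dim
    by (intro cohen_macaulay_local_localization_at[where xs = "map \<sigma> xs"]) (simp_all add: xs_def)
qed

lemma normal_domain_segre_iso:
  fixes R (structure) and \<sigma> :: "'k::field npoly \<Rightarrow> _"
  assumes R: "domain R"
    and \<sigma>: "\<sigma> \<in> ring_hom (subring_of (segre r)) R" and \<tau>: "\<tau> \<in> ring_hom R (subring_of (segre r))"
    and inv: "\<And>s. s \<in> segre r \<Longrightarrow> \<tau> (\<sigma> s) = s" "\<And>a. a \<in> carrier R \<Longrightarrow> \<sigma> (\<tau> a) = a"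
  shows "normal_domain R"
proof (rule normal_domainI[OF R])
  let ?S = "subring_of (segre r :: 'k npoly set)"
  interpret R: domain R by fact
  interpret S: cring ?S by (rule cring_subring_of[OF subring_closed_segre])
  interpret \<sigma>: ring_hom_ring ?S R \<sigma> using R.ring_axioms S.ring_axioms \<sigma> by (simp add: ring_hom_ringI2)
  interpret \<tau>: ring_hom_ring R ?S \<tau> using R.ring_axioms S.ring_axioms \<tau> by (simp add: ring_hom_ringI2)
  fix f g c assume f: "f \<in> carrier R" and g: "g \<in> carrier R" and c: "c \<in> carrier R" and g0: "g \<noteq> \<zero>" and c0: "c \<noteq> \<zero>"
    and ex: "\<And>m::nat. \<exists>h\<in>carrier R. c \<otimes> f [^] m = g [^] m \<otimes> h"
  have pow: "s [^]\<^bsub>?S\<^esub> n = s ^ n" for s and n :: nat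
    by (induction n) (simp_all add: mult.commute)
  have nz: "\<tau> a \<noteq> 0" if "a \<in> carrier R" "a \<noteq> \<zero>" for a
  proof
    assume "\<tau> a = 0"
    then have "a = \<sigma> 0" using inv(2)[OF that(1)] by simp
    then show False using \<sigma>.hom_zero that(2) by simp
  qed
  have "\<exists>h\<in>segre r. \<tau> f = \<tau> g * h"
  proof (rule segre_almost_integral)
    show "\<tau> f \<in> segre r" "\<tau> g \<in> segre r" "\<tau> c \<in> segre r" using f g c \<tau>.hom_closed by simp_all
    show "\<tau> g \<noteq> 0" "\<tau> c \<noteq> 0" using nz g c g0 c0 by simp_all
    fix n :: nat
    obtain h where h: "h \<in> carrier R" "c \<otimes> f [^] n = g [^] n \<otimes> h" using ex by blast
    have "\<tau> (c \<otimes> f [^] n) = \<tau> c * \<tau> f ^ n" "\<tau> (g [^] n \<otimes> h) = \<tau> g ^ n * \<tau> h"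
      using f g c h(1) \<tau>.hom_nat_pow[of f n] \<tau>.hom_nat_pow[of g n] by (simp_all add: pow)
    then show "\<exists>h\<in>segre r. \<tau> c * \<tau> f ^ n = \<tau> g ^ n * h"
      using h \<tau>.hom_closed[OF h(1)] by (intro bexI[of _ "\<tau> h"]) simp_all
  qed
  then obtain h where h: "h \<in> segre r" "\<tau> f = \<tau> g * h" by blast
  have "f = \<sigma> (\<tau> g \<otimes>\<^bsub>?S\<^esub> h)" using inv(2)[OF f] h(2) by simp
  also have "\<dots> = g \<otimes> \<sigma> h" using inv(2)[OF g] g h(1) \<tau>.hom_closed[OF g] by (subst \<sigma>.hom_mult) simp_all
  finally show "\<exists>h\<in>carrier R. f = g \<otimes> h" using \<sigma>.hom_closed[of h] h(1) by auto
qed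

section \<open>Irreducibility along polynomial curves\<close>

lemma comm_ring_hom_pCons: "comm_ring_hom (\<lambda>c::'a::comm_ring_1. [:c:])"
  by unfold_locales (simp_all add: pCons_one)

lemma poly_curve_eval:
  "poly (mp_subst (\<lambda>c. [:c:]) \<gamma> p) t = mpoly_eval (\<lambda>v. poly (\<gamma> v) t) p"
proof -
  have "comm_ring_hom (\<lambda>p. poly p t)" by unfold_locales simp_all
  then show ?thesis unfolding mpoly_eval_eq_subst
    using mp_subst_comp[OF comm_ring_hom_pCons, of "\<lambda>p. poly p t" \<gamma> p] by simp
qed

lemma mpoly_eval_cong: "p \<in> PI I \<Longrightarrow> (\<And>v. v \<in> I \<Longrightarrow> x v = y v) \<Longrightarrow> mpoly_eval x p = mpoly_eval y p"
  unfolding mpoly_eval_eq_subst by (rule mp_subst_cong)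

lemma mpoly_eval_restrict: "p \<in> PI I \<Longrightarrow> mpoly_eval (restrict x I) p = mpoly_eval x p"
  by (rule mpoly_eval_cong) (auto simp: restrict_def)

lemma mpoly_eval_simps [simp]:
  "mpoly_eval x (p + q) = mpoly_eval x p + mpoly_eval x q"
  "mpoly_eval x (p * q) = mpoly_eval x p * mpoly_eval x q"
  "mpoly_eval x (p - q) = mpoly_eval x p - mpoly_eval x q"
  "mpoly_eval x 0 = 0" "mpoly_eval x 1 = 1"
  "mpoly_eval x (mp_const c) = c" "mpoly_eval x (mp_var v) = x v"
proof -
  interpret i: comm_ring_hom "\<lambda>c::'a. c" by (rule comm_ring_hom_ident)
  interpret e: comm_ring_hom "mp_subst (\<lambda>c::'a. c) x" by (rule i.comm_ring_hom_mp_subst)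
  show "mpoly_eval x (p + q) = mpoly_eval x p + mpoly_eval x q"
    "mpoly_eval x (p * q) = mpoly_eval x p * mpoly_eval x q"
    "mpoly_eval x (p - q) = mpoly_eval x p - mpoly_eval x q"
    "mpoly_eval x 0 = 0" "mpoly_eval x 1 = 1"
    "mpoly_eval x (mp_const c) = c" "mpoly_eval x (mp_var v) = x v"
    unfolding mpoly_eval_eq_subst by (simp_all only: e.hom_add e.hom_mult e.hom_minus e.hom_zero e.hom_one i.mp_subst_const i.mp_subst_var)
qed

lemma poly_nonroot:
  fixes p :: "'k::idom poly"
  assumes "infinite (UNIV :: 'k set)" "p \<noteq> 0"
  shows "\<exists>t. poly p t \<noteq> 0"
  using poly_roots_finite[OF assms(2)] assms(1) by (metis (mono_tags, lifting) UNIV_I ex_new_if_finite mem_Collect_eq)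

text \<open>If x lies outside Z1 and y outside Z2, some equation of Z1 does not vanish at x and some
  equation of Z2 does not vanish at y. Along the curve both become nonzero polynomials in t, so over
  an infinite field some point of the curve lies in neither set.\<close>

lemma zariski_irreducible_curves:
  fixes V :: "('v \<Rightarrow> 'k::field) set"
  assumes inf: "infinite (UNIV :: 'k set)" and V: "V \<noteq> {}" "V \<subseteq> I \<rightarrow>\<^sub>E UNIV"
    and curve: "\<And>x y. x \<in> V \<Longrightarrow> y \<in> V \<Longrightarrow> \<exists>\<gamma>. (\<forall>t. restrict (\<lambda>v. poly (\<gamma> v) t) I \<in> V) \<and>
       x = restrict (\<lambda>v. poly (\<gamma> v) 0) I \<and> y = restrict (\<lambda>v. poly (\<gamma> v) 1) I"
  shows "zariski_irreducible I V"
  unfolding zariski_irreducible_def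
proof (intro conjI allI impI V(1), rule ccontr)
  fix Z1 Z2 assume Z: "zariski_closed I Z1 \<and> zariski_closed I Z2 \<and> V \<subseteq> Z1 \<union> Z2" and n: "\<not> (V \<subseteq> Z1 \<or> V \<subseteq> Z2)"
  have ex: "\<exists>p\<in>PI I. (\<forall>z\<in>Z. mpoly_eval z p = 0) \<and> mpoly_eval x p \<noteq> 0" if "zariski_closed I Z" "x \<in> V" "x \<notin> Z" for Z x
    using that V(2) unfolding zariski_closed_def by blast
  obtain x y where xy: "x \<in> V" "x \<notin> Z1" "y \<in> V" "y \<notin> Z2" using n by blast
  obtain p where p: "p \<in> PI I" "\<And>z. z \<in> Z1 \<Longrightarrow> mpoly_eval z p = 0" "mpoly_eval x p \<noteq> 0" using ex[of Z1 x] Z xy by blast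
  obtain q where q: "q \<in> PI I" "\<And>z. z \<in> Z2 \<Longrightarrow> mpoly_eval z q = 0" "mpoly_eval y q \<noteq> 0" using ex[of Z2 y] Z xy by blast
  obtain \<gamma> where \<gamma>: "\<And>t. restrict (\<lambda>v. poly (\<gamma> v) t) I \<in> V" "x = restrict (\<lambda>v. poly (\<gamma> v) 0) I" "y = restrict (\<lambda>v. poly (\<gamma> v) 1) I"
    using curve[OF xy(1,3)] by blast
  let ?P = "mp_subst (\<lambda>c. [:c:]) \<gamma> p" and ?Q = "mp_subst (\<lambda>c. [:c:]) \<gamma> q"
  have P: "poly ?P t = mpoly_eval (restrict (\<lambda>v. poly (\<gamma> v) t) I) p" for t
    unfolding poly_curve_eval using mpoly_eval_restrict[OF p(1)] by metis
  have Q: "poly ?Q t = mpoly_eval (restrict (\<lambda>v. poly (\<gamma> v) t) I) q" for t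
    unfolding poly_curve_eval using mpoly_eval_restrict[OF q(1)] by metis
  have "poly ?P 0 \<noteq> 0" "poly ?Q 1 \<noteq> 0" unfolding P Q using p(3) q(3) \<gamma>(2,3) by auto
  then have "?P * ?Q \<noteq> 0" by auto
  then obtain t where "poly (?P * ?Q) t \<noteq> 0" using poly_nonroot[OF inf] by blast
  then have "mpoly_eval (restrict (\<lambda>v. poly (\<gamma> v) t) I) p \<noteq> 0" "mpoly_eval (restrict (\<lambda>v. poly (\<gamma> v) t) I) q \<noteq> 0"
    unfolding P[symmetric] Q[symmetric] by auto
  moreover have "restrict (\<lambda>v. poly (\<gamma> v) t) I \<in> Z1 \<union> Z2" using Z \<gamma>(1) by blast
  ultimately show False using p(2) q(2) by blast
qed

lemma primeideal_vanishing_ideal: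
  fixes V :: "('v \<Rightarrow> 'k::field) set"
  assumes irr: "zariski_irreducible I V" and V: "V \<subseteq> I \<rightarrow>\<^sub>E UNIV"
  shows "primeideal (vanishing_ideal I V) (mpoly_ring I)"
proof (rule primeidealI)
  interpret R: cring "mpoly_ring I :: (('v \<Rightarrow>\<^sub>0 nat) \<Rightarrow>\<^sub>0 'k) ring" by (rule cring_mpoly_ring)
  show "ideal (vanishing_ideal I V) (mpoly_ring I)"
    by (rule R.idealI_mult) (auto simp: vanishing_ideal_def)
  show "cring (mpoly_ring I :: (('v \<Rightarrow>\<^sub>0 nat) \<Rightarrow>\<^sub>0 'k) ring)" by (rule cring_mpoly_ring)
  obtain x where "x \<in> V" using irr by (auto simp: zariski_irreducible_def)
  then have "1 \<notin> vanishing_ideal I V" by (auto simp: vanishing_ideal_def)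
  then show "PI I \<noteq> vanishing_ideal I V" by (metis PI_one)
  fix p q :: "('v \<Rightarrow>\<^sub>0 nat) \<Rightarrow>\<^sub>0 'k" assume pq: "p \<in> PI I" "q \<in> PI I" "p \<otimes>\<^bsub>mpoly_ring I\<^esub> q \<in> vanishing_ideal I V"
  let ?Z = "\<lambda>p. {x \<in> I \<rightarrow>\<^sub>E UNIV. \<forall>p\<in>{p}. mpoly_eval x p = 0}"
  have cl: "zariski_closed I (?Z p)" if "p \<in> PI I" for p :: "('v \<Rightarrow>\<^sub>0 nat) \<Rightarrow>\<^sub>0 'k"
    unfolding zariski_closed_def by (rule exI[of _ "{p}"]) (simp add: that)
  have "mpoly_eval x p = 0 \<or> mpoly_eval x q = 0" if "x \<in> V" for x
    using pq(3) that by (auto simp: vanishing_ideal_def)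
  then have "V \<subseteq> ?Z p \<union> ?Z q" using V by blast
  then have "V \<subseteq> ?Z p \<or> V \<subseteq> ?Z q" using irr cl pq(1,2) unfolding zariski_irreducible_def by blast
  then show "p \<in> vanishing_ideal I V \<or> q \<in> vanishing_ideal I V" using pq(1,2) by (auto simp: vanishing_ideal_def)
qed

lemma zariski_closed_vanishing:
  assumes "zariski_closed I Z" "x \<in> I \<rightarrow>\<^sub>E UNIV" "\<And>p. p \<in> vanishing_ideal I Z \<Longrightarrow> mpoly_eval x p = 0"
  shows "x \<in> Z"
proof -
  obtain F where F: "F \<subseteq> PI I" "Z = {x \<in> I \<rightarrow>\<^sub>E UNIV. \<forall>p\<in>F. mpoly_eval x p = 0}" using assms(1) unfolding zariski_closed_def by blast
  have "p \<in> vanishing_ideal I Z" if "p \<in> F" for p using F that by (auto simp: vanishing_ideal_def)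
  then show ?thesis using assms(2,3) F(2) by blast
qed

section \<open>The commuting variety\<close>

text \<open>Below the diagonal only the positions (1,0), (2,1) and (2,0) occur, so testing the row
  and then the column for 1 separates the three kinds of entries.\<close>

definition abc_point :: "nat \<Rightarrow> (nat \<Rightarrow> 'k) \<Rightarrow> (nat \<Rightarrow> 'k) \<Rightarrow> (nat \<Rightarrow> 'k) \<Rightarrow> nat \<times> nat \<times> nat \<Rightarrow> 'k" where
  "abc_point r a b c = (\<lambda>(i, j, l)\<in>u_index r. if j = 1 then a i else if l = 1 then b i else c i)"

lemma u_index_cases:
  assumes "v \<in> u_index r"
  obtains i where "i \<in> {1..r}" "v = (i, 1, 0)" | i where "i \<in> {1..r}" "v = (i, 2, 1)" | i where "i \<in> {1..r}" "v = (i, 2, 0)"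
proof -
  obtain i j l where v: "v = (i, j, l)" by (cases v)
  then have "1 \<le> i" "i \<le> r" "l < j" "j < 3" using assms by (auto simp: u_index_def)
  then have "i \<in> {1..r}" "(j, l) = (1, 0) \<or> (j, l) = (2, 1) \<or> (j, l) = (2, 0)" by auto
  then show thesis using that v by auto
qed

lemma u_index_eq: "u_index r = (\<lambda>i. (i, 1, 0)) ` {1..r} \<union> ((\<lambda>i. (i, 2, 1)) ` {1..r} \<union> (\<lambda>i. (i, 2, 0)) ` {1..r})"
proof (intro equalityI subsetI)
  fix v assume "v \<in> u_index r"
  then show "v \<in> (\<lambda>i. (i, 1, 0)) ` {1..r} \<union> ((\<lambda>i. (i, 2, 1)) ` {1..r} \<union> (\<lambda>i. (i, 2, 0)) ` {1..r})"
    by (cases rule: u_index_cases) blast+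
qed (auto simp: u_index_def)

lemma finite_u_index: "finite (u_index r)"
  unfolding u_index_eq by simp

lemma card_u_index: "card (u_index r) = 3 * r"
proof -
  have "card ((\<lambda>i. (i, x, y)) ` {1..r}) = r" for x y :: nat by (subst card_image) (auto simp: inj_on_def)
  then show ?thesis unfolding u_index_eq by (subst card_Un_disjoint, (auto)[3], subst card_Un_disjoint) auto
qed

lemma u_index_mem [simp]:
  "(i, 1, 0) \<in> u_index r \<longleftrightarrow> i \<in> {1..r}" "(i, Suc 0, 0) \<in> u_index r \<longleftrightarrow> i \<in> {1..r}"
  "(i, 2, 1) \<in> u_index r \<longleftrightarrow> i \<in> {1..r}" "(i, 2, Suc 0) \<in> u_index r \<longleftrightarrow> i \<in> {1..r}" "(i, 2, 0) \<in> u_index r \<longleftrightarrow> i \<in> {1..r}"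
  by (auto simp: u_index_def)

lemma abc_point_simps [simp]:
  "i \<in> {1..r} \<Longrightarrow> abc_point r a b c (i, Suc 0, 0) = a i"
  "i \<in> {1..r} \<Longrightarrow> abc_point r a b c (i, 2, Suc 0) = b i"
  "i \<in> {1..r} \<Longrightarrow> abc_point r a b c (i, 2, 0) = c i"
  by (simp_all add: abc_point_def)

lemma abc_point_eta:
  assumes "x \<in> u_index r \<rightarrow>\<^sub>E UNIV"
  shows "x = abc_point r (\<lambda>i. x (i, 1, 0)) (\<lambda>i. x (i, 2, 1)) (\<lambda>i. x (i, 2, 0))"
proof
  fix v
  show "x v = abc_point r (\<lambda>i. x (i, 1, 0)) (\<lambda>i. x (i, 2, 1)) (\<lambda>i. x (i, 2, 0)) v"
  proof (cases "v \<in> u_index r")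
    case True
    then show ?thesis by (cases rule: u_index_cases) auto
  next
    case False
    then show ?thesis using PiE_arb[OF assms False] by (simp add: abc_point_def restrict_def)
  qed
qed

lemma abc_point_PiE: "abc_point r a b c \<in> u_index r \<rightarrow>\<^sub>E UNIV"
  by (auto simp: abc_point_def)

lemma lessThan_3: "{0..<3} = {0, 1, 2::nat}" by auto

lemma lie_u_mult_index:
  assumes "A \<in> lie_u" "B \<in> lie_u" "p < 3" "q < 3"
  shows "(A * B) $$ (p, q) = (if p = 2 \<and> q = 0 then A $$ (2, 1) * B $$ (1, 0) else 0)"
proof -
  have A: "A \<in> carrier_mat 3 3" "\<And>i j. i < 3 \<Longrightarrow> j < 3 \<Longrightarrow> i \<le> j \<Longrightarrow> A $$ (i, j) = 0" using assms(1) by (auto simp: lie_u_def)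
  have B: "B \<in> carrier_mat 3 3" "\<And>i j. i < 3 \<Longrightarrow> j < 3 \<Longrightarrow> i \<le> j \<Longrightarrow> B $$ (i, j) = 0" using assms(2) by (auto simp: lie_u_def)
  have "(A * B) $$ (p, q) = (\<Sum>k\<in>{0..<3}. A $$ (p, k) * B $$ (k, q))"
    using A(1) B(1) assms(3,4) by (simp add: scalar_prod_def)
  also have "\<dots> = A $$ (p, 0) * B $$ (0, q) + A $$ (p, 1) * B $$ (1, q) + A $$ (p, 2) * B $$ (2, q)"
    unfolding lessThan_3 by (simp add: add.assoc)
  also have "\<dots> = (if p = 2 \<and> q = 0 then A $$ (2, 1) * B $$ (1, 0) else 0)"
  proof -
    have "A $$ (p, 2) = 0" "B $$ (0, q) = 0" using A(2)[of p 2] B(2)[of 0 q] assms by auto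
    moreover have "A $$ (p, 1) = 0" if "p \<noteq> 2" using A(2)[of p 1] assms that by auto
    moreover have "B $$ (1, q) = 0" if "q \<noteq> 0" using B(2)[of 1 q] assms that by auto
    ultimately show ?thesis by auto
  qed
  finally show ?thesis .
qed

text \<open>A product of two matrices in \<open>lie_u\<close> can be nonzero only at (2,0), where
  the commutator of u_i and u_j is b_i a_j - b_j a_i.\<close>

lemma commuting_variety_iff:
  fixes x :: "nat \<times> nat \<times> nat \<Rightarrow> 'k::field"
  shows "x \<in> commuting_variety r \<longleftrightarrow> x \<in> u_index r \<rightarrow>\<^sub>E UNIV \<and>
     (\<forall>i\<in>{1..r}. \<forall>j\<in>{1..r}. x (i, 1, 0) * x (j, 2, 1) = x (j, 1, 0) * x (i, 2, 1))"
proof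
  assume "x \<in> commuting_variety r"
  then obtain u where u: "u \<in> commuting_tuples r" "x = u_coords r u" by (auto simp: commuting_variety_def)
  have U: "u i \<in> lie_u" if "i \<in> {1..r}" for i using u(1) that by (auto simp: commuting_tuples_def)
  have xu: "x (i, 1, 0) = u i $$ (1, 0)" "x (i, 2, 1) = u i $$ (2, 1)" if "i \<in> {1..r}" for i
    using that by (auto simp: u(2) u_coords_def)
  have le: "x (i, 1, 0) * x (j, 2, 1) = x (j, 1, 0) * x (i, 2, 1)" if ij: "i \<in> {1..r}" "j \<in> {1..r}" "i \<le> j" for i j
  proof -
    have z: "u i * u j - u j * u i = 0\<^sub>m 3 3" using u(1) ij by (auto simp: commuting_tuples_def)
    have c: "u i \<in> carrier_mat 3 3" "u j \<in> carrier_mat 3 3" using U ij by (auto simp: lie_u_def)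
    have "(u i * u j - u j * u i) $$ (2, 0) = (u i * u j) $$ (2, 0) - (u j * u i) $$ (2, 0)"
      using c by (intro index_minus_mat) auto
    then have "(u i * u j) $$ (2, 0) = (u j * u i) $$ (2, 0)" unfolding z by simp
    then show ?thesis using lie_u_mult_index[OF U[OF ij(1)] U[OF ij(2)], of 2 0] lie_u_mult_index[OF U[OF ij(2)] U[OF ij(1)], of 2 0]
      by (simp only: xu[OF ij(1)] xu[OF ij(2)]) (simp add: mult.commute)
  qed
  have "x (i, 1, 0) * x (j, 2, 1) = x (j, 1, 0) * x (i, 2, 1)" if "i \<in> {1..r}" "j \<in> {1..r}" for i j
    using le[of i j] le[of j i] that by (cases "i \<le> j") auto
  then show "x \<in> u_index r \<rightarrow>\<^sub>E UNIV \<and> (\<forall>i\<in>{1..r}. \<forall>j\<in>{1..r}. x (i, 1, 0) * x (j, 2, 1) = x (j, 1, 0) * x (i, 2, 1))"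
    unfolding u(2) by (auto simp: u_coords_def)
next
  assume x: "x \<in> u_index r \<rightarrow>\<^sub>E UNIV \<and> (\<forall>i\<in>{1..r}. \<forall>j\<in>{1..r}. x (i, 1, 0) * x (j, 2, 1) = x (j, 1, 0) * x (i, 2, 1))"
  define u where "u = (\<lambda>i\<in>{1..r}. mat 3 3 (\<lambda>(p, q). if q < p then x (i, p, q) else 0))"
  have U: "u i \<in> lie_u" if "i \<in> {1..r}" for i using that by (auto simp: u_def lie_u_def)
  have "u i * u j - u j * u i = 0\<^sub>m 3 3" if ij: "i \<in> {1..r}" "j \<in> {1..r}" for i j
  proof (rule eq_matI)
    have c: "u i \<in> carrier_mat 3 3" "u j \<in> carrier_mat 3 3" using U ij by (auto simp: lie_u_def)
    then show "dim_row (u i * u j - u j * u i) = dim_row (0\<^sub>m 3 3 :: 'k mat)" "dim_col (u i * u j - u j * u i) = dim_col (0\<^sub>m 3 3 :: 'k mat)" by auto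
    fix p q assume "p < dim_row (0\<^sub>m 3 3 :: 'k mat)" "q < dim_col (0\<^sub>m 3 3 :: 'k mat)"
    then have pq: "p < 3" "q < 3" by auto
    have "(u i * u j - u j * u i) $$ (p, q) = (u i * u j) $$ (p, q) - (u j * u i) $$ (p, q)"
      using c pq by (intro index_minus_mat) auto
    also have "\<dots> = 0" unfolding lie_u_mult_index[OF U[OF ij(1)] U[OF ij(2)] pq] lie_u_mult_index[OF U[OF ij(2)] U[OF ij(1)] pq]
      using x ij by (auto simp: u_def mult.commute)
    finally show "(u i * u j - u j * u i) $$ (p, q) = 0\<^sub>m 3 3 $$ (p, q)" using pq by simp
  qed
  then have "u \<in> commuting_tuples r" using U by (auto simp: commuting_tuples_def u_def)
  moreover have "x = u_coords r u"
  proof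
    fix v
    show "x v = u_coords r u v"
    proof (cases "v \<in> u_index r")
      case True
      then show ?thesis by (cases rule: u_index_cases) (auto simp: u_coords_def u_def)
    next
      case False
      then have "x v = undefined" using x PiE_arb[of x "u_index r" "\<lambda>_. UNIV" v] by blast
      then show ?thesis using False by (simp add: u_coords_def restrict_def)
    qed
  qed
  ultimately show "x \<in> commuting_variety r" by (auto simp: commuting_variety_def)
qed

lemma abc_point_in_commuting_variety:
  "abc_point r a b c \<in> commuting_variety r \<longleftrightarrow> (\<forall>i\<in>{1..r}. \<forall>j\<in>{1..r}. a i * b j = a j * b i)"
  unfolding commuting_variety_iff using abc_point_PiE[of r a b c] by (simp del: PiE_iff)

text \<open>If some b_j is nonzero, the ratio a_j / b_j serves all columns, with t = 1; otherwise b
  = 0, and the row a itself is w, with s = 1 and t = 0. The last alternative isolates the points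
  that have no finite ratio \<zeta>.\<close>

lemma commuting_variety_param:
  assumes "x \<in> commuting_variety r"
  obtains s t w c where "x = abc_point r (\<lambda>i. s * w i) (\<lambda>i. t * w i) c" "t \<noteq> 0 \<or> t = 0 \<and> s = 1"
proof -
  have x: "x \<in> u_index r \<rightarrow>\<^sub>E UNIV" "\<And>i j. i \<in> {1..r} \<Longrightarrow> j \<in> {1..r} \<Longrightarrow> x (i, 1, 0) * x (j, 2, 1) = x (j, 1, 0) * x (i, 2, 1)"
    using assms by (auto simp: commuting_variety_iff)
  have eq: "x = abc_point r (\<lambda>i. x (i, 1, 0)) (\<lambda>i. x (i, 2, 1)) (\<lambda>i. x (i, 2, 0))" by (rule abc_point_eta[OF x(1)])
  have cong: "abc_point r a b c = abc_point r a' b' c" if "\<And>i. i \<in> {1..r} \<Longrightarrow> a i = a' i" "\<And>i. i \<in> {1..r} \<Longrightarrow> b i = b' i" for a b a' b' :: "nat \<Rightarrow> 'a" and c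
    unfolding abc_point_def using that by (auto simp: restrict_def u_index_def fun_eq_iff)
  show thesis
  proof (cases "\<exists>j\<in>{1..r}. x (j, 2, 1) \<noteq> 0")
    case True
    then obtain j where j: "j \<in> {1..r}" "x (j, 2, 1) \<noteq> 0" by blast
    have "x (i, 1, 0) = x (j, 1, 0) / x (j, 2, 1) * x (i, 2, 1)" if "i \<in> {1..r}" for i
      using x(2)[OF that j(1)] j(2) by (simp add: field_simps)
    then have "x = abc_point r (\<lambda>i. x (j, 1, 0) / x (j, 2, 1) * x (i, 2, 1)) (\<lambda>i. 1 * x (i, 2, 1)) (\<lambda>i. x (i, 2, 0))"
      by (subst eq, intro cong) auto
    then show thesis by (rule that) simp
  next
    case False
    then have "x = abc_point r (\<lambda>i. 1 * x (i, 1, 0)) (\<lambda>i. 0 * x (i, 1, 0)) (\<lambda>i. x (i, 2, 0))"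
      by (subst eq, intro cong) auto
    then show thesis by (rule that) simp
  qed
qed

lemma zariski_closed_commuting_variety: "zariski_closed (u_index r) (commuting_variety r)"
  unfolding zariski_closed_def
proof (intro exI conjI)
  let ?F = "(\<lambda>(i, j). mp_var (i, 1, 0) * mp_var (j, 2, 1) - mp_var (j, 1, 0) * mp_var (i, 2, 1)) ` ({1..r} \<times> {1..r})"
  show "?F \<subseteq> PI (u_index r)" by (auto intro!: PI_minus PI_mult PI_var)
  show "commuting_variety r = {x \<in> u_index r \<rightarrow>\<^sub>E UNIV. \<forall>p\<in>?F. mpoly_eval x p = 0}"
    by (auto simp: commuting_variety_iff)
qed

text \<open>A straight line between two points need not stay on the variety. Instead s, t, w and c
  are interpolated linearly one by one; the products s w and t w, quadratic in the curve parameter,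
  still form proportional rows.\<close>

lemma zariski_irreducible_commuting_variety:
  "zariski_irreducible (u_index r) (commuting_variety r :: (_ \<Rightarrow> 'k::field) set)" if inf: "infinite (UNIV :: 'k set)"
proof (rule zariski_irreducible_curves[OF inf])
  have "abc_point r (\<lambda>_. 0) (\<lambda>_. 0) (\<lambda>_. 0) \<in> (commuting_variety r :: (_ \<Rightarrow> 'k) set)"
    by (simp add: abc_point_in_commuting_variety)
  then show "commuting_variety r \<noteq> ({} :: (_ \<Rightarrow> 'k) set)" by blast
  show "commuting_variety r \<subseteq> u_index r \<rightarrow>\<^sub>E (UNIV :: 'k set)" by (auto simp: commuting_variety_iff)
  fix x y :: "nat \<times> nat \<times> nat \<Rightarrow> 'k" assume xy: "x \<in> commuting_variety r" "y \<in> commuting_variety r"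
  obtain s t w c where x: "x = abc_point r (\<lambda>i. s * w i) (\<lambda>i. t * w i) c" using xy(1) by (rule commuting_variety_param)
  obtain s' t' w' c' where y: "y = abc_point r (\<lambda>i. s' * w' i) (\<lambda>i. t' * w' i) c'" using xy(2) by (rule commuting_variety_param)
  define l where "l p q = [:p, q - p:]" for p q :: 'k
  have l: "poly (l p q) 0 = p" "poly (l p q) 1 = q" for p q by (simp_all add: l_def)
  define \<gamma> where "\<gamma> = (\<lambda>(i, j, m). if j = (1::nat) then l s s' * l (w i) (w' i) else if m = (1::nat) then l t t' * l (w i) (w' i) else l (c i) (c' i))"
  have \<gamma>: "restrict (\<lambda>v. poly (\<gamma> v) z) (u_index r) = abc_point r (\<lambda>i. poly (l s s') z * poly (l (w i) (w' i)) z)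
      (\<lambda>i. poly (l t t') z * poly (l (w i) (w' i)) z) (\<lambda>i. poly (l (c i) (c' i)) z)" for z
    unfolding abc_point_def by (auto simp: \<gamma>_def restrict_def fun_eq_iff)
  show "\<exists>\<gamma>. (\<forall>z. restrict (\<lambda>v. poly (\<gamma> v) z) (u_index r) \<in> commuting_variety r) \<and>
       x = restrict (\<lambda>v. poly (\<gamma> v) 0) (u_index r) \<and> y = restrict (\<lambda>v. poly (\<gamma> v) 1) (u_index r)"
  proof (intro exI[of _ \<gamma>] conjI allI)
    show "restrict (\<lambda>v. poly (\<gamma> v) z) (u_index r) \<in> commuting_variety r" for z
      unfolding \<gamma> abc_point_in_commuting_variety by simp
  qed (simp_all add: \<gamma> x y l)
qed

section \<open>The vanishing ideal of the variety\<close>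

definition abc_hom :: "nat \<Rightarrow> ((nat \<times> nat \<times> nat \<Rightarrow>\<^sub>0 nat) \<Rightarrow>\<^sub>0 'k::comm_ring_1) \<Rightarrow> 'k npoly" where
  "abc_hom r = mp_subst mp_const (\<lambda>(i, j, l). if j = 1 then mp_var 0 * mp_var i else if l = 1 then mp_var i else mp_var (r + i))"

lemma comm_ring_hom_abc_hom: "comm_ring_hom (abc_hom r :: _ \<Rightarrow> 'k::comm_ring_1 npoly)"
proof -
  interpret c: comm_ring_hom "mp_const :: 'k \<Rightarrow> 'k npoly" by (rule comm_ring_hom_mp_const)
  show ?thesis unfolding abc_hom_def by (rule c.comm_ring_hom_mp_subst)
qed

lemma abc_hom_const [simp]: "abc_hom r (mp_const c) = mp_const (c :: 'k::comm_ring_1)"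
  and abc_hom_var [simp]: "abc_hom r (mp_var (i, j, l)) =
    (if j = 1 then mp_var 0 * mp_var i else if l = 1 then mp_var i else mp_var (r + i) :: 'k npoly)"
proof -
  interpret c: comm_ring_hom "mp_const :: 'k \<Rightarrow> 'k npoly" by (rule comm_ring_hom_mp_const)
  show "abc_hom r (mp_const c) = mp_const c" "abc_hom r (mp_var (i, j, l)) =
    (if j = 1 then mp_var 0 * mp_var i else if l = 1 then mp_var i else mp_var (r + i) :: 'k npoly)"
    unfolding abc_hom_def by simp_all
qed

lemma abc_hom_mem:
  assumes "p \<in> PI (u_index r)"
  shows "abc_hom r p \<in> segre r"
  unfolding abc_hom_def
proof (rule mp_subst_mem[OF assms comm_ring_hom_mp_const])
  fix v assume "v \<in> u_index r"
  then show "(case v of (i, j, l) \<Rightarrow> if j = 1 then mp_var 0 * mp_var i else if l = 1 then mp_var i else mp_var (r + i)) \<in> segre r"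
    by (cases rule: u_index_cases) (auto intro: segre_gens simp: One_nat_def[symmetric] simp del: One_nat_def)
qed (auto intro: segre_closed)

lemma abc_hom_image: "abc_hom r ` PI (u_index r) = (segre r :: 'k::comm_ring_1 npoly set)"
proof
  show "abc_hom r ` PI (u_index r) \<subseteq> (segre r :: 'k npoly set)" using abc_hom_mem by blast
  interpret h: comm_ring_hom "abc_hom r :: _ \<Rightarrow> 'k npoly" by (rule comm_ring_hom_abc_hom)
  let ?B = "abc_hom r ` PI (u_index r) :: 'k npoly set"
  show "segre r \<subseteq> ?B"
  proof (rule segre_subset)
    show "mp_const c \<in> ?B" for c by (rule image_eqI[of _ _ "mp_const c"]) simp_all
    show "a + b \<in> ?B" if "a \<in> ?B" "b \<in> ?B" for a b using that by (auto simp: h.hom_add[symmetric])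
    show "a * b \<in> ?B" if "a \<in> ?B" "b \<in> ?B" for a b using that by (auto simp: h.hom_mult[symmetric])
    fix i assume i: "i \<in> {1..r}"
    have "mp_var i \<in> ?B" by (rule image_eqI[of _ _ "mp_var (i, 2, 1)"]) (use i in auto)
    moreover have "mp_var 0 * mp_var i \<in> ?B" by (rule image_eqI[of _ _ "mp_var (i, 1, 0)"]) (use i in auto)
    moreover have "mp_var (r + i) \<in> ?B" by (rule image_eqI[of _ _ "mp_var (i, 2, 0)"]) (use i in auto)
    ultimately show "mp_var i \<in> ?B \<and> mp_var 0 * mp_var i \<in> ?B \<and> mp_var (r + i) \<in> ?B" by blast
  qed
qed

lemma abc_hom_eval:
  assumes "p \<in> PI (u_index r)"
  shows "mp_subst (\<lambda>c. c) q (abc_hom r p) = mpoly_eval (abc_point r (\<lambda>i. q 0 * q i) q (\<lambda>i. q (r + i))) (p :: _ \<Rightarrow>\<^sub>0 'k::comm_ring_1)"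
proof -
  interpret i: comm_ring_hom "\<lambda>c::'k. c" by (rule comm_ring_hom_ident)
  interpret e: comm_ring_hom "mp_subst (\<lambda>c::'k. c) q" by (rule i.comm_ring_hom_mp_subst)
  let ?g = "\<lambda>(i, j, l). if j = 1 then mp_var 0 * mp_var i else if l = 1 then mp_var i else mp_var (r + i) :: 'k npoly"
  have "mp_subst (\<lambda>c. c) q (abc_hom r p) = mp_subst (\<lambda>c. mp_subst (\<lambda>c. c) q (mp_const c)) (\<lambda>v. mp_subst (\<lambda>c. c) q (?g v)) p"
    unfolding abc_hom_def by (rule mp_subst_comp[OF comm_ring_hom_mp_const e.comm_ring_hom_axioms])
  also have "\<dots> = mp_subst (\<lambda>c. c) (\<lambda>v. mp_subst (\<lambda>c. c) q (?g v)) p" by simp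
  also have "\<dots> = mp_subst (\<lambda>c. c) (abc_point r (\<lambda>i. q 0 * q i) q (\<lambda>i. q (r + i))) p"
  proof (rule mp_subst_cong[OF assms])
    fix v assume "v \<in> u_index r"
    then show "mp_subst (\<lambda>c. c) q (?g v) = abc_point r (\<lambda>i. q 0 * q i) q (\<lambda>i. q (r + i)) v"
      by (cases rule: u_index_cases) (simp_all add: e.hom_mult)
  qed
  finally show ?thesis by (simp add: mpoly_eval_eq_subst)
qed

text \<open>Values of \<open>abc_hom r p\<close> are values of p at the points (\<zeta> b, b, c);
  over an infinite field, vanishing at all of them means that the image is zero. Points with b = 0
  and a = w \<noteq> 0 are not of this form, but they are the limits at z = 0 of the points (w, z w,
  c), whose ratio is 1 / z.\<close>

lemma vanishing_ideal_commuting_variety: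
  assumes inf: "infinite (UNIV :: 'k::field set)"
  shows "vanishing_ideal (u_index r) (commuting_variety r) = {p \<in> PI (u_index r). abc_hom r p = (0 :: 'k npoly)}"
proof (intro equalityI subsetI CollectI conjI)
  fix p :: "_ \<Rightarrow>\<^sub>0 'k" assume p: "p \<in> vanishing_ideal (u_index r) (commuting_variety r)"
  then show pI: "p \<in> PI (u_index r)" by (simp add: vanishing_ideal_def)
  have "mp_subst (\<lambda>c. c) q (abc_hom r p) = 0" for q
  proof -
    have "abc_point r (\<lambda>i. q 0 * q i) q (\<lambda>i. q (r + i)) \<in> commuting_variety r"
      by (simp add: abc_point_in_commuting_variety)
    then show ?thesis unfolding abc_hom_eval[OF pI] using p by (simp add: vanishing_ideal_def)
  qed
  then show "abc_hom r p = 0" using exists_nonzero_value[OF inf] by blast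
next
  fix p :: "_ \<Rightarrow>\<^sub>0 'k" assume "p \<in> {p \<in> PI (u_index r). abc_hom r p = 0}"
  then have pI: "p \<in> PI (u_index r)" and p0: "abc_hom r p = 0" by auto
  have ratio: "mpoly_eval (abc_point r (\<lambda>i. z * b i) b c) p = 0" for z b c
  proof -
    define q where "q i = (if i = 0 then z else if i \<le> r then b i else c (i - r))" for i
    have "abc_point r (\<lambda>i. q 0 * q i) q (\<lambda>i. q (r + i)) = abc_point r (\<lambda>i. z * b i) b c"
      by (auto simp: abc_point_def restrict_def u_index_def q_def fun_eq_iff)
    then show ?thesis using abc_hom_eval[OF pI, of q] p0 by (simp add: mp_subst_def)
  qed
  have "mpoly_eval x p = 0" if x: "x \<in> commuting_variety r" for x
  proof -
    obtain s t w c where x: "x = abc_point r (\<lambda>i. s * w i) (\<lambda>i. t * w i) c" and st: "t \<noteq> 0 \<or> t = 0 \<and> s = 1"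
      using x by (rule commuting_variety_param)
    show ?thesis
    proof (cases "t = 0")
      case False
      have "x = abc_point r (\<lambda>i. s / t * (t * w i)) (\<lambda>i. t * w i) c" unfolding x using False by simp
      then show ?thesis using ratio[of "s / t" "\<lambda>i. t * w i" c] by simp
    next
      case True
      define \<gamma> where "\<gamma> = (\<lambda>(i, j, l). if j = (1::nat) then [:w i:] else if l = (1::nat) then [:0, w i:] else [:c i:])"
      have g: "restrict (\<lambda>v. poly (\<gamma> v) z) (u_index r) = abc_point r (\<lambda>i. w i) (\<lambda>i. z * w i) c" for z
        unfolding abc_point_def by (auto simp: \<gamma>_def restrict_def fun_eq_iff)
      let ?P = "mp_subst (\<lambda>c. [:c:]) \<gamma> p"
      have P: "poly ?P z = mpoly_eval (abc_point r (\<lambda>i. w i) (\<lambda>i. z * w i) c) p" for z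
        unfolding poly_curve_eval g[symmetric] mpoly_eval_restrict[OF pI] ..
      have "poly ?P z = 0" if "z \<noteq> 0" for z
        using ratio[of "1 / z" "\<lambda>i. z * w i" c] that unfolding P by simp
      then have "{z. poly ?P z \<noteq> 0} \<subseteq> {0}" by blast
      \<comment> \<open>Vanishing is known only for z \<noteq> 0; the extra factor z makes the
        product vanish everywhere, hence identically.\<close>
      then have "?P * [:0, 1:] = 0" using poly_nonroot[OF inf, of "?P * [:0, 1:]"] by auto
      then have "poly ?P 0 = 0" by simp
      moreover have "s = 1" using st True by simp
      ultimately show ?thesis unfolding P x using True by simp
    qed
  qed
  then show "p \<in> vanishing_ideal (u_index r) (commuting_variety r)" using pI by (simp add: vanishing_ideal_def)
qed

lemma segre_PI: "segre r \<subseteq> PI {..2 * r}"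
  unfolding monomial_ring_def segre_monomials_def by (intro subsetI) (auto simp: PI_iff dest!: subsetD)

lemma prime_chain_commuting_variety:
  fixes P :: "nat \<Rightarrow> ((nat \<times> nat \<times> nat \<Rightarrow>\<^sub>0 nat) \<Rightarrow>\<^sub>0 'k::field) set"
  assumes inf: "infinite (UNIV :: 'k set)"
    and "vanishing_ideal (u_index r) (commuting_variety r) \<subseteq> P 0"
    and "\<And>i. i \<le> n \<Longrightarrow> primeideal (P i) (mpoly_ring (u_index r))" "\<And>i. i < n \<Longrightarrow> P i \<subset> P (Suc i)"
  shows "n \<le> 2 * r + 1"
proof -
  have "n \<le> card {..2 * r}"
  proof (rule prime_chain_le[where \<phi> = "abc_hom r" and P = P and I = "u_index r"])
    show "abc_hom r p \<in> PI {..2 * r}" if "p \<in> PI (u_index r)" for p :: "_ \<Rightarrow>\<^sub>0 'k"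
      using abc_hom_mem[OF that] segre_PI by blast
    show "p \<in> P 0" if "p \<in> PI (u_index r)" "abc_hom r p = 0" for p
      using that assms(2) unfolding vanishing_ideal_commuting_variety[OF inf] by blast
  qed (use assms comm_ring_hom_abc_hom in auto)
  then show ?thesis by simp
qed

section \<open>The dimension of the variety\<close>

lemma variety_dim_le:
  fixes r :: nat
  assumes inf: "infinite (UNIV :: 'k::field set)"
  shows "variety_dim (u_index r) (commuting_variety r :: (_ \<Rightarrow> 'k) set) \<le> enat (2 * r + 1)"
  unfolding variety_dim_def
proof (rule Sup_least, clarify)
  fix n and Z :: "nat \<Rightarrow> (nat \<times> nat \<times> nat \<Rightarrow> 'k) set"
  assume Z: "\<forall>i\<le>n. zariski_closed (u_index r) (Z i) \<and> zariski_irreducible (u_index r) (Z i) \<and> Z i \<subseteq> commuting_variety r"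
    and st: "\<forall>i<n. Z i \<subset> Z (Suc i)"
  \<comment> \<open>Vanishing ideals reverse inclusions, so the chain is read from its top.\<close>
  define P where "P i = vanishing_ideal (u_index r) (Z (n - i))" for i
  have sub: "Z i \<subseteq> u_index r \<rightarrow>\<^sub>E UNIV" if "i \<le> n" for i
    using Z that unfolding zariski_closed_def by blast
  have "n \<le> 2 * r + 1"
  proof (rule prime_chain_commuting_variety[OF inf, of r P])
    show "vanishing_ideal (u_index r) (commuting_variety r) \<subseteq> P 0"
      using Z unfolding P_def vanishing_ideal_def by fastforce
    show "primeideal (P i) (mpoly_ring (u_index r))" if "i \<le> n" for i
      unfolding P_def using Z sub by (intro primeideal_vanishing_ideal) auto
    fix i assume i: "i < n"
    have lt: "Z (n - Suc i) \<subset> Z (n - i)" using st i by (metis Suc_diff_Suc diff_less lessI less_zeroE less_trans not_gr_zero zero_less_Suc)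
    have "P i \<subseteq> P (Suc i)" using lt unfolding P_def vanishing_ideal_def by auto
    moreover have "P (Suc i) \<noteq> P i"
    proof
      assume eq: "P (Suc i) = P i"
      obtain x where x: "x \<in> Z (n - i)" "x \<notin> Z (n - Suc i)" using lt by blast
      have "x \<in> Z (n - Suc i)"
      proof (rule zariski_closed_vanishing)
        show "zariski_closed (u_index r) (Z (n - Suc i))" using Z by simp
        show "x \<in> u_index r \<rightarrow>\<^sub>E UNIV" using x(1) sub[of "n - i"] by auto
        show "mpoly_eval x p = 0" if "p \<in> vanishing_ideal (u_index r) (Z (n - Suc i))" for p
          using that eq x(1) unfolding P_def by (auto simp: vanishing_ideal_def)
      qed
      then show False using x(2) by simp
    qed
    ultimately show "P i \<subset> P (Suc i)" by blast
  qed
  then show "enat n \<le> enat (2 * r + 1)" by simp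
qed

text \<open>The points with b = 0 form a linear space of dimension 2r on the variety. Freeing one
  a_i or c_i after the other gives a flag of 2r + 1 coordinate subspaces, and the variety is
  strictly larger because it contains a point with b \<noteq> 0.\<close>

lemma variety_dim_ge:
  fixes r :: nat
  assumes inf: "infinite (UNIV :: 'k::field set)" and r: "r \<ge> 1"
  shows "enat (2 * r + 1) \<le> variety_dim (u_index r) (commuting_variety r :: (_ \<Rightarrow> 'k) set)"
proof -
  define f :: "nat \<Rightarrow> nat \<times> nat \<times> nat" where "f k = (if k < r then (k + 1, 1, 0) else (k - r + 1, 2, 0))" for k
  define V :: "nat \<Rightarrow> (nat \<times> nat \<times> nat \<Rightarrow> 'k) set" where
    "V m = {x \<in> u_index r \<rightarrow>\<^sub>E UNIV. \<forall>v\<in>u_index r. v \<notin> f ` {..<m} \<longrightarrow> x v = 0}" for m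
  define Z where "Z m = (if m \<le> 2 * r then V m else commuting_variety r)" for m
  have fI: "f k \<in> u_index r" if "k < 2 * r" for k using that by (auto simp: f_def)
  have fb: "(i, 2, 1) \<notin> f ` A" for i A by (auto simp: f_def split: if_splits)
  have VC: "V m \<subseteq> commuting_variety r" for m
  proof
    fix x assume x: "x \<in> V m"
    have "x (i, 2, 1) = 0" if "i \<in> {1..r}" for i using x fb[of i "{..<m}"] that by (auto simp: V_def)
    then show "x \<in> commuting_variety r" using x by (auto simp: commuting_variety_iff V_def)
  qed
  have Vcl: "zariski_closed (u_index r) (V m)" for m
    unfolding zariski_closed_def
    by (rule exI[of _ "mp_var ` (u_index r - f ` {..<m})"]) (auto simp: V_def)
  have Virr: "zariski_irreducible (u_index r) (V m)" for m
  proof (rule zariski_irreducible_curves[OF inf])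
    have "restrict (\<lambda>_. 0) (u_index r) \<in> V m" by (simp add: V_def)
    then show "V m \<noteq> {}" by blast
    show "V m \<subseteq> u_index r \<rightarrow>\<^sub>E UNIV" by (auto simp: V_def)
    fix x y assume xy: "x \<in> V m" "y \<in> V m"
    have ext: "restrict u (u_index r) = w" if "w \<in> V m" "\<And>v. v \<in> u_index r \<Longrightarrow> u v = w v" for u w
    proof
      fix v show "restrict u (u_index r) v = w v"
        using that PiE_arb[of w "u_index r" "\<lambda>_. UNIV" v] by (cases "v \<in> u_index r") (auto simp: V_def restrict_def)
    qed
    show "\<exists>\<gamma>. (\<forall>t. restrict (\<lambda>v. poly (\<gamma> v) t) (u_index r) \<in> V m) \<and>
       x = restrict (\<lambda>v. poly (\<gamma> v) 0) (u_index r) \<and> y = restrict (\<lambda>v. poly (\<gamma> v) 1) (u_index r)"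
      using xy by (intro exI[of _ "\<lambda>v. [:x v, y v - x v:]"] conjI allI)
        (simp add: V_def, rule ext[symmetric], simp, simp, rule ext[symmetric], simp, simp)
  qed
  have e: "restrict (\<lambda>v. if v = w then 1 else 0) (u_index r) \<in> u_index r \<rightarrow>\<^sub>E (UNIV :: 'k set)" for w by simp
  have "enat (2 * r + 1) \<in> {enat n | n. \<exists>Z :: nat \<Rightarrow> (nat \<times> nat \<times> nat \<Rightarrow> 'k) set.
     (\<forall>i\<le>n. zariski_closed (u_index r) (Z i) \<and> zariski_irreducible (u_index r) (Z i) \<and> Z i \<subseteq> commuting_variety r) \<and>
     (\<forall>i<n. Z i \<subset> Z (Suc i))}"
  proof (intro CollectI exI[of _ "2 * r + 1"] exI[of _ Z] conjI allI impI refl)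
    fix i assume "i \<le> 2 * r + 1"
    show "zariski_closed (u_index r) (Z i)" using Vcl zariski_closed_commuting_variety by (auto simp: Z_def)
    show "zariski_irreducible (u_index r) (Z i)" using Virr zariski_irreducible_commuting_variety[OF inf] by (auto simp: Z_def)
    show "Z i \<subseteq> commuting_variety r" using VC by (auto simp: Z_def)
  next
    fix i assume i: "i < 2 * r + 1"
    show "Z i \<subset> Z (Suc i)"
    proof (cases "i < 2 * r")
      case True
      have inj: "f k \<noteq> f i" if "k < i" for k using that True by (auto simp: f_def)
      let ?x = "restrict (\<lambda>v. if v = f i then 1 else (0::'k)) (u_index r)"
      have "?x \<in> V (Suc i)" by (auto simp: V_def lessThan_Suc)
      moreover have "?x \<notin> V i"
      proof
        assume "?x \<in> V i"
        moreover have "f i \<notin> f ` {..<i}" using inj by force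
        ultimately have "?x (f i) = 0" using fI[OF True] unfolding V_def by blast
        then show False using fI[OF True] by simp
      qed
      moreover have "V i \<subseteq> V (Suc i)" by (auto simp: V_def)
      ultimately show ?thesis using True by (auto simp: Z_def)
    next
      case False
      then have i: "i = 2 * r" using i by simp
      let ?x = "abc_point r (\<lambda>_. 0) (\<lambda>_. 1) (\<lambda>_. 0) :: _ \<Rightarrow> 'k"
      have "?x \<in> commuting_variety r" by (simp add: abc_point_in_commuting_variety)
      moreover have "?x \<notin> V (2 * r)"
      proof
        assume "?x \<in> V (2 * r)"
        moreover have "(1, 2, 1) \<in> u_index r" using r by simp
        ultimately have "?x (1, 2, 1) = 0" using fb[of 1 "{..<2 * r}"] unfolding V_def by blast
        then show False using r by simp
      qed
      ultimately show ?thesis using VC i by (auto simp: Z_def)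
    qed
  qed
  then show ?thesis unfolding variety_dim_def by (rule Sup_upper)
qed

section \<open>The coordinate ring of the commuting variety\<close>

lemma mpoly_ring_minus:
  assumes "p \<in> PI I" "q \<in> PI I"
  shows "p \<ominus>\<^bsub>mpoly_ring I\<^esub> q = p - (q :: _ \<Rightarrow>\<^sub>0 'k::comm_ring_1)"
proof -
  interpret R: cring "mpoly_ring I :: (_ \<Rightarrow>\<^sub>0 'k) ring" by (rule cring_mpoly_ring)
  have "\<ominus>\<^bsub>mpoly_ring I\<^esub> q = - q" using R.minus_equality[of "- q" q] assms by simp
  then show ?thesis by (simp add: a_minus_def)
qed

lemma primeideal_vimage:
  assumes h: "ring_hom_ring R S h" and R: "cring R" and P: "primeideal P S"
  shows "primeideal {a \<in> carrier R. h a \<in> P} R"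
proof -
  interpret h: ring_hom_ring R S h by fact
  interpret P: primeideal P S by fact
  show ?thesis
  proof (rule primeidealI[OF h.ideal_vimage[OF P.is_ideal] R])
    have "h \<one>\<^bsub>R\<^esub> \<notin> P" using P.one_imp_carrier P.I_notcarr by auto
    then show "carrier R \<noteq> {a \<in> carrier R. h a \<in> P}" using h.R.one_closed by blast
    fix a b assume ab: "a \<in> carrier R" "b \<in> carrier R" "a \<otimes>\<^bsub>R\<^esub> b \<in> {a \<in> carrier R. h a \<in> P}"
    then have "h a \<otimes>\<^bsub>S\<^esub> h b \<in> P" by simp
    then show "a \<in> {a \<in> carrier R. h a \<in> P} \<or> b \<in> {a \<in> carrier R. h a \<in> P}"
      using P.I_prime[of "h a" "h b"] ab by auto
  qed
qed

context
  fixes r :: nat and C :: "(nat \<times> nat \<times> nat \<Rightarrow> 'k::alg_closed_field) set"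
  assumes C_def: "C = commuting_variety r"
begin

abbreviation "I \<equiv> u_index r"
abbreviation "J \<equiv> vanishing_ideal I C"
abbreviation "P \<equiv> mpoly_ring I :: ((nat \<times> nat \<times> nat \<Rightarrow>\<^sub>0 nat) \<Rightarrow>\<^sub>0 'k) ring"
abbreviation "A \<equiv> coordinate_ring I C"
abbreviation "coset p \<equiv> J +>\<^bsub>P\<^esub> p"

lemma A_eq: "A = P Quot J" by (simp add: coordinate_ring_def)

lemma primeideal_J: "primeideal J P"
  unfolding C_def
  by (rule primeideal_vanishing_ideal[OF zariski_irreducible_commuting_variety[OF infinite_UNIV_alg_closed]])
    (auto simp: commuting_variety_iff)

lemma ideal_J: "ideal J P" using primeideal_J by (simp add: primeideal_def)

lemma domain_A: "domain A" unfolding A_eq by (rule primeideal.quotient_is_domain[OF primeideal_J])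

lemma coset_hom: "ring_hom_ring P A (\<lambda>p. coset p)"
  unfolding A_eq using ideal.rcos_ring_hom_ring[OF ideal_J] .

lemma coset_surj: "(\<lambda>p. coset p) ` carrier P = carrier A"
  unfolding A_eq FactRing_def A_RCOSETS_def' by auto

lemma carrier_A_E: assumes "x \<in> carrier A" obtains p where "p \<in> carrier P" "x = coset p"
  using assms unfolding coset_surj[symmetric] by blast

lemma coset_eq_iff: "p \<in> carrier P \<Longrightarrow> q \<in> carrier P \<Longrightarrow> coset p = coset q \<longleftrightarrow> p - q \<in> J"
  using ring.quotient_eq_iff_same_a_r_cos[OF cring.axioms(1)[OF cring_mpoly_ring] ideal_J, of p q]
  by (simp add: mpoly_ring_minus)

lemma noetherian_A: "noetherian_ring A"
  by (rule noetherian_ring_surj[OF coset_hom coset_surj noetherian_mpoly_ring[OF finite_u_index]])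

lemma krull_dim_A: "krull_dim A \<le> enat (2 * r + 1)"
  unfolding krull_dim_def
proof (rule Sup_least, clarify)
  fix n and Q :: "nat \<Rightarrow> ((nat \<times> nat \<times> nat \<Rightarrow>\<^sub>0 nat) \<Rightarrow>\<^sub>0 'k) set set"
  assume Q: "\<forall>i\<le>n. primeideal (Q i) A" "\<forall>i<n. Q i \<subset> Q (Suc i)"
  interpret h: ring_hom_ring P A "\<lambda>p. coset p" by (rule coset_hom)
  define q where "q i = {p \<in> carrier P. coset p \<in> Q i}" for i
  have "n \<le> 2 * r + 1"
  proof (rule prime_chain_commuting_variety[OF infinite_UNIV_alg_closed, of r q])
    show "primeideal (q i) P" if "i \<le> n" for i
      unfolding q_def using Q(1) that by (intro primeideal_vimage[OF coset_hom cring_mpoly_ring]) auto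
    have "\<zero>\<^bsub>A\<^esub> \<in> Q 0" using Q(1) by (auto simp: primeideal_def ideal_def additive_subgroup.zero_closed)
    moreover have "coset p = \<zero>\<^bsub>A\<^esub>" if "p \<in> J" for p
      using ring.a_rcos_zero[OF cring.axioms(1)[OF cring_mpoly_ring] ideal_J that] by (simp add: A_eq FactRing_def)
    ultimately show "vanishing_ideal (u_index r) (commuting_variety r) \<subseteq> q 0"
      unfolding q_def C_def[symmetric] using ideal.Icarr[OF ideal_J] by auto
    fix i assume i: "i < n"
    have lt: "Q i \<subset> Q (Suc i)" using Q(2) i by blast
    then obtain x where x: "x \<in> Q (Suc i)" "x \<notin> Q i" by blast
    have "ideal (Q (Suc i)) A" using Q(1) i by (auto simp: primeideal_def)
    then have "x \<in> carrier A" using x(1) by (rule ideal.Icarr)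
    then obtain p where "p \<in> carrier P" "x = coset p" by (rule carrier_A_E)
    then have "p \<in> q (Suc i)" "p \<notin> q i" using x by (auto simp: q_def)
    moreover have "q i \<subseteq> q (Suc i)" using lt by (auto simp: q_def)
    ultimately show "q i \<subset> q (Suc i)" by blast
  qed
  then show "enat n \<le> enat (2 * r + 1)" by simp
qed

text \<open>The first isomorphism theorem for \<open>abc_hom\<close>, whose kernel is the vanishing
  ideal. Two mutually inverse homomorphisms are provided because ideals are pulled back along
  both.\<close>

lemma A_iso_segre:
  "\<exists>\<sigma> \<tau>. \<sigma> \<in> ring_hom (subring_of (segre r :: 'k npoly set)) A \<and> \<tau> \<in> ring_hom A (subring_of (segre r)) \<and>
     (\<forall>s\<in>segre r. \<tau> (\<sigma> s) = s) \<and> (\<forall>a\<in>carrier A. \<sigma> (\<tau> a) = a)"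
proof -
  let ?S = "subring_of (segre r :: 'k npoly set)"
  interpret h: comm_ring_hom "abc_hom r :: _ \<Rightarrow> 'k npoly" by (rule comm_ring_hom_abc_hom)
  have S: "cring ?S" by (rule cring_subring_of[OF subring_closed_segre])
  have rP: "ring P" and rS: "ring ?S" using cring.axioms(1)[OF cring_mpoly_ring] cring.axioms(1)[OF S] by auto
  have "abc_hom r \<in> ring_hom P ?S"
    by (rule ring_hom_memI) (simp_all add: abc_hom_mem h.hom_add h.hom_mult)
  then interpret \<phi>: ring_hom_ring P ?S "abc_hom r" using ring_hom_ringI2[OF rP rS] by blast
  have ker: "a_kernel P ?S (abc_hom r) = J"
    unfolding a_kernel_def' C_def vanishing_ideal_commuting_variety[OF infinite_UNIV_alg_closed] by simp
  define \<tau> where "\<tau> = (\<lambda>x. the_elem ((abc_hom r :: _ \<Rightarrow> 'k npoly) ` x))"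
  have \<tau>: "\<tau> \<in> ring_iso A ?S"
    unfolding \<tau>_def A_eq ker[symmetric] by (rule \<phi>.FactRing_iso_set) (simp add: abc_hom_image)
  have rA: "ring A" using domain_A by (simp add: domain_def cring_def)
  define \<sigma> where "\<sigma> = inv_into (carrier A) \<tau>"
  have \<sigma>: "\<sigma> \<in> ring_iso ?S A" unfolding \<sigma>_def by (rule ring_iso_set_sym[OF rA \<tau>])
  have bij: "bij_betw \<tau> (carrier A) (carrier ?S)" by (rule ring_iso_memE(5)[OF \<tau>])
  show ?thesis
  proof (intro exI conjI ballI)
    show "\<sigma> \<in> ring_hom ?S A" "\<tau> \<in> ring_hom A ?S" using \<sigma> \<tau> by (auto simp: ring_iso_def)
    fix s :: "'k npoly" assume "s \<in> segre r"
    then show "\<tau> (\<sigma> s) = s" unfolding \<sigma>_def using bij_betw_inv_into_right[OF bij] by simp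
  next
    fix a assume "a \<in> carrier A"
    then show "\<sigma> (\<tau> a) = a" unfolding \<sigma>_def using bij_betw_inv_into_left[OF bij] by blast
  qed
qed

lemma cohen_macaulay_A: "r \<ge> 1 \<Longrightarrow> cohen_macaulay A"
proof -
  assume r: "r \<ge> 1"
  obtain \<sigma> \<tau> where *: "\<sigma> \<in> ring_hom (subring_of (segre r :: 'k npoly set)) A" "\<tau> \<in> ring_hom A (subring_of (segre r))"
    "\<forall>s\<in>segre r. \<tau> (\<sigma> s) = s" "\<forall>a\<in>carrier A. \<sigma> (\<tau> a) = a" using A_iso_segre by blast
  have "cring A" using domain_A by (simp add: domain_def)
  then show ?thesis by (rule cohen_macaulay_segre_iso[OF r _ noetherian_A krull_dim_A *(1,2)]) (use *(3,4) in blast)+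
qed

lemma normal_domain_A: "normal_domain A"
proof -
  obtain \<sigma> \<tau> where *: "\<sigma> \<in> ring_hom (subring_of (segre r :: 'k npoly set)) A" "\<tau> \<in> ring_hom A (subring_of (segre r))"
    "\<forall>s\<in>segre r. \<tau> (\<sigma> s) = s" "\<forall>a\<in>carrier A. \<sigma> (\<tau> a) = a" using A_iso_segre by blast
  show ?thesis by (rule normal_domain_segre_iso[OF domain_A *(1,2)]) (use *(3,4) in blast)+
qed

text \<open>All coordinate lines through the point lie on the variety, so that its tangent space is the whole
  space, of dimension \<open>3 * r > 2 * r + 1\<close>.\<close>

lemma singular_A:
  assumes r: "r \<ge> 2"
  shows "singular_at I C (u_coords r (corner_tuple r y))"
proof -
  define x where "x = u_coords r (corner_tuple r y)"
  have x: "x = abc_point r (\<lambda>_. 0) (\<lambda>_. 0) y"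
    unfolding x_def u_coords_def abc_point_def by (auto simp: restrict_def corner_tuple_def u_index_def fun_eq_iff)
  have xC: "x \<in> C" unfolding x C_def by (simp add: abc_point_in_commuting_variety)
  define line where "line w = (\<lambda>v. [:x v, if v = w then 1 else (0::'k):])" for w
  \<comment> \<open>The restriction of a polynomial to the line through x in direction w: the
    constant coefficient is the value at x, the linear one the partial derivative. The product rule
    becomes a statement about coefficients of a product.\<close>
  define E where "E w = mp_subst (\<lambda>c. [:c:]) (line w)" for w
  interpret pc: comm_ring_hom "\<lambda>c::'k. [:c:]" by (rule comm_ring_hom_pCons)
  have E: "comm_ring_hom (E w)" for w unfolding E_def by (rule pc.comm_ring_hom_mp_subst)
  \<comment> \<open>Moving one coordinate leaves one of the rows a and b equal to zero, so all
    minors vanish.\<close>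
  have lineC: "restrict (\<lambda>v. poly (line w v) t) I \<in> C" if "w \<in> I" for w t
  proof -
    have "restrict (\<lambda>v. poly (line w v) t) I = abc_point r (\<lambda>i. if (i, 1, 0) = w then t else 0) (\<lambda>i. if (i, 2, 1) = w then t else 0)
        (\<lambda>i. if (i, 2, 0) = w then y i + t else y i)"
    proof (subst abc_point_eta[of "restrict (\<lambda>v. poly (line w v) t) I" r])
      show "restrict (\<lambda>v. poly (line w v) t) I \<in> I \<rightarrow>\<^sub>E UNIV" by simp
      show "abc_point r (\<lambda>i. restrict (\<lambda>v. poly (line w v) t) I (i, 1, 0)) (\<lambda>i. restrict (\<lambda>v. poly (line w v) t) I (i, 2, 1))
        (\<lambda>i. restrict (\<lambda>v. poly (line w v) t) I (i, 2, 0)) = abc_point r (\<lambda>i. if (i, 1, 0) = w then t else 0) (\<lambda>i. if (i, 2, 1) = w then t else 0)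
        (\<lambda>i. if (i, 2, 0) = w then y i + t else y i)"
        unfolding abc_point_def by (rule restrict_ext) (auto simp: line_def x abc_point_def u_index_def)
    qed
    moreover have "\<dots> \<in> C" unfolding C_def abc_point_in_commuting_variety by auto
    ultimately show ?thesis by simp
  qed
  have EJ: "E w p = 0" if "p \<in> J" "w \<in> I" for p w
  proof -
    have pI: "p \<in> carrier P" using that(1) by (simp add: vanishing_ideal_def)
    have "poly (E w p) t = 0" for t
      unfolding E_def poly_curve_eval using lineC[OF that(2)] that(1) mpoly_eval_restrict[OF pI] by (metis (mono_tags, lifting) mem_Collect_eq vanishing_ideal_def)
    then show ?thesis using poly_nonroot[OF infinite_UNIV_alg_closed] by blast
  qed
  have Eq: "E w p = E w q" if "p \<in> carrier P" "q \<in> carrier P" "coset p = coset q" "w \<in> I" for p q w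
  proof -
    interpret E: comm_ring_hom "E w" by (rule E)
    have "E w (p - q) = 0" using that coset_eq_iff by (intro EJ) auto
    then show ?thesis by (simp add: E.hom_minus)
  qed
  have E0: "Polynomial.coeff (E w p) 0 = mpoly_eval x p" if "p \<in> carrier P" for w p
    unfolding poly_0_coeff_0[symmetric] E_def poly_curve_eval by (simp add: line_def)
  \<comment> \<open>\<open>\<epsilon>\<close> and \<open>D\<close> must be functions on cosets. Any
    representative will do, because \<open>E w\<close> kills the vanishing ideal for
    \<open>w\<close> in \<open>I\<close>.\<close>
  define rep where "rep z = (SOME p. p \<in> carrier P \<and> z = coset p)" for z
  have rep: "rep z \<in> carrier P \<and> z = coset (rep z)" if z: "z \<in> carrier A" for z
  proof -
    obtain p where "p \<in> carrier P" "z = coset p" using z by (rule carrier_A_E)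
    then have "\<exists>p. p \<in> carrier P \<and> z = coset p" by blast
    then show ?thesis unfolding rep_def by (rule someI_ex)
  qed
  define \<epsilon> where "\<epsilon> z = mpoly_eval x (rep z)" for z
  define D where "D z w = (if w \<in> I then Polynomial.coeff (E w (rep z)) 1 else 0)" for z w
  interpret h: ring_hom_ring P A "\<lambda>p. coset p" by (rule coset_hom)
  have repc: "coset p \<in> carrier A" "coset (rep (coset p)) = coset p" "rep (coset p) \<in> carrier P" if "p \<in> carrier P" for p
    using rep[of "coset p"] h.hom_closed[OF that] by auto
  have D: "D (coset p) w = (if w \<in> I then Polynomial.coeff (E w p) 1 else 0)" if "p \<in> carrier P" for p w
    using Eq[OF repc(3)[OF that] that repc(2)[OF that]] by (simp add: D_def)
  have "(1, 1, 0) \<in> I" using r by simp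
  then have \<epsilon>: "\<epsilon> (coset p) = mpoly_eval x p" if "p \<in> carrier P" for p
    using Eq[OF repc(3)[OF that] that repc(2)[OF that], of "(1, 1, 0)"] E0[OF that, of "(1, 1, 0)"] E0[OF repc(3)[OF that], of "(1, 1, 0)"]
    unfolding \<epsilon>_def by simp
  have \<epsilon>_mult: "\<epsilon> (a \<otimes>\<^bsub>A\<^esub> b) = \<epsilon> a * \<epsilon> b" and \<epsilon>_add: "\<epsilon> (a \<oplus>\<^bsub>A\<^esub> b) = \<epsilon> a + \<epsilon> b"
    and D_add: "D (a \<oplus>\<^bsub>A\<^esub> b) w = D a w + D b w" and D_mult: "D (a \<otimes>\<^bsub>A\<^esub> b) w = \<epsilon> a * D b w + \<epsilon> b * D a w"
    if ab: "a \<in> carrier A" "b \<in> carrier A" for a b w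
  proof -
    interpret E: comm_ring_hom "E w" by (rule E)
    obtain p where p: "p \<in> carrier P" "a = coset p" using ab(1) by (rule carrier_A_E)
    obtain q where q: "q \<in> carrier P" "b = coset q" using ab(2) by (rule carrier_A_E)
    have m: "a \<otimes>\<^bsub>A\<^esub> b = coset (p * q)" unfolding p(2) q(2) using h.hom_mult[OF p(1) q(1)] by simp
    have s: "a \<oplus>\<^bsub>A\<^esub> b = coset (p + q)" unfolding p(2) q(2) using h.hom_add[OF p(1) q(1)] by simp
    have pq: "p * q \<in> carrier P" "p + q \<in> carrier P" using p(1) q(1) by simp_all
    have \<epsilon>a: "\<epsilon> a = mpoly_eval x p" and \<epsilon>b: "\<epsilon> b = mpoly_eval x q" unfolding p(2) q(2) using \<epsilon> p(1) q(1) by auto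
    show "\<epsilon> (a \<otimes>\<^bsub>A\<^esub> b) = \<epsilon> a * \<epsilon> b" unfolding m \<epsilon>[OF pq(1)] \<epsilon>a \<epsilon>b by simp
    show "\<epsilon> (a \<oplus>\<^bsub>A\<^esub> b) = \<epsilon> a + \<epsilon> b" unfolding s \<epsilon>[OF pq(2)] \<epsilon>a \<epsilon>b by simp
    show "D (a \<oplus>\<^bsub>A\<^esub> b) w = D a w + D b w" unfolding s D[OF pq(2)] unfolding p(2) q(2) D[OF p(1)] D[OF q(1)] by (simp add: E.hom_add)
    have "Polynomial.coeff (E w p * E w q) 1 = Polynomial.coeff (E w p) 0 * Polynomial.coeff (E w q) 1 + Polynomial.coeff (E w p) 1 * Polynomial.coeff (E w q) 0"
      by (simp add: coeff_mult)
    then show "D (a \<otimes>\<^bsub>A\<^esub> b) w = \<epsilon> a * D b w + \<epsilon> b * D a w"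
      unfolding m D[OF pq(1)] \<epsilon>a \<epsilon>b unfolding p(2) q(2) D[OF p(1)] D[OF q(1)] by (simp add: E.hom_mult E0[OF p(1)] E0[OF q(1)])
  qed
  have PI_eq: "point_ideal I C x = {z \<in> carrier A. \<epsilon> z = 0}"
  proof (intro equalityI subsetI)
    fix z assume "z \<in> point_ideal I C x"
    then obtain p where "p \<in> carrier P" "mpoly_eval x p = 0" "z = coset p" unfolding point_ideal_def by blast
    then show "z \<in> {z \<in> carrier A. \<epsilon> z = 0}" using repc(1) \<epsilon> by simp
  next
    fix z assume "z \<in> {z \<in> carrier A. \<epsilon> z = 0}"
    then have z: "z \<in> carrier A" "\<epsilon> z = 0" by auto
    obtain p where "p \<in> carrier P" "z = coset p" using z(1) by (rule carrier_A_E)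
    then show "z \<in> point_ideal I C x" unfolding point_ideal_def using z(2) \<epsilon> by auto
  qed
  interpret A: domain A by (rule domain_A)
  have \<epsilon>1: "\<epsilon> \<one>\<^bsub>A\<^esub> = 1" using \<epsilon>[of 1] h.hom_one by simp
  have "\<epsilon> \<zero>\<^bsub>A\<^esub> = \<epsilon> \<zero>\<^bsub>A\<^esub> + \<epsilon> \<zero>\<^bsub>A\<^esub>"
    using \<epsilon>_add[OF h.S.zero_closed h.S.zero_closed] by (simp only: h.S.l_zero h.S.zero_closed)
  then have \<epsilon>0: "\<epsilon> \<zero>\<^bsub>A\<^esub> = 0" by (simp only: add_cancel_right_right)
  have prime: "primeideal (point_ideal I C x) A"
  proof (rule primeidealI)
    show "ideal (point_ideal I C x) A" unfolding PI_eq
      by (rule A.idealI_mult) (auto simp: \<epsilon>0 \<epsilon>_add \<epsilon>_mult)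
    show "cring A" by (rule A.is_cring)
    have "\<one>\<^bsub>A\<^esub> \<notin> point_ideal I C x" unfolding PI_eq using \<epsilon>1 by simp
    then show "carrier A \<noteq> point_ideal I C x" using h.S.one_closed by blast
    fix a b assume "a \<in> carrier A" "b \<in> carrier A" "a \<otimes>\<^bsub>A\<^esub> b \<in> point_ideal I C x"
    then show "a \<in> point_ideal I C x \<or> b \<in> point_ideal I C x" unfolding PI_eq by (auto simp: \<epsilon>_mult)
  qed
  define \<xi> where "\<xi> v = coset (mp_var v - mp_const (x v))" for v
  have \<xi>P: "mp_var v - mp_const (x v) \<in> carrier P" if "v \<in> I" for v using that by simp
  have "\<not> regular_local_ring (localization_at A (point_ideal I C x))"
  proof (rule not_regular_local_ring[OF prime PI_eq \<epsilon>_mult D_add D_mult finite_u_index])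
    fix v assume v: "v \<in> I"
    show "\<xi> v \<in> point_ideal I C x" unfolding PI_eq \<xi>_def using \<epsilon>[OF \<xi>P[OF v]] repc(1)[OF \<xi>P[OF v]] by simp
    fix w
    interpret E: comm_ring_hom "E w" by (rule E)
    have "E w (mp_var v - mp_const (x v)) = line w v - [:x v:]"
      unfolding E_def by (simp add: E.hom_minus[unfolded E_def])
    then show "D (\<xi> v) w = (if w = v then 1 else 0)" unfolding \<xi>_def D[OF \<xi>P[OF v]] using v by (auto simp: line_def)
  next
    have "krull_dim A \<le> enat (2 * r + 1)" by (rule krull_dim_A)
    also have "\<dots> < enat (card I)" using r by (simp add: card_u_index)
    finally show "krull_dim A < enat (card I)" .
  qed
  then show ?thesis unfolding singular_at_def x_def[symmetric] using xC by simp
qed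

end

text \<open>For r = 1 the only condition is [u_1, u_1] = 0, which always holds: the variety is then
  affine 3-space and regular at every point. This is why the singularity statement starts at r =
  2.\<close>

theorem proposition7p1p1:
  fixes r :: nat
    and C :: "(nat \<times> nat \<times> nat \<Rightarrow> 'k::alg_closed_field) set"
  assumes "r \<ge> 1"
    and "C = commuting_variety r"
  shows "(zariski_irreducible (u_index r) C \<and> variety_dim (u_index r) C = enat (2 * r + 1)) \<and>
         (r \<ge> 2 \<longrightarrow> (\<forall>y. singular_at (u_index r) C (u_coords r (corner_tuple r y)))) \<and>
         (cohen_macaulay (coordinate_ring (u_index r) C) \<and>
          normal_domain (coordinate_ring (u_index r) C))"
proof (intro conjI impI allI)
  show "zariski_irreducible (u_index r) C"
    unfolding assms(2) by (rule zariski_irreducible_commuting_variety[OF infinite_UNIV_alg_closed])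
  show "variety_dim (u_index r) C = enat (2 * r + 1)"
    unfolding assms(2) using variety_dim_le variety_dim_ge infinite_UNIV_alg_closed assms(1) by (metis order.antisym)
  show "singular_at (u_index r) C (u_coords r (corner_tuple r y))" if "r \<ge> 2" for y
    by (rule singular_A[OF assms(2) that])
  show "cohen_macaulay (coordinate_ring (u_index r) C)"
    by (rule cohen_macaulay_A[OF assms(2,1)])
  show "normal_domain (coordinate_ring (u_index r) C)"
    by (rule normal_domain_A[OF assms(2)])
qed

end
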